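(* Assume the balanced setting: $G$ is balanced, all weights $a_{N,n}$ are radial, and all polynomials belong to $H(a_{N,n})_0(G)$ for all $N,n$. Consider the following statements. (i) $\operatorname{Proj}^1\mathcal{A}H=0$. (ii) $AH(G)$ is ultrabornological. (iii) $AH(G)$ is barrelled. (iv) $\mathcal{A}$ satisfies condition $(\mathrm{wQ})^{\sim}_{\mathrm{in}}$. Then (i)$\Rightarrow$(ii)$\Rightarrow$(iii)$\Rightarrow$(iv).
   Context: $\mathbb{N}=\{1,2,\dots\}$. $G$ is a non-empty open subset of $\mathbb{C}^d$, $d\geq 1$; $H(G)$ is the space of holomorphic functions on $G$, and co denotes the topology of uniform convergence on compact subsets of $G$. A weight on $G$ is a strictly positive continuous function on $G$. For a weight $a$: $Ha(G)=\{f\in H(G): \|f\|_a:=\sup_{z\in G}a(z)|f(z)|<\infty\}$, a Banach space with norm $\|\cdot\|_a$, and $Ha_0(G)=\{f\in H(G): a|f| \text{ vanishes at } \infty\text{ on } G\}$, a closed subspace. ($g\colon G\to\mathbb{R}$ vanishes at $\infty$ on $G$ if for each $\varepsilon>0$ there is a compact $K\subseteq G$ with $|g(z)|<\varepsilon$ for $z\in G\setminus K$.) $\mathcal{A}=((a_{N,n})_{n\in\mathbb{N}})_{N\in\mathbb{N}}$ is a double sequence of weights on $G$ with $a_{N,n+1}\leq a_{N,n}\leq a_{N+1,n}$ for all $N,n$. Put $\mathcal{A}_NH(G):=\operatorname{ind}_n Ha_{N,n}(G)$ (locally convex inductive limit). $\mathcal{A}H=(\mathcal{A}_NH(G))_{N\in\mathbb{N}}$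 is the projective spectrum with inclusions $\mathcal{A}_{N+1}H(G)\subseteq\mathcal{A}_NH(G)$ as linking maps, and $AH(G):=\operatorname{proj}_N\mathcal{A}_NH(G)$ is its locally convex projective limit. For a projective spectrum $\mathcal{X}=(X_N)_{N\in\mathbb{N}}$ with inclusions as linking maps, $\operatorname{Proj}^1\mathcal{X}:=\big(\prod_{N}X_N\big)/\operatorname{im}\sigma$, where $\sigma\colon\prod_N X_N\to\prod_N X_N$, $\sigma((x_N)_N)=(x_{N+1}-x_N)_N$. Balanced setting: $G$ is balanced ($\lambda z\in G$ for $z\in G$, $|\lambda|\leq 1$), each weight $a$ in $\mathcal{A}$ is radial ($a(\lambda z)=a(z)$ for $|\lambda|=1$), the Banach space topologies of the spaces $Ha_{N,n}(G)$ are stronger than co, and the polynomials are contained in all the spaces $H(a_{N,n})_0(G)$. For a strictly positive continuous function $w$ on $G$, $\tilde w(z)=(w)^{\sim}(z):=\sup\{|g(z)|: g\in H(G),\ |g|\leq w \text{ on } G\}$. Condition $(\mathrm{wQ})^{\sim}_{\mathrm{in}}$: for every $N$ there exist $M\geq N$ and $n$ such that for all $K\geq M$ and $m$ there exist $k$ and $S>0$ with $$\Big(\frac{1}{a_{M,m}}\Big)^{\sim}\leq S\max\Big(\Big(\frac{1}{a_{N,n}}\Big)^{\sim},\Big(\frac{1}{a_{K,k}}\Big)^{\sim}\Big)\quad\text{on } G.$$ *)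

theory Defs
  imports "HOL-Analysis.Analysis" "HOL-Library.Function_Algebras"
begin

section \<open>Complex vector spaces\<close>

class complex_vs = ab_group_add +
  fixes scaleC :: "complex \<Rightarrow> 'a \<Rightarrow> 'a"  (infixr "*\<^sub>C" 75)
  assumes scaleC_add_right: "c *\<^sub>C (x + y) = c *\<^sub>C x + c *\<^sub>C y"
    and scaleC_add_left: "(b + c) *\<^sub>C x = b *\<^sub>C x + c *\<^sub>C x"
    and scaleC_scaleC: "b *\<^sub>C c *\<^sub>C x = (b * c) *\<^sub>C x"
    and scaleC_one: "1 *\<^sub>C x = x"

global_interpretation complex_vs: vector_space "scaleC :: complex \<Rightarrow> 'a \<Rightarrow> 'a::complex_vs"
  by unfold_locales (fact scaleC_add_right scaleC_add_left scaleC_scaleC scaleC_one)+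

instantiation complex :: complex_vs
begin
definition scaleC_complex_def: "c *\<^sub>C (x::complex) = c * x"
instance by standard (simp_all add: scaleC_complex_def algebra_simps)
end

instantiation "fun" :: (type, complex_vs) complex_vs
begin
definition scaleC_fun_def: "c *\<^sub>C f = (\<lambda>x. c *\<^sub>C f x)"
instance
  by standard (simp_all add: scaleC_fun_def fun_eq_iff scaleC_add_right scaleC_add_left
      scaleC_scaleC scaleC_one)
end


section \<open>Locally convex spaces\<close>

text \<open>A locally convex space is given by a topology on a complex linear subspace
  of an ambient vector space; the subspace is the topspace. Hausdorffness is not part of the
  notion.\<close>

definition absolutely_convex :: "'a::complex_vs set \<Rightarrow> bool" where
  "absolutely_convex B \<longleftrightarrow> B \<noteq> {} \<and>
     (\<forall>x\<in>B. \<forall>y\<in>B. \<forall>b c. cmod b + cmod c \<le> 1 \<longrightarrow> b *\<^sub>C x + c *\<^sub>C y \<in> B)"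

definition zero_nhd :: "'a::complex_vs topology \<Rightarrow> 'a set \<Rightarrow> bool" where
  "zero_nhd T U \<longleftrightarrow> U \<subseteq> topspace T \<and> (\<exists>W. openin T W \<and> 0 \<in> W \<and> W \<subseteq> U)"

definition lcs :: "'a::complex_vs topology \<Rightarrow> bool" where
  "lcs T \<longleftrightarrow>
     complex_vs.subspace (topspace T) \<and>
     continuous_map (prod_topology T T) T (\<lambda>(x, y). x + y) \<and>
     continuous_map (prod_topology euclidean T) T (\<lambda>(c, x). c *\<^sub>C x) \<and>
     (\<forall>U. zero_nhd T U \<longrightarrow> (\<exists>W. zero_nhd T W \<and> absolutely_convex W \<and> W \<subseteq> U))"

definition absorbs :: "'a::complex_vs set \<Rightarrow> 'a set \<Rightarrow> bool" where
  "absorbs U B \<longleftrightarrow> (\<exists>r>0. B \<subseteq> (\<lambda>x. complex_of_real r *\<^sub>C x) ` U)"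

definition lc_bounded :: "'a::complex_vs topology \<Rightarrow> 'a set \<Rightarrow> bool" where
  "lc_bounded T B \<longleftrightarrow> B \<subseteq> topspace T \<and> (\<forall>U. zero_nhd T U \<longrightarrow> absorbs U B)"

definition barrel :: "'a::complex_vs topology \<Rightarrow> 'a set \<Rightarrow> bool" where
  "barrel T U \<longleftrightarrow> closedin T U \<and> absolutely_convex U \<and> (\<forall>x\<in>topspace T. absorbs U {x})"

definition barrelled :: "'a::complex_vs topology \<Rightarrow> bool" where
  "barrelled T \<longleftrightarrow> lcs T \<and> (\<forall>U. barrel T U \<longrightarrow> zero_nhd T U)"

text \<open>The distance induced by a norm \<open>p\<close> on the linear space \<open>V\<close>. It is set to zero off \<open>V\<close>
  because \<^locale>\<open>Metric_space\<close> asks for nonnegativity and symmetry on the whole type.\<close>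

definition norm_dist :: "'a::complex_vs set \<Rightarrow> ('a \<Rightarrow> real) \<Rightarrow> 'a \<Rightarrow> 'a \<Rightarrow> real" where
  "norm_dist V p x y = (if x \<in> V \<and> y \<in> V then p (x - y) else 0)"

definition minkowski :: "'a::complex_vs set \<Rightarrow> 'a \<Rightarrow> real" where
  "minkowski B x = Inf {r. r > 0 \<and> x \<in> (\<lambda>y. complex_of_real r *\<^sub>C y) ` B}"

text \<open>The Minkowski functional of an absolutely convex set is always a seminorm on the linear
  span, so the two conditions below say that it is a norm and that it is complete.
  Absorbing all Banach discs is the intrinsic form of being an inductive limit of Banach
  spaces.\<close>

definition banach_disc :: "'a::complex_vs topology \<Rightarrow> 'a set \<Rightarrow> bool" where
  "banach_disc T B \<longleftrightarrow> absolutely_convex B \<and> lc_bounded T B \<and>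
     Metric_space (complex_vs.span B) (norm_dist (complex_vs.span B) (minkowski B)) \<and>
     Metric_space.mcomplete (complex_vs.span B) (norm_dist (complex_vs.span B) (minkowski B))"

definition ultrabornological :: "'a::complex_vs topology \<Rightarrow> bool" where
  "ultrabornological T \<longleftrightarrow> lcs T \<and>
     (\<forall>U. U \<subseteq> topspace T \<and> absolutely_convex U \<and> (\<forall>B. banach_disc T B \<longrightarrow> absorbs U B)
       \<longrightarrow> zero_nhd T U)"

text \<open>The inductive limit of an increasing sequence of locally convex spaces carries the finest
  locally convex topology making all inclusions continuous, that is, the supremum of all locally
  convex topologies with this property. The projective limit of a decreasing sequence (with
  inclusions as linking maps) is the intersection with the coarsest topology making all
  inclusions continuous.\<close>

definition ind_lim :: "(nat \<Rightarrow> 'a::complex_vs topology) \<Rightarrow> 'a topology" where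
  "ind_lim E = topology_generated_by
     {U. \<exists>T. lcs T \<and> topspace T = (\<Union>n. topspace (E n)) \<and>
             (\<forall>n. continuous_map (E n) T (\<lambda>x. x)) \<and> openin T U}"

definition proj_lim :: "(nat \<Rightarrow> 'a topology) \<Rightarrow> 'a topology" where
  "proj_lim E = topology_generated_by
     {(\<Inter>N. topspace (E N)) \<inter> U | N U. openin (E N) U}"

text \<open>\<open>Proj\<^sup>1\<close> of a decreasing sequence \<open>X\<close> of linear spaces with inclusions as linking maps,
  as a set of cosets; the zero element of this quotient space is the coset \<open>im \<sigma>\<close>.\<close>

definition proj_sigma :: "(nat \<Rightarrow> 'a::complex_vs) \<Rightarrow> nat \<Rightarrow> 'a" where
  "proj_sigma x = (\<lambda>N. x (Suc N) - x N)"

definition Proj1 :: "(nat \<Rightarrow> 'a::complex_vs set) \<Rightarrow> (nat \<Rightarrow> 'a) set set" where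
  "Proj1 X = Pi UNIV X //
     {(x, y). x \<in> Pi UNIV X \<and> y \<in> Pi UNIV X \<and> x - y \<in> proj_sigma ` Pi UNIV X}"

definition Proj1_is_zero :: "(nat \<Rightarrow> 'a::complex_vs set) \<Rightarrow> bool" where
  "Proj1_is_zero X \<longleftrightarrow> Proj1 X = {proj_sigma ` Pi UNIV X}"


section \<open>Weighted spaces of holomorphic functions\<close>

text \<open>Functions on \<open>G\<close> are represented by functions on the whole space vanishing off \<open>G\<close>.
  Holomorphic means Frechet differentiable with complex linear derivative.\<close>

definition hol :: "(complex^'d) set \<Rightarrow> (complex^'d \<Rightarrow> complex) set" where
  "hol G = {f. (\<forall>z\<in>G. \<exists>D. (f has_derivative D) (at z) \<and> (\<forall>c v. D (c *s v) = c * D v)) \<and>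
               (\<forall>z. z \<notin> G \<longrightarrow> f z = 0)}"

definition co_topology :: "(complex^'d) set \<Rightarrow> (complex^'d \<Rightarrow> complex) topology" where
  "co_topology G = topology (\<lambda>U. U \<subseteq> hol G \<and>
     (\<forall>f\<in>U. \<exists>K e. compact K \<and> K \<subseteq> G \<and> e > 0 \<and> {g \<in> hol G. \<forall>z\<in>K. cmod (g z - f z) < e} \<subseteq> U))"

definition weight :: "(complex^'d) set \<Rightarrow> (complex^'d \<Rightarrow> real) \<Rightarrow> bool" where
  "weight G a \<longleftrightarrow> continuous_on G a \<and> (\<forall>z\<in>G. a z > 0)"

definition Ha :: "(complex^'d) set \<Rightarrow> (complex^'d \<Rightarrow> real) \<Rightarrow> (complex^'d \<Rightarrow> complex) set" where
  "Ha G a = {f \<in> hol G. bdd_above ((\<lambda>z. a z * cmod (f z)) ` G)}"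

definition Ha_norm ::
  "(complex^'d) set \<Rightarrow> (complex^'d \<Rightarrow> real) \<Rightarrow> (complex^'d \<Rightarrow> complex) \<Rightarrow> real" where
  "Ha_norm G a f = (SUP z\<in>G. a z * cmod (f z))"

definition Ha_topology ::
  "(complex^'d) set \<Rightarrow> (complex^'d \<Rightarrow> real) \<Rightarrow> (complex^'d \<Rightarrow> complex) topology" where
  "Ha_topology G a = Metric_space.mtopology (Ha G a) (norm_dist (Ha G a) (Ha_norm G a))"

definition vanishes_at_infinity :: "(complex^'d) set \<Rightarrow> (complex^'d \<Rightarrow> real) \<Rightarrow> bool" where
  "vanishes_at_infinity G g \<longleftrightarrow>
     (\<forall>e>0. \<exists>K. compact K \<and> K \<subseteq> G \<and> (\<forall>z\<in>G - K. \<bar>g z\<bar> < e))"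

definition Ha0 :: "(complex^'d) set \<Rightarrow> (complex^'d \<Rightarrow> real) \<Rightarrow> (complex^'d \<Rightarrow> complex) set" where
  "Ha0 G a = {f \<in> hol G. vanishes_at_infinity G (\<lambda>z. a z * cmod (f z))}"

text \<open>Double sequences are indexed from 0, and \<open>a N n\<close> stands for \<open>a\<^bsub>N,n\<^esub>\<close>.\<close>

definition weight_system :: "(complex^'d) set \<Rightarrow> (nat \<Rightarrow> nat \<Rightarrow> complex^'d \<Rightarrow> real) \<Rightarrow> bool" where
  "weight_system G a \<longleftrightarrow> (\<forall>N n. weight G (a N n)) \<and>
     (\<forall>N n. \<forall>z\<in>G. a N (Suc n) z \<le> a N n z \<and> a N n z \<le> a (Suc N) n z)"

definition ANH_space ::
  "(complex^'d) set \<Rightarrow> (nat \<Rightarrow> nat \<Rightarrow> complex^'d \<Rightarrow> real) \<Rightarrow> nat \<Rightarrow> (complex^'d \<Rightarrow> complex) set" where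
  "ANH_space G a N = (\<Union>n. Ha G (a N n))"

definition ANH ::
  "(complex^'d) set \<Rightarrow> (nat \<Rightarrow> nat \<Rightarrow> complex^'d \<Rightarrow> real) \<Rightarrow> nat \<Rightarrow> (complex^'d \<Rightarrow> complex) topology" where
  "ANH G a N = ind_lim (\<lambda>n. Ha_topology G (a N n))"

definition AH ::
  "(complex^'d) set \<Rightarrow> (nat \<Rightarrow> nat \<Rightarrow> complex^'d \<Rightarrow> real) \<Rightarrow> (complex^'d \<Rightarrow> complex) topology" where
  "AH G a = proj_lim (ANH G a)"

definition balanced :: "(complex^'d) set \<Rightarrow> bool" where
  "balanced G \<longleftrightarrow> (\<forall>z\<in>G. \<forall>c. cmod c \<le> 1 \<longrightarrow> c *s z \<in> G)"

definition radial :: "(complex^'d) set \<Rightarrow> (complex^'d \<Rightarrow> real) \<Rightarrow> bool" where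
  "radial G a \<longleftrightarrow> (\<forall>z\<in>G. \<forall>c. cmod c = 1 \<longrightarrow> a (c *s z) = a z)"

definition polynomial_fun :: "(complex^'d \<Rightarrow> complex) \<Rightarrow> bool" where
  "polynomial_fun p \<longleftrightarrow> (\<exists>(A :: ('d \<Rightarrow> nat) set) c. finite A \<and>
     p = (\<lambda>z. \<Sum>\<alpha>\<in>A. c \<alpha> * (\<Prod>i\<in>UNIV. (z $ i) ^ \<alpha> i)))"

definition balanced_setting :: "(complex^'d) set \<Rightarrow> (nat \<Rightarrow> nat \<Rightarrow> complex^'d \<Rightarrow> real) \<Rightarrow> bool" where
  "balanced_setting G a \<longleftrightarrow> balanced G \<and> (\<forall>N n. radial G (a N n)) \<and>
     (\<forall>N n. continuous_map (Ha_topology G (a N n)) (co_topology G) (\<lambda>f. f)) \<and>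
     (\<forall>N n p. polynomial_fun p \<longrightarrow> (\<lambda>z. if z \<in> G then p z else 0) \<in> Ha0 G (a N n))"

definition tilde :: "(complex^'d) set \<Rightarrow> (complex^'d \<Rightarrow> real) \<Rightarrow> complex^'d \<Rightarrow> real" where
  "tilde G w z = Sup {cmod (g z) | g. g \<in> hol G \<and> (\<forall>\<zeta>\<in>G. cmod (g \<zeta>) \<le> w \<zeta>)}"

definition wQ_in_tilde :: "(complex^'d) set \<Rightarrow> (nat \<Rightarrow> nat \<Rightarrow> complex^'d \<Rightarrow> real) \<Rightarrow> bool" where
  "wQ_in_tilde G a \<longleftrightarrow>
     (\<forall>N. \<exists>M\<ge>N. \<exists>n. \<forall>K\<ge>M. \<forall>m. \<exists>k. \<exists>S>0. \<forall>z\<in>G.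
        tilde G (\<lambda>\<zeta>. 1 / a M m \<zeta>) z
          \<le> S * max (tilde G (\<lambda>\<zeta>. 1 / a N n \<zeta>) z) (tilde G (\<lambda>\<zeta>. 1 / a K k \<zeta>) z))"

end

(* Vanishing of Proj1 implies ultrabornological. Baire's theorem, applied to the surjection
   sigma on the product of the steps with discrete topologies, yields discs W_k (finite
   intersections of balls of the first k steps) such that each W_k satisfies X_j <= XX + 4 W_k for
   some j, where XX is the projective limit. An absolutely convex U that absorbs all Banach discs
   absorbs XX cap W_k for some k, and U + W_k is a neighbourhood of zero in X_j that meets XX in a
   multiple of U.

   Ultrabornological implies barrelled because a barrel absorbs Banach discs by Baire's theorem.

   Barrelled implies the weight condition: if the condition fails, suitably normalised point
   evaluations are pointwise bounded on the projective limit, but their polar is not a neighbourhood of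
   zero. To see the latter one approximates pointwise by polynomials, which lie in
   the projective limit, at the cost of a factor 2 in the weighted norms. *)

theory Submission
  imports Defs "HOL-Complex_Analysis.Complex_Analysis"
begin

section \<open>Absolutely convex sets\<close>

text \<open>\<open>Proj1_is_zero\<close> is purely algebraic, and the steps need not be metrizable.
  Discrete topologies make the product of the steps completely metrizable, while the countability in
  Baire's theorem comes from writing each step as a countable union of balls.

  Baire's theorem gives decompositions only up to a closure, and \<open>U\<close> is not known to be
  closed in any topology. Each approximation is therefore made exact by a series with coefficients
  2^(-t), the error being doubled at every stage. This works because the discs in use are given by
  pointwise bounds, which such series respect up to the factor 2, and because the number of balls
  containing the t-th term grows with t, so that tails of the series reach every step. A difference
  of two points costs a factor 2 and summation another one: hence 2 and 4, 8 and 16.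

  For the weight condition, a ball of a single step contains functions outside the projective limit.
  A point evaluation sees one value only, so approximation at that point below a fixed multiple of
  the bound suffices.\<close>

abbreviation dil :: "real \<Rightarrow> 'a::complex_vs set \<Rightarrow> 'a set" where
  "dil r V \<equiv> (\<lambda>x. complex_of_real r *\<^sub>C x) ` V"

lemma absolutely_convex_zero: "absolutely_convex B \<Longrightarrow> 0 \<in> B"
  unfolding absolutely_convex_def
  by (metis add.right_neutral all_not_in_conv complex_vs.scale_zero_left norm_zero zero_less_one less_imp_le)

lemma absolutely_convex_scale: "absolutely_convex B \<Longrightarrow> x \<in> B \<Longrightarrow> cmod c \<le> 1 \<Longrightarrow> c *\<^sub>C x \<in> B"
  unfolding absolutely_convex_def
  by (metis add.right_neutral complex_vs.scale_zero_left norm_zero)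

lemma mem_dil_iff: "r > 0 \<Longrightarrow> x \<in> dil r V \<longleftrightarrow> complex_of_real (1 / r) *\<^sub>C x \<in> V"
proof
  assume r: "r > 0" and "x \<in> dil r V"
  then show "complex_of_real (1 / r) *\<^sub>C x \<in> V"
    by (auto simp: scaleC_scaleC simp flip: of_real_mult of_real_divide)
next
  assume r: "r > 0" and "complex_of_real (1 / r) *\<^sub>C x \<in> V"
  then have "complex_of_real r *\<^sub>C complex_of_real (1 / r) *\<^sub>C x \<in> dil r V" by blast
  with r show "x \<in> dil r V"
    by (simp add: scaleC_scaleC flip: of_real_mult of_real_divide)
qed

lemma dil_add:
  assumes V: "absolutely_convex V" and x: "x \<in> dil s V" and y: "y \<in> dil t V"
    and st: "s \<ge> 0" "t \<ge> 0"
  shows "x + y \<in> dil (s + t) V"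
proof -
  obtain v w where v: "v \<in> V" "x = complex_of_real s *\<^sub>C v" and w: "w \<in> V" "y = complex_of_real t *\<^sub>C w"
    using x y by auto
  show ?thesis
  proof (cases "s + t = 0")
    case True
    then have "s = 0" "t = 0" using st by auto
    then show ?thesis using v w by auto
  next
    case False
    then have pos: "s + t > 0" using st by auto
    have "cmod (complex_of_real (s / (s + t))) + cmod (complex_of_real (t / (s + t))) \<le> 1"
      unfolding norm_of_real using st pos by (simp add: field_simps)
    then have "complex_of_real (s / (s + t)) *\<^sub>C v + complex_of_real (t / (s + t)) *\<^sub>C w \<in> V"
      using V v w unfolding absolutely_convex_def by blast
    then have "complex_of_real (s + t) *\<^sub>C
      (complex_of_real (s / (s + t)) *\<^sub>C v + complex_of_real (t / (s + t)) *\<^sub>C w) \<in> dil (s + t) V"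
      by blast
    also have "complex_of_real (s + t) *\<^sub>C
      (complex_of_real (s / (s + t)) *\<^sub>C v + complex_of_real (t / (s + t)) *\<^sub>C w) = x + y"
      using pos v w
      by (simp add: scaleC_add_right scaleC_scaleC del: of_real_add of_real_divide flip: of_real_mult)
    finally show ?thesis .
  qed
qed

text \<open>Absolute convexity contains invariance under rotation and shrinking, so only the modulus
  of \<open>c\<close> counts. The case \<open>t = 0\<close> is separate because the proof divides by
  \<open>t\<close>.\<close>

lemma dil_scale:
  assumes V: "absolutely_convex V" and x: "x \<in> dil s V" and "s \<ge> 0" and le: "cmod c * s \<le> t"
  shows "c *\<^sub>C x \<in> dil t V"
proof -
  obtain v where v: "v \<in> V" "x = complex_of_real s *\<^sub>C v"
    using x by auto
  have t: "t \<ge> 0" using le \<open>s \<ge> 0\<close> by (meson mult_nonneg_nonneg norm_ge_zero order_trans)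
  show ?thesis
  proof (cases "t = 0")
    case True
    then have "c * complex_of_real s = 0"
      using le \<open>s \<ge> 0\<close> by (metis antisym mult_eq_0_iff mult_nonneg_nonneg norm_eq_zero norm_ge_zero of_real_0)
    then have "c *\<^sub>C x = complex_of_real t *\<^sub>C 0" using v True by (simp add: scaleC_scaleC)
    then show ?thesis using absolutely_convex_zero[OF V] by blast
  next
    case False
    then have "cmod (c * complex_of_real s / complex_of_real t) \<le> 1"
      using t le \<open>s \<ge> 0\<close> by (simp add: norm_mult norm_divide field_simps)
    then have "(c * complex_of_real s / complex_of_real t) *\<^sub>C v \<in> V"
      using absolutely_convex_scale[OF V] v by blast
    then have "complex_of_real t *\<^sub>C (c * complex_of_real s / complex_of_real t) *\<^sub>C v \<in> dil t V"
      by blast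
    then show ?thesis using False v by (simp add: scaleC_scaleC)
  qed
qed

lemma dil_mono: "absolutely_convex V \<Longrightarrow> 0 \<le> s \<Longrightarrow> s \<le> t \<Longrightarrow> dil s V \<subseteq> dil t V"
  using dil_scale[of V _ s 1 t] by (auto simp: scaleC_one)

lemma dil_one [simp]: "dil 1 V = V"
  by (simp add: scaleC_one)

lemma dil_dil: "dil r (dil s V) = dil (r * s) V"
  by (simp add: image_image scaleC_scaleC)

lemma absolutely_convex_dil:
  assumes V: "absolutely_convex V" and r: "r \<ge> 0"
  shows "absolutely_convex (dil r V)"
  unfolding absolutely_convex_def
proof (intro conjI ballI allI impI)
  show "dil r V \<noteq> {}" using V by (simp add: absolutely_convex_def)
  fix x y b c assume x: "x \<in> dil r V" and y: "y \<in> dil r V" and bc: "cmod b + cmod c \<le> 1"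
  have "b *\<^sub>C x + c *\<^sub>C y \<in> dil (cmod b * r + cmod c * r) V"
    using r by (intro dil_add[OF V] dil_scale[OF V x] dil_scale[OF V y]) auto
  moreover have "cmod b * r + cmod c * r \<le> r"
    using mult_right_mono[OF bc r] by (simp add: algebra_simps)
  ultimately show "b *\<^sub>C x + c *\<^sub>C y \<in> dil r V"
    using dil_mono[OF V, of "cmod b * r + cmod c * r" r] r by auto
qed

lemma absolutely_convex_Int:
  "absolutely_convex A \<Longrightarrow> absolutely_convex B \<Longrightarrow> absolutely_convex (A \<inter> B)"
  using absolutely_convex_zero[of A] absolutely_convex_zero[of B]
  unfolding absolutely_convex_def by blast

lemma absolutely_convex_subspace: "complex_vs.subspace E \<Longrightarrow> absolutely_convex E"
  unfolding absolutely_convex_def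
  by (meson complex_vs.subspace_0 complex_vs.subspace_add complex_vs.subspace_scale empty_iff)

text \<open>The union of the dilates is already a subspace, since dilates add by convexity. Hence
  the set in the definition of \<open>minkowski\<close> is non-empty exactly on the span.\<close>

lemma span_absolutely_convex:
  assumes B: "absolutely_convex B"
  shows "complex_vs.span B = (\<Union>r\<in>{0<..}. dil r B)"
proof
  have "complex_vs.subspace (\<Union>r\<in>{0<..}. dil r B)"
  proof (rule complex_vs.subspaceI)
    have "0 \<in> dil 1 B" using absolutely_convex_zero[OF B] by simp
    then show "0 \<in> (\<Union>r\<in>{0<..}. dil r B)" by (intro UN_I[of 1]) simp_all
  next
    fix x y assume "x \<in> (\<Union>r\<in>{0<..}. dil r B)" "y \<in> (\<Union>r\<in>{0<..}. dil r B)"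
    then obtain r s where rs: "r > 0" "s > 0" "x \<in> dil r B" "y \<in> dil s B" by auto
    then have "x + y \<in> dil (r + s) B" using dil_add[OF B] by simp
    then show "x + y \<in> (\<Union>r\<in>{0<..}. dil r B)"
      using rs by (intro UN_I[of "r + s"]) auto
  next
    fix c x assume "x \<in> (\<Union>r\<in>{0<..}. dil r B)"
    then obtain r where r: "r > 0" "x \<in> dil r B" by auto
    then have "c *\<^sub>C x \<in> dil (cmod c * r + 1) B" by (intro dil_scale[OF B, of x r]) auto
    moreover have "cmod c * r + 1 > 0" using r by (simp add: add_nonneg_pos)
    ultimately show "c *\<^sub>C x \<in> (\<Union>r\<in>{0<..}. dil r B)"
      by (intro UN_I[of "cmod c * r + 1"]) auto
  qed
  moreover have "B \<subseteq> (\<Union>r\<in>{0<..}. dil r B)"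
    by (rule order_trans[OF _ UN_upper[of 1]]) auto
  ultimately show "complex_vs.span B \<subseteq> (\<Union>r\<in>{0<..}. dil r B)"
    by (rule complex_vs.span_minimal[rotated])
  show "(\<Union>r\<in>{0<..}. dil r B) \<subseteq> complex_vs.span B"
    by (auto intro: complex_vs.span_scale complex_vs.span_base)
qed

lemma minkowski_le: "r > 0 \<Longrightarrow> x \<in> dil r B \<Longrightarrow> minkowski B x \<le> r"
  unfolding minkowski_def by (rule cInf_lower) (auto intro: bdd_belowI[of _ 0])

lemma minkowski_less_imp:
  assumes B: "absolutely_convex B" and x: "x \<in> complex_vs.span B" and less: "minkowski B x < r"
  shows "x \<in> dil r B"
proof -
  have "{r. r > 0 \<and> x \<in> dil r B} \<noteq> {}"
    using x span_absolutely_convex[OF B] by auto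
  from cInf_lessD[OF this less[unfolded minkowski_def]]
  obtain s where "s > 0" "x \<in> dil s B" "s < r" by auto
  then show ?thesis using dil_mono[OF B, of s r] by auto
qed

lemma minkowski_nonneg: "absolutely_convex B \<Longrightarrow> x \<in> complex_vs.span B \<Longrightarrow> 0 \<le> minkowski B x"
  unfolding minkowski_def span_absolutely_convex by (rule cInf_greatest) auto

lemma absorbsI: "r > 0 \<Longrightarrow> (\<And>x. x \<in> B \<Longrightarrow> x \<in> dil r U) \<Longrightarrow> absorbs U B"
  unfolding absorbs_def by blast


section \<open>Locally convex topologies\<close>

text \<open>The seminorm topology of the Minkowski functional of \<open>V\<close>, written with
  translates of dilates so that no infimum enters. It supplies test topologies for the inductive
  limit, whose definition refers to all locally convex topologies.\<close>

definition gauge_topology :: "'a::complex_vs set \<Rightarrow> 'a set \<Rightarrow> 'a topology" where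
  "gauge_topology E V = topology (\<lambda>W. W \<subseteq> E \<and> (\<forall>x\<in>W. \<exists>r>0. \<forall>v\<in>dil r V. x + v \<in> W))"

locale absorbing_disc =
  fixes E V :: "'a::complex_vs set"
  assumes subspace: "complex_vs.subspace E" and V: "absolutely_convex V" "V \<subseteq> E"
    and absorbing: "\<And>x. x \<in> E \<Longrightarrow> \<exists>r>0. x \<in> dil r V"
begin

lemma openin_gauge_topology:
  "openin (gauge_topology E V) W \<longleftrightarrow> W \<subseteq> E \<and> (\<forall>x\<in>W. \<exists>r>0. \<forall>v\<in>dil r V. x + v \<in> W)"
proof -
  have "istopology (\<lambda>W. W \<subseteq> E \<and> (\<forall>x\<in>W. \<exists>r>0. \<forall>v\<in>dil r V. x + v \<in> W))"
    unfolding istopology_def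
  proof (rule conjI; intro allI impI)
    fix S T
    assume S: "S \<subseteq> E \<and> (\<forall>x\<in>S. \<exists>r>0. \<forall>v\<in>dil r V. x + v \<in> S)"
      and T: "T \<subseteq> E \<and> (\<forall>x\<in>T. \<exists>r>0. \<forall>v\<in>dil r V. x + v \<in> T)"
    show "S \<inter> T \<subseteq> E \<and> (\<forall>x\<in>S \<inter> T. \<exists>r>0. \<forall>v\<in>dil r V. x + v \<in> S \<inter> T)"
    proof (intro conjI ballI)
      show "S \<inter> T \<subseteq> E" using S by blast
      fix x assume "x \<in> S \<inter> T"
      then obtain r s where r: "r > 0" "\<forall>v\<in>dil r V. x + v \<in> S" and s: "s > 0" "\<forall>v\<in>dil s V. x + v \<in> T"
        using S T by blast
      have "dil (min r s) V \<subseteq> dil r V" "dil (min r s) V \<subseteq> dil s V"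
        using r s by (intro dil_mono[OF V(1)]; simp)+
      then show "\<exists>r>0. \<forall>v\<in>dil r V. x + v \<in> S \<inter> T"
        using r s by (intro exI[of _ "min r s"]) auto
    qed
  next
    fix K assume K: "\<forall>S\<in>K. S \<subseteq> E \<and> (\<forall>x\<in>S. \<exists>r>0. \<forall>v\<in>dil r V. x + v \<in> S)"
    then show "\<Union>K \<subseteq> E \<and> (\<forall>x\<in>\<Union>K. \<exists>r>0. \<forall>v\<in>dil r V. x + v \<in> \<Union>K)"
      by (meson Sup_le_iff Union_iff)
  qed
  then show ?thesis unfolding gauge_topology_def by (simp add: topology_inverse')
qed

lemma dil_subset: "dil r V \<subseteq> E"
  using V(2) by (auto intro: complex_vs.subspace_scale[OF subspace])

lemma topspace_gauge_topology [simp]: "topspace (gauge_topology E V) = E"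
proof -
  have "openin (gauge_topology E V) E"
    unfolding openin_gauge_topology
    using dil_subset complex_vs.subspace_add[OF subspace] by (auto intro!: exI[of _ 1])
  then show ?thesis
    by (meson openin_gauge_topology openin_subset openin_topspace subset_antisym)
qed

text \<open>The open ball of the Minkowski functional. The strict inequality \<open>s < r\<close>
  leaves the room that makes it open; a translate of \<open>dil r V\<close> itself may fail to be
  open.\<close>

definition gball :: "'a \<Rightarrow> real \<Rightarrow> 'a set" where
  "gball x r = {y. \<exists>s. 0 < s \<and> s < r \<and> y - x \<in> dil s V}"

lemma centre_in_gball: "r > 0 \<Longrightarrow> x \<in> gball x r"
proof -
  assume "r > 0"
  moreover have "x - x \<in> dil (r / 2) V"
    using absolutely_convex_zero[OF V(1)] by force
  ultimately show ?thesis unfolding gball_def by (intro CollectI exI[of _ "r / 2"]) auto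
qed

lemma gball_subset: "x \<in> E \<Longrightarrow> gball x r \<subseteq> E"
  unfolding gball_def using dil_subset complex_vs.subspace_add[OF subspace]
  by (smt (verit) diff_add_cancel mem_Collect_eq subset_iff)

lemma openin_gball:
  assumes x: "x \<in> E"
  shows "openin (gauge_topology E V) (gball x r)"
  unfolding openin_gauge_topology
proof (intro conjI ballI)
  show "gball x r \<subseteq> E" by (rule gball_subset[OF x])
  fix y assume "y \<in> gball x r"
  then obtain s where s: "0 < s" "s < r" "y - x \<in> dil s V" unfolding gball_def by auto
  show "\<exists>r'>0. \<forall>v\<in>dil r' V. y + v \<in> gball x r"
  proof (intro exI[of _ "(r - s) / 2"] conjI ballI)
    show "(r - s) / 2 > 0" using s by simp
    fix v assume "v \<in> dil ((r - s) / 2) V"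
    then have "(y - x) + v \<in> dil (s + (r - s) / 2) V"
      using s by (intro dil_add[OF V(1)]) auto
    then show "y + v \<in> gball x r"
      unfolding gball_def using s
      by (intro CollectI exI[of _ "s + (r - s) / 2"]) (auto simp: field_simps)
  qed
qed

lemma lcs_gauge_topology: "lcs (gauge_topology E V)"
  unfolding lcs_def topspace_gauge_topology
proof (intro conjI allI impI)
  let ?T = "gauge_topology E V"
  show "complex_vs.subspace E" by (rule subspace)
  show "continuous_map (prod_topology ?T ?T) ?T (\<lambda>(x, y). x + y)"
    unfolding continuous_map_def
  proof (intro conjI allI impI)
    show "(\<lambda>(x, y). x + y) \<in> topspace (prod_topology ?T ?T) \<rightarrow> topspace ?T"
      using complex_vs.subspace_add[OF subspace] by auto
    fix W assume W: "openin ?T W"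
    show "openin (prod_topology ?T ?T) {p \<in> topspace (prod_topology ?T ?T). (case p of (x, y) \<Rightarrow> x + y) \<in> W}"
      unfolding openin_prod_topology_alt
    proof (intro allI impI)
      fix x y assume "(x, y) \<in> {p \<in> topspace (prod_topology ?T ?T). (case p of (x, y) \<Rightarrow> x + y) \<in> W}"
      then have xy: "x \<in> E" "y \<in> E" "x + y \<in> W" by auto
      then obtain r where r: "r > 0" "\<forall>v\<in>dil r V. x + y + v \<in> W"
        using W openin_gauge_topology by blast
      have "x' + y' \<in> W" if x': "x' \<in> gball x (r / 2)" and y': "y' \<in> gball y (r / 2)" for x' y'
      proof -
        obtain s t where st: "0 < s" "s < r / 2" "x' - x \<in> dil s V" "0 < t" "t < r / 2" "y' - y \<in> dil t V"
          using x' y' unfolding gball_def by auto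
        then have "(x' - x) + (y' - y) \<in> dil (s + t) V" by (intro dil_add[OF V(1)]) auto
        then have "(x' - x) + (y' - y) \<in> dil r V" using dil_mono[OF V(1), of "s + t" r] st by auto
        then have "x + y + ((x' - x) + (y' - y)) \<in> W" using r by blast
        then show ?thesis by (simp add: algebra_simps)
      qed
      then show "\<exists>U V. openin ?T U \<and> openin ?T V \<and> x \<in> U \<and> y \<in> V \<and>
          U \<times> V \<subseteq> {p \<in> topspace (prod_topology ?T ?T). (case p of (x, y) \<Rightarrow> x + y) \<in> W}"
        using xy r gball_subset[of x "r / 2"] gball_subset[of y "r / 2"]
          centre_in_gball[of "r/2" x] centre_in_gball[of "r/2" y]
        by (intro exI[of _ "gball x (r / 2)"] exI[of _ "gball y (r / 2)"])
          (auto simp: openin_gball simp del: image_iff)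
    qed
  qed
  show "continuous_map (prod_topology euclidean ?T) ?T (\<lambda>(c, x). c *\<^sub>C x)"
    unfolding continuous_map_def
  proof (intro conjI allI impI)
    show "(\<lambda>(c, x). c *\<^sub>C x) \<in> topspace (prod_topology euclidean ?T) \<rightarrow> topspace ?T"
      using complex_vs.subspace_scale[OF subspace] by auto
    fix W assume W: "openin ?T W"
    show "openin (prod_topology euclidean ?T)
      {p \<in> topspace (prod_topology euclidean ?T). (case p of (c, x) \<Rightarrow> c *\<^sub>C x) \<in> W}"
      unfolding openin_prod_topology_alt
    proof (intro allI impI)
      fix c :: complex and x
      assume "(c, x) \<in> {p \<in> topspace (prod_topology euclidean ?T). (case p of (c, x) \<Rightarrow> c *\<^sub>C x) \<in> W}"
      then have cx: "x \<in> E" "c *\<^sub>C x \<in> W" by auto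
      then obtain r where r: "r > 0" "\<forall>v\<in>dil r V. c *\<^sub>C x + v \<in> W"
        using W openin_gauge_topology by blast
      obtain k where k: "k > 0" "x \<in> dil k V" using absorbing cx by blast
      \<comment> \<open>Bounds for the splitting of \<open>c' x' - c x\<close> into
        \<open>c' (x' - x)\<close> and \<open>(c' - c) x\<close>, each of which is to lie in
        \<open>dil (r / 2) V\<close>. The cap 1 in \<open>e\<close> gives
        \<open>cmod c' \<le> cmod c + 1\<close>, whence the denominator of
        \<open>e'\<close>.\<close>
      define e where "e = min 1 (r / (2 * k))"
      define e' where "e' = r / (2 * (cmod c + 1))"
      have e: "e > 0" "e \<le> 1" "e * k \<le> r / 2" using r k by (auto simp: e_def field_simps min_def)
      have c1: "cmod c + 1 > 0" by (simp add: add_nonneg_pos)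
      then have e': "e' > 0" "(cmod c + 1) * e' = r / 2" using r by (auto simp: e'_def field_simps)
      have "c' *\<^sub>C x' \<in> W" if c': "c' \<in> ball c e" and x': "x' \<in> gball x e'" for c' x'
      proof -
        obtain s where s: "0 < s" "s < e'" "x' - x \<in> dil s V"
          using x' unfolding gball_def by auto
        have d: "cmod (c' - c) < e" using c' by (simp add: dist_norm norm_minus_commute)
        have "cmod c' \<le> cmod c + cmod (c' - c)" by (metis add.commute diff_add_cancel norm_triangle_ineq)
        then have "cmod c' \<le> cmod c + 1" using d e by linarith
        then have "cmod c' * s \<le> r / 2"
          using s e' mult_mono[of "cmod c'" "cmod c + 1" s e'] c1 by simp
        then have 1: "c' *\<^sub>C (x' - x) \<in> dil (r / 2) V"
          using s by (intro dil_scale[OF V(1) s(3)]) auto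
        have "cmod (c' - c) * k \<le> e * k" using d k by (intro mult_right_mono) auto
        then have "cmod (c' - c) * k \<le> r / 2" using e by linarith
        then have 2: "(c' - c) *\<^sub>C x \<in> dil (r / 2) V"
          using k by (intro dil_scale[OF V(1) k(2)]) simp_all
        have "c' *\<^sub>C (x' - x) + (c' - c) *\<^sub>C x \<in> dil (r / 2 + r / 2) V"
          using r by (intro dil_add[OF V(1) 1 2]) auto
        then have "c' *\<^sub>C (x' - x) + (c' - c) *\<^sub>C x \<in> dil r V" by simp
        then have "c *\<^sub>C x + (c' *\<^sub>C (x' - x) + (c' - c) *\<^sub>C x) \<in> W" using r(2) by blast
        then show ?thesis
          by (simp add: complex_vs.scale_right_diff_distrib complex_vs.scale_left_diff_distrib)
      qed
      then show "\<exists>U V. openin euclidean U \<and> openin ?T V \<and> c \<in> U \<and> x \<in> V \<and>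
          U \<times> V \<subseteq> {p \<in> topspace (prod_topology euclidean ?T). (case p of (c, x) \<Rightarrow> c *\<^sub>C x) \<in> W}"
        using cx e e' gball_subset[of x e'] centre_in_gball[of e' x]
        by (intro exI[of _ "ball c e"] exI[of _ "gball x e'"]) (auto simp: openin_gball)
    qed
  qed
  fix U assume "zero_nhd ?T U"
  then obtain W where W: "openin ?T W" "0 \<in> W" "W \<subseteq> U" unfolding zero_nhd_def by blast
  then obtain r where r: "r > 0" "\<forall>v\<in>dil r V. 0 + v \<in> W"
    using openin_gauge_topology by blast
  have "gball 0 r \<subseteq> dil r V" unfolding gball_def using dil_mono[OF V(1)]
    by (smt (verit) diff_0_right less_imp_le mem_Collect_eq subset_iff)
  then have "zero_nhd ?T (dil r V)"
    unfolding zero_nhd_def using dil_subset openin_gball[of 0 r] centre_in_gball r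
      complex_vs.subspace_0[OF subspace] by auto
  then show "\<exists>W. zero_nhd ?T W \<and> absolutely_convex W \<and> W \<subseteq> U"
    using r W absolutely_convex_dil[OF V(1), of r] by (intro exI[of _ "dil r V"]) auto
qed

lemma zero_nhd_gauge_topology: "zero_nhd (gauge_topology E V) V"
proof -
  have "gball 0 1 \<subseteq> V" unfolding gball_def using dil_mono[OF V(1), of _ 1]
    by (smt (verit) diff_0_right dil_one mem_Collect_eq subset_iff)
  then show ?thesis
    unfolding zero_nhd_def using V(2) openin_gball[of 0 1] centre_in_gball[of 1 0]
      complex_vs.subspace_0[OF subspace] by auto
qed

end

text \<open>Serves both limits. For the inductive limit all \<open>T\<close> have topspace
  \<open>E\<close> and the result is their supremum; for the projective limit the traces on
  \<open>E\<close> give the initial topology of the inclusions. Continuity of the vector operations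
  is tested on subbasic sets, where it reduces to \<open>T\<close> through the continuous
  inclusion.\<close>

lemma lcs_generated:
  fixes E :: "'a::complex_vs set"
  assumes E: "complex_vs.subspace E" and ne: "\<T> \<noteq> {}"
    and lcs: "\<And>T. T \<in> \<T> \<Longrightarrow> lcs T" and sub: "\<And>T. T \<in> \<T> \<Longrightarrow> E \<subseteq> topspace T"
  defines "S \<equiv> {E \<inter> U | U. \<exists>T\<in>\<T>. openin T U}"
  shows "topspace (topology_generated_by S) = E" "lcs (topology_generated_by S)"
proof -
  let ?T = "topology_generated_by S"
  show top: "topspace ?T = E"
  proof -
    obtain T where T: "T \<in> \<T>" using ne by blast
    then have "E \<inter> topspace T \<in> S" unfolding S_def by blast
    moreover have "E \<inter> topspace T = E" using sub[OF T] by blast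
    moreover have "\<Union>S \<subseteq> E" unfolding S_def by blast
    ultimately show ?thesis by (metis Union_upper subset_antisym topology_generated_by_topspace)
  qed
  have id: "continuous_map ?T T (\<lambda>x. x)" if T: "T \<in> \<T>" for T
    unfolding continuous_map_def
  proof (intro conjI allI impI)
    show "(\<lambda>x. x) \<in> topspace ?T \<rightarrow> topspace T" using sub[OF T] top by auto
    fix U assume "openin T U"
    then have "E \<inter> U \<in> S" using T unfolding S_def by blast
    moreover have "{x \<in> topspace ?T. x \<in> U} = E \<inter> U" using top by blast
    ultimately show "openin ?T {x \<in> topspace ?T. x \<in> U}"
      by (metis topology_generated_by_Basis)
  qed
  show "lcs ?T"
    unfolding lcs_def
  proof (intro conjI allI impI)
    show "complex_vs.subspace (topspace ?T)" using E top by simp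
    show "continuous_map (prod_topology ?T ?T) ?T (\<lambda>(x, y). x + y)"
    proof (rule continuous_on_generated_topo)
      show "(\<lambda>(x, y). x + y) ` topspace (prod_topology ?T ?T) \<subseteq> \<Union>S"
        using top complex_vs.subspace_add[OF E] unfolding topology_generated_by_topspace by auto
      fix U assume "U \<in> S"
      then obtain U' T where U: "U = E \<inter> U'" "T \<in> \<T>" "openin T U'" unfolding S_def by blast
      have c: "continuous_map (prod_topology ?T ?T) T (\<lambda>(x, y). x + y)"
      proof -
        have "continuous_map (prod_topology ?T ?T) (prod_topology T T) (\<lambda>(x,y). (x, y))"
          unfolding continuous_map_prod_top using id[OF U(2)] by blast
        then have "continuous_map (prod_topology ?T ?T) T ((\<lambda>(x, y). x + y) \<circ> (\<lambda>(x,y). (x, y)))"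
          using lcs[OF U(2)] unfolding lcs_def by (meson continuous_map_compose)
        then show ?thesis by (simp add: o_def case_prod_unfold)
      qed
      have eq: "(\<lambda>(x, y). x + y) -` U \<inter> topspace (prod_topology ?T ?T)
          = {p \<in> topspace (prod_topology ?T ?T). (case p of (x, y) \<Rightarrow> x + y) \<in> U'}"
        unfolding U(1) topspace_prod_topology top using complex_vs.subspace_add[OF E] by auto
      show "openin (prod_topology ?T ?T) ((\<lambda>(x, y). x + y) -` U \<inter> topspace (prod_topology ?T ?T))"
        unfolding eq by (rule openin_continuous_map_preimage[OF c U(3)])
    qed
    show "continuous_map (prod_topology euclidean ?T) ?T (\<lambda>(c, x). c *\<^sub>C x)"
    proof (rule continuous_on_generated_topo)
      show "(\<lambda>(c, x). c *\<^sub>C x) ` topspace (prod_topology euclidean ?T) \<subseteq> \<Union>S"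
        using top complex_vs.subspace_scale[OF E] unfolding topology_generated_by_topspace by auto
      fix U assume "U \<in> S"
      then obtain U' T where U: "U = E \<inter> U'" "T \<in> \<T>" "openin T U'" unfolding S_def by blast
      have c: "continuous_map (prod_topology euclidean ?T) T (\<lambda>(c, x). c *\<^sub>C x)"
      proof -
        have "continuous_map (prod_topology (euclidean :: complex topology) ?T) (prod_topology euclidean T) (\<lambda>(x,y). (x, y))"
          unfolding continuous_map_prod_top using id[OF U(2)] by auto
        then have "continuous_map (prod_topology euclidean ?T) T ((\<lambda>(c, x). c *\<^sub>C x) \<circ> (\<lambda>(x,y). (x, y)))"
          using lcs[OF U(2)] unfolding lcs_def by (meson continuous_map_compose)
        then show ?thesis by (simp add: o_def case_prod_unfold)
      qed
      have eq: "(\<lambda>(c, x). c *\<^sub>C x) -` U \<inter> topspace (prod_topology euclidean ?T)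
          = {p \<in> topspace (prod_topology euclidean ?T). (case p of (c, x) \<Rightarrow> c *\<^sub>C x) \<in> U'}"
        unfolding U(1) topspace_prod_topology top using complex_vs.subspace_scale[OF E] by auto
      show "openin (prod_topology euclidean ?T) ((\<lambda>(c, x). c *\<^sub>C x) -` U \<inter> topspace (prod_topology euclidean ?T))"
        unfolding eq by (rule openin_continuous_map_preimage[OF c U(3)])
    qed
    fix U assume "zero_nhd ?T U"
    then obtain W where W: "openin ?T W" "0 \<in> W" "W \<subseteq> U" unfolding zero_nhd_def by blast
    \<comment> \<open>Induction over the generation of \<open>W\<close>: finite intersections
      preserve absolute convexity, and for unions one member containing 0 suffices.\<close>
    from W(1) have "generate_topology_on S W" by (simp add: openin_topology_generated_by_iff)
    then have "0 \<in> W \<Longrightarrow> \<exists>A. zero_nhd ?T A \<and> absolutely_convex A \<and> A \<subseteq> W"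
    proof induction
      case Empty
      then show ?case by simp
    next
      case (Int a b)
      then obtain A B where AB: "zero_nhd ?T A" "absolutely_convex A" "A \<subseteq> a"
        "zero_nhd ?T B" "absolutely_convex B" "B \<subseteq> b" by auto
      have "zero_nhd ?T (A \<inter> B)"
        using AB(1,4) unfolding zero_nhd_def by (metis Int_iff Int_mono le_infI1 openin_Int)
      then show ?case using AB absolutely_convex_Int[of A B] by (intro exI[of _ "A \<inter> B"]) auto
    next
      case (UN K)
      then obtain k where "k \<in> K" "0 \<in> k" by blast
      then show ?case using UN.IH[of k] by blast
    next
      case (Basis s)
      then obtain U T where U: "s = E \<inter> U" "T \<in> \<T>" "openin T U" unfolding S_def by blast
      have "zero_nhd T U" unfolding zero_nhd_def using U Basis openin_subset by blast
      then obtain A where A: "zero_nhd T A" "absolutely_convex A" "A \<subseteq> U"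
        using lcs[OF U(2)] unfolding lcs_def by blast
      then obtain A' where A': "openin T A'" "0 \<in> A'" "A' \<subseteq> A" unfolding zero_nhd_def by blast
      have "openin ?T (E \<inter> A')" using A' U(2) by (auto simp: S_def intro!: topology_generated_by_Basis)
      then have "zero_nhd ?T (E \<inter> A)"
        unfolding zero_nhd_def using A' complex_vs.subspace_0[OF E] top by blast
      then show ?case using A absolutely_convex_Int[OF absolutely_convex_subspace[OF E] A(2)] U
        by (intro exI[of _ "E \<inter> A"]) auto
    qed
    then show "\<exists>A. zero_nhd ?T A \<and> absolutely_convex A \<and> A \<subseteq> U" using W by blast
  qed
qed

lemma continuous_map_translation:
  assumes T: "lcs T" and "x \<in> topspace T"
  shows "continuous_map T T (\<lambda>y. x + y)"
proof -
  have "continuous_map T (prod_topology T T) (\<lambda>y. (x, y))"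
    using assms by (simp add: continuous_map_pairedI)
  then have "continuous_map T T ((\<lambda>(x, y). x + y) \<circ> (\<lambda>y. (x, y)))"
    using T unfolding lcs_def by (meson continuous_map_compose)
  then show ?thesis by (simp add: o_def)
qed

lemma continuous_map_scaling:
  assumes T: "lcs T"
  shows "continuous_map T T (\<lambda>x. c *\<^sub>C x)"
proof -
  have "continuous_map T (prod_topology euclidean T) (\<lambda>x. (c, x))"
    by (simp add: continuous_map_pairedI)
  then have "continuous_map T T ((\<lambda>(c, x). c *\<^sub>C x) \<circ> (\<lambda>x. (c, x)))"
    using T unfolding lcs_def by (meson continuous_map_compose)
  then show ?thesis by (simp add: o_def)
qed

lemma zero_nhd_dil:
  assumes T: "lcs T" and U: "zero_nhd T U" and r: "r > 0"
  shows "zero_nhd T (dil r U)"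
proof -
  have sp: "complex_vs.subspace (topspace T)" using T by (simp add: lcs_def)
  obtain W where W: "openin T W" "0 \<in> W" "W \<subseteq> U" "U \<subseteq> topspace T" using U unfolding zero_nhd_def by blast
  have "dil r W = {x \<in> topspace T. complex_of_real (1 / r) *\<^sub>C x \<in> W}"
  proof (intro set_eqI iffI)
    fix x assume x: "x \<in> dil r W"
    then have "complex_of_real (1 / r) *\<^sub>C x \<in> W" using mem_dil_iff[OF r, of x W] by metis
    moreover have "x \<in> topspace T"
      using x openin_subset[OF W(1)] complex_vs.subspace_scale[OF sp] by auto
    ultimately show "x \<in> {x \<in> topspace T. complex_of_real (1 / r) *\<^sub>C x \<in> W}" by blast
  next
    fix x assume "x \<in> {x \<in> topspace T. complex_of_real (1 / r) *\<^sub>C x \<in> W}"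
    then show "x \<in> dil r W" using mem_dil_iff[OF r, of x W] by (metis mem_Collect_eq)
  qed
  then have "openin T (dil r W)"
    using openin_continuous_map_preimage[OF continuous_map_scaling[OF T] W(1)] by metis
  moreover have "0 \<in> dil r W" using W(2) mem_dil_iff[OF r, of 0 W] by (metis complex_vs.scale_zero_right)
  moreover have "dil r W \<subseteq> dil r U" using W by (intro image_mono)
  moreover have "dil r U \<subseteq> topspace T" using W(4) complex_vs.subspace_scale[OF sp] by auto
  ultimately show ?thesis
    unfolding zero_nhd_def by metis
qed


section \<open>Baire category\<close>

text \<open>A node that is not meagre has a child that is not meagre, since a countable union of
  meagre sets is meagre. Following such children from the root gives one branch \<open>l\<close> on
  which no node is nowhere dense.\<close>

lemma Baire_web:
  fixes A :: "nat list \<Rightarrow> 'a set"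
  assumes T: "completely_metrizable_space T" and ne: "topspace T \<noteq> {}"
    and top: "topspace T \<subseteq> A []" and sub: "\<And>ls. A ls \<subseteq> topspace T"
    and step: "\<And>ls. A ls \<subseteq> (\<Union>n. A (ls @ [n]))"
  obtains l where "\<And>k. T interior_of (T closure_of A (map l [0..<k])) \<noteq> {}"
proof -
  define meagre where "meagre S \<longleftrightarrow> (\<exists>\<G>. countable \<G> \<and> S \<subseteq> \<Union>\<G> \<and>
      (\<forall>C\<in>\<G>. closedin T C \<and> T interior_of C = {}))" for S
  have 1: "\<not> meagre (A [])"
  proof
    assume "meagre (A [])"
    then obtain \<G> where G: "countable \<G>" "A [] \<subseteq> \<Union>\<G>" "\<And>C. C \<in> \<G> \<Longrightarrow> closedin T C \<and> T interior_of C = {}"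
      unfolding meagre_def by blast
    have "T interior_of \<Union>\<G> = {}"
      by (rule Baire_category_alt) (use T G in auto)
    moreover have "\<Union>\<G> = topspace T" using top G(2,3) closedin_subset by blast
    ultimately show False using ne by simp
  qed
  have 2: "\<exists>n. \<not> meagre (A (ls @ [n]))" if "\<not> meagre (A ls)" for ls
  proof (rule ccontr)
    assume "\<not> ?thesis"
    then have "\<forall>n. \<exists>\<G>. countable \<G> \<and> A (ls @ [n]) \<subseteq> \<Union>\<G> \<and>
      (\<forall>C\<in>\<G>. closedin T C \<and> T interior_of C = {})" unfolding meagre_def by blast
    then obtain G where "\<forall>n. countable (G n) \<and> A (ls @ [n]) \<subseteq> \<Union>(G n) \<and>
      (\<forall>C\<in>G n. closedin T C \<and> T interior_of C = {})" by (rule choice[THEN exE])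
    then have G: "\<And>n. countable (G n)" "\<And>n. A (ls @ [n]) \<subseteq> \<Union>(G n)"
      "\<And>n. \<forall>C\<in>G n. closedin T C \<and> T interior_of C = {}" by simp_all
    have "A ls \<subseteq> \<Union>(\<Union>n. G n)"
    proof
      fix x assume "x \<in> A ls"
      then obtain n where "x \<in> A (ls @ [n])" using step[of ls] by auto
      then show "x \<in> \<Union>(\<Union>n. G n)" using G(2)[of n] by blast
    qed
    then have "meagre (A ls)" unfolding meagre_def using G(1,3) by (intro exI[of _ "\<Union>n. G n"]) auto
    then show False using that by blast
  qed
  have 3: "T interior_of (T closure_of (A ls)) \<noteq> {}" if "\<not> meagre (A ls)" for ls
  proof
    assume "T interior_of (T closure_of (A ls)) = {}"
    then have "meagre (A ls)" unfolding meagre_def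
      using sub[of ls] by (intro exI[of _ "{T closure_of (A ls)}"]) (auto simp: closure_of_subset)
    then show False using that by blast
  qed
  from 2 obtain g where g: "\<And>ls. \<not> meagre (A ls) \<Longrightarrow> \<not> meagre (A (ls @ [g ls]))" by metis
  define L where "L = rec_nat [] (\<lambda>_ ls. ls @ [g ls])"
  have L: "L 0 = []" "\<And>k. L (Suc k) = L k @ [g (L k)]" by (simp_all add: L_def)
  have "map (\<lambda>i. g (L i)) [0..<k] = L k" for k by (induction k) (simp_all add: L)
  moreover have "\<not> meagre (A (L k))" for k by (induction k) (simp_all add: L 1 g)
  ultimately show ?thesis using 3 that[of "\<lambda>i. g (L i)"] by metis
qed

section \<open>Banach discs and barrels\<close>

lemma banach_disc_continuous_inclusion:
  assumes T: "lcs T" and B: "banach_disc T B"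
  shows "continuous_map (Metric_space.mtopology (complex_vs.span B) (norm_dist (complex_vs.span B) (minkowski B)))
    T (\<lambda>x. x)"
proof -
  let ?M = "complex_vs.span B"
  interpret M: Metric_space ?M "norm_dist ?M (minkowski B)"
    using B by (simp add: banach_disc_def)
  have ac: "absolutely_convex B" and bd: "lc_bounded T B" using B by (auto simp: banach_disc_def)
  have sp: "complex_vs.subspace (topspace T)" using T by (simp add: lcs_def)
  have sub: "?M \<subseteq> topspace T"
    using bd complex_vs.span_minimal[OF _ sp] unfolding lc_bounded_def by blast
  show ?thesis
    unfolding continuous_map_def
  proof (intro conjI allI impI)
    show "(\<lambda>x. x) \<in> topspace M.mtopology \<rightarrow> topspace T" using sub by auto
    fix W assume W: "openin T W"
    have "\<exists>r>0. M.mball x r \<subseteq> {x \<in> ?M. x \<in> W}" if x: "x \<in> ?M" "x \<in> W" for x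
    proof -
      have "openin T {y \<in> topspace T. x + y \<in> W}"
        using openin_continuous_map_preimage[OF continuous_map_translation[OF T] W] sub x by blast
      moreover have "0 \<in> {y \<in> topspace T. x + y \<in> W}"
        using x complex_vs.subspace_0[OF sp] by simp
      ultimately have "zero_nhd T {y \<in> topspace T. x + y \<in> W}"
        unfolding zero_nhd_def by blast
      then obtain V where V: "zero_nhd T V" "absolutely_convex V" "V \<subseteq> {y \<in> topspace T. x + y \<in> W}"
        using T unfolding lcs_def by blast
      obtain r where r: "r > 0" "B \<subseteq> dil r V"
        using bd V(1) unfolding lc_bounded_def absorbs_def by blast
      have "M.mball x (1 / r) \<subseteq> {x \<in> ?M. x \<in> W}"
      proof
        fix y assume "y \<in> M.mball x (1 / r)"
        then have y: "y \<in> ?M" "minkowski B (x - y) < 1 / r"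
          by (auto simp: norm_dist_def M.in_mball)
        then have "x - y \<in> dil (1 / r) B"
          by (intro minkowski_less_imp[OF ac complex_vs.span_diff]) (use x in auto)
        also have "\<dots> \<subseteq> dil (1 / r) (dil r V)" using r by blast
        also have "\<dots> = V" unfolding dil_dil using r by (simp add: scaleC_one)
        finally have "(-1) *\<^sub>C (x - y) \<in> V" by (intro absolutely_convex_scale[OF V(2)]) auto
        then have "x + (-1) *\<^sub>C (x - y) \<in> W" using V(3) by blast
        then show "y \<in> {x \<in> ?M. x \<in> W}" using y by simp
      qed
      then show ?thesis using r by (intro exI[of _ "1 / r"]) auto
    qed
    then show "openin M.mtopology {x \<in> topspace M.mtopology. x \<in> W}"
      by (auto simp: M.openin_mtopology)
  qed
qed

lemma barrel_absorbs_banach_disc: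
  assumes T: "lcs T" and U: "barrel T U" and B: "banach_disc T B"
  shows "absorbs U B"
proof -
  let ?M = "complex_vs.span B"
  interpret M: Metric_space ?M "norm_dist ?M (minkowski B)"
    using B by (simp add: banach_disc_def)
  have ac: "absolutely_convex B" and bd: "lc_bounded T B" and compl: "M.mcomplete"
    using B by (auto simp: banach_disc_def)
  have sp: "complex_vs.subspace (topspace T)" using T by (simp add: lcs_def)
  have sub: "?M \<subseteq> topspace T"
    using bd complex_vs.span_minimal[OF _ sp] unfolding lc_bounded_def by blast
  have Uac: "absolutely_convex U" using U by (simp add: barrel_def)
  define C where "C n = {x \<in> ?M. complex_of_real (1 / real (Suc n)) *\<^sub>C x \<in> U}" for n
  define A where "A ls = (case ls of [] \<Rightarrow> ?M | n # _ \<Rightarrow> C n)" for ls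
  have C: "closedin M.mtopology (C n)" for n
  proof -
    have "continuous_map M.mtopology T ((\<lambda>x. complex_of_real (1 / real (Suc n)) *\<^sub>C x) \<circ> (\<lambda>x. x))"
      by (intro continuous_map_compose[OF banach_disc_continuous_inclusion[OF T B]] continuous_map_scaling T)
    from closedin_continuous_map_preimage[OF this, of U] U
    show ?thesis by (simp add: C_def barrel_def)
  qed
  have cover: "?M \<subseteq> (\<Union>n. C n)"
  proof
    fix x assume x: "x \<in> ?M"
    then obtain r where r: "r > 0" "x \<in> dil r U"
      using sub U unfolding barrel_def absorbs_def by blast
    obtain n where "r < real n" using reals_Archimedean2 by blast
    then have "x \<in> dil (real (Suc n)) U" using r dil_mono[OF Uac, of r "real (Suc n)"] by auto
    then show "x \<in> (\<Union>n. C n)" using x mem_dil_iff[of "real (Suc n)" x U] unfolding C_def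
      by (metis (mono_tags, lifting) UNIV_I UN_I mem_Collect_eq of_nat_0_less_iff zero_less_Suc)
  qed
  obtain l where l: "\<And>k. M.mtopology interior_of (M.mtopology closure_of A (map l [0..<k])) \<noteq> {}"
  proof (rule Baire_web[of M.mtopology A])
    show "completely_metrizable_space M.mtopology"
      using compl unfolding completely_metrizable_space_def using M.Metric_space_axioms by blast
    show "topspace M.mtopology \<noteq> {}" using complex_vs.span_zero[of B] by auto
    show "topspace M.mtopology \<subseteq> A []" by (simp add: A_def)
    show "A ls \<subseteq> topspace M.mtopology" for ls by (auto simp: A_def C_def split: list.splits)
    show "A ls \<subseteq> (\<Union>n. A (ls @ [n]))" for ls
      using cover by (cases ls) (auto simp: A_def)
  qed (use that in blast)
  have "A (map l [0..<1]) = C (l 0)" by (simp add: A_def)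
  then have "M.mtopology interior_of (C (l 0)) \<noteq> {}"
    using l[of 1] C[of "l 0"] by (simp add: closure_of_closedin)
  then obtain x where x: "x \<in> M.mtopology interior_of (C (l 0))" by (meson all_not_in_conv)
  have "\<forall>y\<in>M.mtopology interior_of (C (l 0)). \<exists>r>0. M.mball y r \<subseteq> M.mtopology interior_of (C (l 0))"
    using openin_interior_of[of M.mtopology "C (l 0)"] unfolding M.openin_mtopology by simp
  with x obtain e where e: "e > 0" "M.mball x e \<subseteq> M.mtopology interior_of (C (l 0))"
    by (meson bspec)
  have e': "M.mball x e \<subseteq> C (l 0)" using e(2) interior_of_subset by (rule order_trans)
  have xC: "x \<in> C (l 0)" using interior_of_subset x by (rule subsetD)
  let ?N = "real (Suc (l 0))"
  show ?thesis
  proof (rule absorbsI)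
    \<comment> \<open>Both \<open>x\<close> and \<open>x + ?y\<close> lie in \<open>?N\<close> times
      \<open>U\<close>, hence so does half their difference, which is \<open>e / 4\<close> times
      \<open>y\<close>. The radius is halved because \<open>minkowski_le\<close> gives a weak
      inequality while the ball is open.\<close>
    show "2 * ?N / (e / 2) > 0" using e by simp
    fix y assume y: "y \<in> B"
    let ?y = "complex_of_real (e / 2) *\<^sub>C y"
    have yM: "?y \<in> ?M" using y by (intro complex_vs.span_scale complex_vs.span_base)
    have xM: "x \<in> ?M" using xC by (simp add: C_def)
    have "- y \<in> B" using absolutely_convex_scale[OF ac y, of "-1"] by simp
    then have "complex_of_real (e / 2) *\<^sub>C (- y) \<in> dil (e / 2) B" by blast
    then have "x - (x + ?y) \<in> dil (e / 2) B" by simp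
    then have "minkowski B (x - (x + ?y)) \<le> e / 2"
      using e by (intro minkowski_le) auto
    moreover have xy: "x + ?y \<in> ?M" using xM yM by (rule complex_vs.span_add)
    ultimately have "x + ?y \<in> M.mball x e"
      using xM e unfolding M.in_mball norm_dist_def by auto
    then have 1: "complex_of_real (1 / ?N) *\<^sub>C (x + ?y) \<in> U" using e' unfolding C_def by blast
    have 2: "complex_of_real (1 / ?N) *\<^sub>C x \<in> U" using xC unfolding C_def by blast
    have "cmod (1/2) + cmod (-1/2) \<le> 1" by (simp add: norm_divide)
    then have "(1/2) *\<^sub>C (complex_of_real (1 / ?N) *\<^sub>C (x + ?y)) + (-1/2) *\<^sub>C (complex_of_real (1 / ?N) *\<^sub>C x) \<in> U"
      using Uac 1 2 unfolding absolutely_convex_def by blast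
    moreover have "(1/2) *\<^sub>C (complex_of_real (1 / ?N) *\<^sub>C (x + ?y)) + (-1/2) *\<^sub>C (complex_of_real (1 / ?N) *\<^sub>C x)
      = complex_of_real (1 / (2 * ?N / (e / 2))) *\<^sub>C y"
    proof -
      have "(1/2) *\<^sub>C (complex_of_real (1 / ?N) *\<^sub>C (x + ?y)) + (-1/2) *\<^sub>C (complex_of_real (1 / ?N) *\<^sub>C x)
        = (1/2 * complex_of_real (1 / ?N) * complex_of_real (e / 2)) *\<^sub>C y"
        by (simp add: scaleC_add_right scaleC_scaleC del: of_nat_Suc of_real_divide)
      also have "1/2 * complex_of_real (1 / ?N) * complex_of_real (e / 2) = complex_of_real (1 / (2 * ?N / (e / 2)))"
        by simp
      finally show ?thesis .
    qed
    ultimately show "y \<in> dil (2 * ?N / (e / 2)) U"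
      using e by (subst mem_dil_iff) auto
  qed
qed

theorem ultrabornological_imp_barrelled:
  assumes "ultrabornological T"
  shows "barrelled T"
  using assms barrel_absorbs_banach_disc closedin_subset[of T]
  unfolding ultrabornological_def barrelled_def by (metis barrel_def)


section \<open>Holomorphic functions of several variables\<close>

lemma norm_vector_scalar_mult: "norm (c *s (z::complex^'d)) = cmod c * norm z"
  by (simp add: norm_vec_def norm_mult L2_set_right_distrib)

lemma bounded_linear_scalar_line: "bounded_linear (\<lambda>c. c *s (v::complex^'d))"
  by (rule bounded_linear_intro[where K = "norm v"])
    (simp_all add: vec_eq_iff algebra_simps norm_vector_scalar_mult)

lemma complex_scaleC_apply: "(c *\<^sub>C f) z = c * (f z :: complex)"
  by (simp add: scaleC_fun_def scaleC_complex_def)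

lemma subspace_hol: "complex_vs.subspace (hol (G::(complex^'d) set))"
proof (rule complex_vs.subspaceI)
  show "0 \<in> hol G" unfolding hol_def by (auto simp: zero_fun_def intro!: exI[of _ "\<lambda>_. 0"])
next
  fix f g assume f: "f \<in> hol G" and g: "g \<in> hol G"
  show "f + g \<in> hol G" unfolding hol_def
  proof (intro CollectI conjI ballI allI impI)
    fix z assume "z \<in> G"
    then obtain D E where "(f has_derivative D) (at z)" "\<forall>c v. D (c *s v) = c * D v"
      "(g has_derivative E) (at z)" "\<forall>c v. E (c *s v) = c * E v" using f g unfolding hol_def by blast
    then show "\<exists>D. (f + g has_derivative D) (at z) \<and> (\<forall>c v. D (c *s v) = c * D v)"
      unfolding plus_fun_def
      by (intro exI[of _ "\<lambda>v. D v + E v"]) (auto intro!: derivative_intros simp: algebra_simps)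
  qed (use f g in \<open>auto simp: hol_def\<close>)
next
  fix b f assume f: "f \<in> hol G"
  show "b *\<^sub>C f \<in> hol G" unfolding hol_def
  proof (intro CollectI conjI ballI allI impI)
    fix z assume "z \<in> G"
    then obtain D where "(f has_derivative D) (at z)" "\<forall>c v. D (c *s v) = c * D v"
      using f unfolding hol_def by blast
    then show "\<exists>D. (b *\<^sub>C f has_derivative D) (at z) \<and> (\<forall>c v. D (c *s v) = c * D v)"
      unfolding scaleC_fun_def scaleC_complex_def
      by (intro exI[of _ "\<lambda>v. b * D v"]) (auto intro!: derivative_intros simp: algebra_simps)
  qed (use f in \<open>auto simp: hol_def complex_scaleC_apply\<close>)
qed

lemma hol_outside: "f \<in> hol G \<Longrightarrow> z \<notin> G \<Longrightarrow> f z = 0"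
  unfolding hol_def by blast

lemma continuous_on_hol: "f \<in> hol G \<Longrightarrow> continuous_on G f"
  unfolding hol_def
  by (auto intro!: continuous_at_imp_continuous_on dest: has_derivative_continuous)

lemma has_field_derivative_line:
  fixes f :: "complex^'d \<Rightarrow> complex"
  assumes D: "(f has_derivative D) (at (z + l *s v))" and hom: "\<And>c v. D (c *s v) = c * D v"
  shows "((\<lambda>l. f (z + l *s v)) has_field_derivative D v) (at l)"
proof -
  have "((\<lambda>l. z + l *s v) has_derivative (\<lambda>c. c *s v)) (at l)"
    using bounded_linear.has_derivative[OF bounded_linear_scalar_line has_derivative_ident, of v]
    by (auto intro!: derivative_eq_intros)
  from has_derivative_compose[OF this D] show ?thesis
    by (simp add: has_field_derivative_def hom mult_commute_abs)
qed

lemma holomorphic_on_line: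
  assumes f: "f \<in> hol G"
  shows "(\<lambda>l. f (z + l *s v)) holomorphic_on {l. z + l *s v \<in> G}"
proof (rule holomorphic_onI)
  fix l assume "l \<in> {l. z + l *s v \<in> G}"
  then obtain D where "(f has_derivative D) (at (z + l *s v))" "\<forall>c v. D (c *s v) = c * D v"
    using f unfolding hol_def by blast
  then show "(\<lambda>l. f (z + l *s v)) field_differentiable at l within {l. z + l *s v \<in> G}"
    using has_field_derivative_line has_field_derivative_at_within unfolding field_differentiable_def by blast
qed

text \<open>Cauchy's inequality on the complex line through \<open>z\<close> in direction
  \<open>v\<close>: the disc of radius \<open>r / norm v\<close> is mapped into the ball of radius
  \<open>r\<close>. The result is a bound for the operator norm of the derivative.\<close>

lemma hol_derivative_bound:
  fixes f :: "complex^'d \<Rightarrow> complex"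
  assumes f: "f \<in> hol G" and r: "r > 0" "cball z r \<subseteq> G" and C: "\<And>x. x \<in> cball z r \<Longrightarrow> cmod (f x) \<le> C"
    and D: "(f has_derivative D) (at z)" "\<And>c v. D (c *s v) = c * D v"
  shows "cmod (D v) \<le> C / r * norm v"
proof (cases "v = 0")
  case True
  then show ?thesis using D(2)[of 0 v] by simp
next
  case False
  define R where "R = r / norm v"
  have R: "R > 0" using r False by (simp add: R_def)
  have sub: "cball 0 R \<subseteq> {l. z + l *s v \<in> cball z r}"
    using False by (auto simp: R_def dist_norm norm_vector_scalar_mult field_simps)
  have hol: "(\<lambda>l. f (z + l *s v)) holomorphic_on cball 0 R"
    by (rule holomorphic_on_subset[OF holomorphic_on_line[OF f]]) (use sub r in blast)
  have "cmod ((deriv ^^ 1) (\<lambda>l. f (z + l *s v)) 0) \<le> fact 1 * C / R ^ 1"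
  proof (rule Cauchy_inequality)
    show "(\<lambda>l. f (z + l *s v)) holomorphic_on ball 0 R"
      using hol by (rule holomorphic_on_subset) auto
    show "continuous_on (cball 0 R) (\<lambda>l. f (z + l *s v))"
      by (rule holomorphic_on_imp_continuous_on[OF hol])
    fix x :: complex assume "norm (0 - x) = R"
    then have "x \<in> cball 0 R" by simp
    then show "cmod (f (z + x *s v)) \<le> C" using sub C by blast
  qed (rule R)
  moreover have "deriv (\<lambda>l. f (z + l *s v)) 0 = D v"
    using has_field_derivative_line[of f D z 0 v] D by (simp add: DERIV_imp_deriv)
  ultimately show ?thesis by (simp add: R_def)
qed

text \<open>Weierstrass' theorem in several variables. The derivatives are uniformly Cauchy on a
  smaller ball by Cauchy's inequality, so the limit is differentiable with the limit derivative;
  complex homogeneity passes to pointwise limits.\<close>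

lemma hol_uniform_limit:
  fixes f :: "nat \<Rightarrow> complex^'d \<Rightarrow> complex"
  assumes f: "\<And>n. f n \<in> hol G"
    and lim: "\<And>z. z \<in> G \<Longrightarrow> \<exists>r>0. cball z r \<subseteq> G \<and> uniform_limit (cball z r) f g sequentially"
    and out: "\<And>z. z \<notin> G \<Longrightarrow> g z = 0"
  shows "g \<in> hol G"
proof -
  have "\<exists>D. (g has_derivative D) (at z) \<and> (\<forall>c v. D (c *s v) = c * D v)" if z: "z \<in> G" for z
  proof -
    obtain r where r: "r > 0" "cball z r \<subseteq> G" "uniform_limit (cball z r) f g sequentially"
      using lim[OF z] by blast
    have "\<forall>n. \<forall>x\<in>G. \<exists>D. (f n has_derivative D) (at x) \<and> (\<forall>c v. D (c *s v) = c * D v)"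
      using f unfolding hol_def by blast
    then obtain D where D: "\<And>n x. x \<in> G \<Longrightarrow> (f n has_derivative D n x) (at x)"
      "\<And>n x c v. x \<in> G \<Longrightarrow> D n x (c *s v) = c * D n x v" by metis
    let ?S = "ball z (r / 2)"
    have sub: "cball x (r / 2) \<subseteq> cball z r" if "x \<in> ?S" for x
    proof
      fix y assume "y \<in> cball x (r / 2)"
      then show "y \<in> cball z r" using that dist_triangle[of z y x] by auto
    qed
    have SG: "x \<in> G" if "x \<in> ?S" for x using sub[OF that] r by (meson centre_in_cball half_gt_zero less_imp_le subsetD)
    have cauchy: "\<exists>N. \<forall>n\<ge>N. \<forall>m\<ge>N. \<forall>x\<in>?S. \<forall>h. cmod (D n x h - D m x h) \<le> e * norm h" if e: "e > 0" for e
    proof -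
      \<comment> \<open>Each of \<open>f n\<close> and \<open>f m\<close> is within
        \<open>e * r / 4\<close> of \<open>g\<close>, so they differ by at most
        \<open>e * r / 2\<close> on balls of radius \<open>r / 2\<close>; Cauchy's inequality then
        returns exactly \<open>e\<close>.\<close>
      have "e * r / 4 > 0" using e r(1) by simp
      then have "\<forall>\<^sub>F n in sequentially. \<forall>x\<in>cball z r. dist (f n x) (g x) < e * r / 4"
        using r(3) unfolding uniform_limit_iff by blast
      then obtain N where N: "\<And>n x. n \<ge> N \<Longrightarrow> x \<in> cball z r \<Longrightarrow> dist (f n x) (g x) < e * r / 4"
        unfolding eventually_sequentially by blast
      have "cmod (D n x h - D m x h) \<le> e * norm h" if nm: "n \<ge> N" "m \<ge> N" and x: "x \<in> ?S" for n m x h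
      proof -
        have diff: "f n - f m \<in> hol G" by (rule complex_vs.subspace_diff[OF subspace_hol f f])
        have "cmod ((\<lambda>h. D n x h - D m x h) h) \<le> (e * r / 2) / (r / 2) * norm h"
        proof (rule hol_derivative_bound[OF diff])
          show "r / 2 > 0" using r by simp
          show "cball x (r / 2) \<subseteq> G" using sub[OF x] r by blast
          show "(f n - f m has_derivative (\<lambda>h. D n x h - D m x h)) (at x)"
            unfolding fun_diff_def using D(1)[OF SG[OF x]] by (intro has_derivative_diff)
          show "D n x (c *s v) - D m x (c *s v) = c * (D n x v - D m x v)" for c v
            using D(2)[OF SG[OF x]] by (simp add: algebra_simps)
          fix y assume "y \<in> cball x (r / 2)"
          then have "y \<in> cball z r" using sub[OF x] by blast
          then have "dist (f n y) (g y) < e * r / 4" "dist (f m y) (g y) < e * r / 4"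
            using N nm by blast+
          then have "dist (f n y) (f m y) < e * r / 2"
            using dist_triangle2[of "f n y" "f m y" "g y"] by linarith
          then show "cmod ((f n - f m) y) \<le> e * r / 2" by (simp add: dist_norm)
        qed
        then show ?thesis using r by simp
      qed
      then show ?thesis by blast
    qed
    have conv: "convergent (\<lambda>n. D n x h)" if x: "x \<in> ?S" for x h
      unfolding Cauchy_convergent_iff[symmetric]
    proof (rule metric_CauchyI)
      fix e :: real assume "e > 0"
      then have "e / (norm h + 1) > 0" by (simp add: add_nonneg_pos)
      then obtain N where N: "\<forall>n\<ge>N. \<forall>m\<ge>N. \<forall>x\<in>?S. \<forall>h'. cmod (D n x h' - D m x h') \<le> e / (norm h + 1) * norm h'"
        using cauchy by blast
      have "e / (norm h + 1) * norm h < e"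
        using \<open>e > 0\<close> norm_ge_zero[of h] by (simp add: divide_less_eq add_nonneg_pos)
      then have "\<forall>m\<ge>N. \<forall>n\<ge>N. dist (D m x h) (D n x h) < e"
        using N x unfolding dist_norm by (meson order_le_less_trans)
      then show "\<exists>M. \<forall>m\<ge>M. \<forall>n\<ge>M. dist (D m x h) (D n x h) < e" by blast
    qed
    define D' where "D' x h = lim (\<lambda>n. D n x h)" for x h
    have D': "(\<lambda>n. D n x h) \<longlonglongrightarrow> D' x h" if "x \<in> ?S" for x h
      using conv[OF that] unfolding D'_def by (simp add: convergent_LIMSEQ_iff)
    have zS: "z \<in> ?S" using r by simp
    have fg: "(\<lambda>n. f n x) \<longlonglongrightarrow> g x" if "x \<in> ?S" for x
    proof -
      have "x \<in> cball z r" using that r(1) by auto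
      then show ?thesis by (rule tendsto_uniform_limitI[OF r(3)])
    qed
    have "\<exists>g'. \<forall>x\<in>?S. (\<lambda>n. f n x) \<longlonglongrightarrow> g' x \<and> (g' has_derivative D' x) (at x within ?S)"
    proof (rule has_derivative_sequence[where f' = D])
      show "(f n has_derivative D n x) (at x within ?S)" if "x \<in> ?S" for n x
        using D(1)[OF SG[OF that]] by (rule has_derivative_at_withinI)
      show "\<forall>\<^sub>F n in sequentially. \<forall>x\<in>?S. \<forall>h. norm (D n x h - D' x h) \<le> e * norm h" if "e > 0" for e
      proof -
        obtain N where N: "\<forall>n\<ge>N. \<forall>m\<ge>N. \<forall>x\<in>?S. \<forall>h. cmod (D n x h - D m x h) \<le> e * norm h"
          using cauchy[OF \<open>e > 0\<close>] by blast
        have "norm (D n x h - D' x h) \<le> e * norm h" if n: "n \<ge> N" and x: "x \<in> ?S" for n x h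
        proof (rule LIMSEQ_le_const2)
          show "(\<lambda>m. norm (D n x h - D m x h)) \<longlonglongrightarrow> norm (D n x h - D' x h)"
            by (intro tendsto_intros D'[OF x])
          show "\<exists>N. \<forall>m\<ge>N. norm (D n x h - D m x h) \<le> e * norm h"
            using N n x by blast
        qed
        then show ?thesis unfolding eventually_sequentially by blast
      qed
      show "(\<lambda>n. f n z) \<longlonglongrightarrow> g z" by (rule fg[OF zS])
    qed (use zS in auto)
    then obtain g' where g': "\<And>x. x \<in> ?S \<Longrightarrow> (\<lambda>n. f n x) \<longlonglongrightarrow> g' x"
      "\<And>x. x \<in> ?S \<Longrightarrow> (g' has_derivative D' x) (at x within ?S)" by blast
    have eq: "g' x = g x" if "x \<in> ?S" for x using LIMSEQ_unique[OF g'(1) fg] that by blast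
    have "(g has_derivative D' z) (at z within ?S)"
      using has_derivative_transform[OF zS _ g'(2)[OF zS]] eq by metis
    then have 1: "(g has_derivative D' z) (at z)"
      using at_within_open[OF zS open_ball] by simp
    have "D' z (c *s v) = c * D' z v" for c v
    proof (rule LIMSEQ_unique[OF D'[OF zS]])
      have "(\<lambda>n. c * D n z v) \<longlonglongrightarrow> c * D' z v" by (intro tendsto_intros D'[OF zS])
      then show "(\<lambda>n. D n z (c *s v)) \<longlonglongrightarrow> c * D' z v" using D(2)[OF z] by simp
    qed
    then show ?thesis using 1 by blast
  qed
  then show ?thesis using out unfolding hol_def by blast
qed

text \<open>Smallness relative to \<open>v\<close> is locally uniform smallness, since the
  continuous function \<open>v\<close> is bounded on compact balls.\<close>

lemma hol_weighted_limit:
  fixes f :: "nat \<Rightarrow> complex^'d \<Rightarrow> complex"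
  assumes G: "open G" and v: "continuous_on G v" and f: "\<And>n. f n \<in> hol G"
    and lim: "\<And>e. e > 0 \<Longrightarrow> \<exists>N. \<forall>n\<ge>N. \<forall>z\<in>G. cmod (f n z - g z) \<le> e * v z"
    and out: "\<And>z. z \<notin> G \<Longrightarrow> g z = 0"
  shows "g \<in> hol G"
proof (rule hol_uniform_limit[OF f _ out])
  fix z assume "z \<in> G"
  then obtain r where r: "r > 0" "cball z r \<subseteq> G" using G open_contains_cball by blast
  have "compact (v ` cball z r)"
    using r v by (intro compact_continuous_image) (auto intro: continuous_on_subset)
  then obtain K where K: "\<And>x. x \<in> cball z r \<Longrightarrow> \<bar>v x\<bar> \<le> K" "K > 0"
    using compact_imp_bounded bounded_pos by (metis imageI real_norm_def)
  have "uniform_limit (cball z r) f g sequentially"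
    unfolding uniform_limit_iff
  proof (intro allI impI)
    fix e :: real assume "e > 0"
    then have "e / (2 * K) > 0" using K by simp
    then obtain N where N: "\<forall>n\<ge>N. \<forall>z\<in>G. cmod (f n z - g z) \<le> e / (2 * K) * v z" using lim by blast
    have "dist (f n x) (g x) < e" if "n \<ge> N" "x \<in> cball z r" for n x
    proof -
      have "cmod (f n x - g x) \<le> e / (2 * K) * v x" using N that r by blast
      also have "\<dots> \<le> e / (2 * K) * K" using K(1)[OF that(2)] K(2) \<open>e > 0\<close> by (intro mult_left_mono) auto
      also have "\<dots> < e" using K(2) \<open>e > 0\<close> by simp
      finally show ?thesis by (simp add: dist_norm)
    qed
    then show "\<forall>\<^sub>F n in sequentially. \<forall>x\<in>cball z r. dist (f n x) (g x) < e"
      unfolding eventually_sequentially by blast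
  qed
  then show "\<exists>r>0. cball z r \<subseteq> G \<and> uniform_limit (cball z r) f g sequentially" using r by blast
qed

definition dominated :: "(complex^'d) set \<Rightarrow> (complex^'d \<Rightarrow> real) \<Rightarrow> (complex^'d \<Rightarrow> complex) set" where
  "dominated G v = {f \<in> hol G. \<forall>z\<in>G. cmod (f z) \<le> v z}"

lemma hol_weighted_series:
  fixes f :: "nat \<Rightarrow> complex^'d \<Rightarrow> complex"
  assumes G: "open G" and v: "continuous_on G v"
    and f: "\<And>n. f n \<in> hol G" "\<And>n z. z \<in> G \<Longrightarrow> cmod (f n z) \<le> c n * v z" and c: "summable c"
    and nonneg: "\<And>n. c n \<ge> 0" "\<And>z. z \<in> G \<Longrightarrow> v z \<ge> 0"
  shows "(\<lambda>z. \<Sum>n. f n z) \<in> dominated G (\<lambda>z. (\<Sum>n. c n) * v z)"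
    and "\<And>z. summable (\<lambda>n. f n z)"
proof -
  show sm: "summable (\<lambda>n. f n z)" for z
  proof (cases "z \<in> G")
    case True
    have "summable (\<lambda>n. c n * v z)" using c by (rule summable_mult2)
    then show ?thesis using f(2)[OF True] by (rule summable_comparison_test'[where N = 0])
  next
    case False
    then show ?thesis using hol_outside[OF f(1)] by simp
  qed
  have tail: "cmod ((\<Sum>n. f n z) - (\<Sum>n<N. f n z)) \<le> (\<Sum>n. c (n + N)) * v z" if z: "z \<in> G" for z N
  proof -
    have "(\<Sum>n. f n z) - (\<Sum>n<N. f n z) = (\<Sum>n. f (n + N) z)"
      using suminf_minus_initial_segment[OF sm] by simp
    also have "cmod \<dots> \<le> (\<Sum>n. c (n + N) * v z)"
      using f(2)[OF z] c by (intro norm_suminf_le summable_mult2) (auto simp: summable_iff_shift)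
    also have "\<dots> = (\<Sum>n. c (n + N)) * v z"
      using c by (intro suminf_mult2[symmetric]) (simp add: summable_iff_shift)
    finally show ?thesis .
  qed
  have "(\<lambda>z. \<Sum>n. f n z) \<in> hol G"
  proof (rule hol_weighted_limit[OF G v, of "\<lambda>N. (\<Sum>n<N. f n)"])
    show "(\<Sum>n<N. f n) \<in> hol G" for N
      by (intro complex_vs.subspace_sum subspace_hol f)
    show "\<exists>M. \<forall>N\<ge>M. \<forall>z\<in>G. cmod ((\<Sum>n<N. f n) z - (\<Sum>n. f n z)) \<le> e * v z" if e: "e > 0" for e
    proof -
      obtain M where M: "\<forall>N\<ge>M. norm (\<Sum>i. c (i + N)) < e"
        using suminf_exist_split[OF e c] by blast
      have "cmod ((\<Sum>n<N. f n) z - (\<Sum>n. f n z)) \<le> e * v z" if "N \<ge> M" "z \<in> G" for N z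
      proof -
        have "(\<Sum>n<N. f n) z = (\<Sum>n<N. f n z)" by (induction N) auto
        then have "cmod ((\<Sum>n<N. f n) z - (\<Sum>n. f n z)) \<le> (\<Sum>n. c (n + N)) * v z"
          using tail[OF that(2), of N] by (simp add: norm_minus_commute)
        also have "\<dots> \<le> e * v z"
          using M that nonneg(2) by (intro mult_right_mono) force+
        finally show ?thesis .
      qed
      then show ?thesis by blast
    qed
    show "(\<Sum>n. f n z) = 0" if "z \<notin> G" for z using hol_outside[OF f(1) that] by simp
  qed
  then show "(\<lambda>z. \<Sum>n. f n z) \<in> dominated G (\<lambda>z. (\<Sum>n. c n) * v z)"
    using tail[of _ 0] by (simp add: dominated_def)
qed


section \<open>Polynomial approximation\<close>

text \<open>Cauchy's inequality bounds the n-th Taylor term by \<open>C\<close> times the n-th power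
  of \<open>norm x / R\<close>; the tail from \<open>j\<close> on is dominated by a geometric
  series.\<close>

lemma taylor_remainder:
  fixes h :: "complex \<Rightarrow> complex"
  assumes hol: "h holomorphic_on ball 0 R" and cont: "continuous_on (cball 0 R) h" and R: "R > 0"
    and C: "\<And>x. norm x = R \<Longrightarrow> cmod (h x) \<le> C" and x: "norm x < R"
  shows "cmod (h x - (\<Sum>l<j. (deriv ^^ l) h 0 / fact l * x ^ l)) \<le> C * (norm x / R) ^ j / (1 - norm x / R)"
proof -
  let ?q = "norm x / R"
  have q: "0 \<le> ?q" "?q < 1" using R x by auto
  have s: "(\<lambda>n. (deriv ^^ n) h 0 / fact n * x ^ n) sums h x"
    using holomorphic_power_series[OF hol, of x] x by simp
  have "h x - (\<Sum>l<j. (deriv ^^ l) h 0 / fact l * x ^ l) = (\<Sum>n. (deriv ^^ (n + j)) h 0 / fact (n + j) * x ^ (n + j))"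
    using suminf_minus_initial_segment[OF sums_summable[OF s], of j] sums_unique[OF s] by simp
  also have "cmod \<dots> \<le> (\<Sum>n. C * ?q ^ j * ?q ^ n)"
  proof (rule norm_suminf_le)
    fix n
    have "cmod ((deriv ^^ (n + j)) h 0) \<le> fact (n + j) * C / R ^ (n + j)"
      by (rule Cauchy_inequality[OF hol cont R]) (use C in simp)
    then have "cmod ((deriv ^^ (n + j)) h 0) / fact (n + j) \<le> C / R ^ (n + j)"
      by (simp add: field_simps)
    then have "cmod ((deriv ^^ (n + j)) h 0) / fact (n + j) * norm x ^ (n + j) \<le> C / R ^ (n + j) * norm x ^ (n + j)"
      by (rule mult_right_mono) simp
    then show "cmod ((deriv ^^ (n + j)) h 0 / fact (n + j) * x ^ (n + j)) \<le> C * ?q ^ j * ?q ^ n"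
      by (simp add: norm_mult norm_divide norm_power power_add power_divide mult_ac)
  qed (use q in \<open>auto intro!: summable_mult summable_geometric\<close>)
  also have "\<dots> = C * ?q ^ j / (1 - ?q)"
    using q suminf_geometric[of ?q] by (subst suminf_mult) (auto intro!: summable_geometric)
  finally show ?thesis .
qed

section \<open>Polynomials in several variables\<close>

lemma polynomial_fun_const: "polynomial_fun (\<lambda>_. b)"
  unfolding polynomial_fun_def
  by (rule exI[of _ "{\<lambda>_. 0}"], rule exI[of _ "\<lambda>_. b"]) simp

lemma polynomial_fun_add:
  assumes "polynomial_fun p" "polynomial_fun q"
  shows "polynomial_fun (\<lambda>z. p z + q z)"
proof -
  obtain A c where A: "finite A" "p = (\<lambda>z. \<Sum>\<alpha>\<in>A. c \<alpha> * (\<Prod>i\<in>UNIV. (z $ i) ^ \<alpha> i))"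
    using assms(1) unfolding polynomial_fun_def by blast
  obtain B d where B: "finite B" "q = (\<lambda>z. \<Sum>\<alpha>\<in>B. d \<alpha> * (\<Prod>i\<in>UNIV. (z $ i) ^ \<alpha> i))"
    using assms(2) unfolding polynomial_fun_def by blast
  have "p z + q z = (\<Sum>\<alpha>\<in>A \<union> B. ((if \<alpha> \<in> A then c \<alpha> else 0) + (if \<alpha> \<in> B then d \<alpha> else 0)) * (\<Prod>i\<in>UNIV. (z $ i) ^ \<alpha> i))"
    for z
  proof -
    have "p z = (\<Sum>\<alpha>\<in>A \<union> B. (if \<alpha> \<in> A then c \<alpha> else 0) * (\<Prod>i\<in>UNIV. (z $ i) ^ \<alpha> i))"
      unfolding A(2) using A(1) B(1) by (intro sum.mono_neutral_cong_left) auto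
    moreover have "q z = (\<Sum>\<alpha>\<in>A \<union> B. (if \<alpha> \<in> B then d \<alpha> else 0) * (\<Prod>i\<in>UNIV. (z $ i) ^ \<alpha> i))"
      unfolding B(2) using A(1) B(1) by (intro sum.mono_neutral_cong_left) auto
    ultimately show ?thesis by (simp add: sum.distrib distrib_right)
  qed
  then show ?thesis unfolding polynomial_fun_def using A(1) B(1) by (intro exI[of _ "A \<union> B"] exI conjI ext) auto
qed

lemma polynomial_fun_monomial_mult:
  fixes p :: "complex^'d \<Rightarrow> complex"
  assumes "polynomial_fun p"
  shows "polynomial_fun (\<lambda>z. b * (z $ i) ^ t * p z)"
proof -
  obtain A c where A: "finite A" "p = (\<lambda>z. \<Sum>\<alpha>\<in>A. c \<alpha> * (\<Prod>i\<in>UNIV. (z $ i) ^ \<alpha> i))"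
    using assms unfolding polynomial_fun_def by blast
  \<comment> \<open>Multiplication by the monomial shifts the exponent at \<open>i\<close> by
    \<open>t\<close>. The shift is injective, so coefficients are read back by subtracting
    \<open>t\<close>.\<close>
  let ?s = "\<lambda>\<alpha> :: 'd \<Rightarrow> nat. \<alpha>(i := \<alpha> i + t)"
  have inj: "inj_on ?s A"
    by (rule inj_onI) (metis (no_types, lifting) add_right_cancel ext fun_upd_apply)
  have "b * (z $ i) ^ t * p z = (\<Sum>\<beta>\<in>?s ` A. (b * c (\<beta>(i := \<beta> i - t))) * (\<Prod>j\<in>UNIV. (z $ j) ^ \<beta> j))" for z
  proof -
    have m: "(\<Prod>j\<in>UNIV. (z $ j) ^ ?s \<alpha> j) = (z $ i) ^ t * (\<Prod>j\<in>UNIV. (z $ j) ^ \<alpha> j)" for \<alpha>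
    proof -
      have "(\<Prod>j\<in>UNIV. (z $ j) ^ ?s \<alpha> j) = (\<Prod>j\<in>UNIV. (if j = i then (z $ i) ^ t else 1) * (z $ j) ^ \<alpha> j)"
        by (intro prod.cong) (auto simp: power_add)
      then show ?thesis by (simp add: prod.distrib)
    qed
    have "(\<Sum>\<beta>\<in>?s ` A. (b * c (\<beta>(i := \<beta> i - t))) * (\<Prod>j\<in>UNIV. (z $ j) ^ \<beta> j))
      = (\<Sum>\<alpha>\<in>A. b * c \<alpha> * (\<Prod>j\<in>UNIV. (z $ j) ^ ?s \<alpha> j))"
      by (subst sum.reindex[OF inj]) simp
    also have "\<dots> = b * (z $ i) ^ t * p z"
      unfolding m A(2) by (simp add: sum_distrib_left mult_ac)
    finally show ?thesis by simp
  qed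
  then show ?thesis unfolding polynomial_fun_def using A(1) by (intro exI[of _ "?s ` A"] exI conjI ext) auto
qed

lemma polynomial_fun_sum:
  "finite I \<Longrightarrow> (\<And>i. i \<in> I \<Longrightarrow> polynomial_fun (p i)) \<Longrightarrow> polynomial_fun (\<lambda>z. \<Sum>i\<in>I. p i z)"
  by (induction I rule: finite_induct) (auto intro: polynomial_fun_const polynomial_fun_add)

text \<open>The numbers \<open>c s t\<close> are the coefficients of the Lagrange basis polynomials
  for the nodes 0, ..., k. What matters is that they do not depend on \<open>q\<close>: one formula
  then applies to all restrictions of a function to lines parallel to an axis.\<close>

lemma lagrange_interpolation:
  obtains c :: "nat \<Rightarrow> nat \<Rightarrow> complex" where
    "\<And>q x. degree q \<le> k \<Longrightarrow> poly q x = (\<Sum>s\<le>k. \<Sum>t\<le>k. c s t * x ^ t * poly q (of_nat s))"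
proof -
  define L :: "nat \<Rightarrow> complex poly" where
    "L s = (\<Prod>u\<in>{..k} - {s}. smult (inverse (of_nat s - of_nat u)) [:- of_nat u, 1:])" for s
  have deg: "degree (L s) \<le> k" if "s \<le> k" for s
  proof -
    have "degree (L s) \<le> (\<Sum>u\<in>{..k} - {s}. 1)" unfolding L_def
      by (rule order_trans[OF degree_prod_sum_le]) (auto intro!: sum_mono)
    then show ?thesis using that by simp
  qed
  have L: "poly (L s) (of_nat r) = (if r = s then 1 else 0)" if "s \<le> k" "r \<le> k" for r s
  proof (cases "r = s")
    case True
    have "poly (smult (inverse (of_nat s - of_nat u)) [:- of_nat u, 1:]) (of_nat s) = (1 :: complex)"
      if "u \<noteq> s" for u
    proof -
      have "complex_of_nat s - of_nat u \<noteq> 0" using that by simp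
      then have "inverse (complex_of_nat s - of_nat u) * (complex_of_nat s - of_nat u) = 1" by (rule left_inverse)
      then show ?thesis by (simp add: algebra_simps)
    qed
    then show ?thesis using True unfolding L_def poly_prod by (auto intro!: prod.neutral simp del: poly_smult)
  next
    case False
    then show ?thesis unfolding L_def poly_prod using that by (auto intro!: prod_zero)
  qed
  have "poly q x = (\<Sum>s\<le>k. \<Sum>t\<le>k. coeff (L s) t * x ^ t * poly q (of_nat s))" if q: "degree q \<le> k" for q x
  proof -
    let ?p = "\<Sum>s\<le>k. smult (poly q (of_nat s)) (L s)"
    have "q = ?p"
    proof (rule poly_eqI_degree[where A = "of_nat ` {..k}"])
      fix x :: complex assume "x \<in> of_nat ` {..k}"
      then obtain r where r: "r \<le> k" "x = of_nat r" by auto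
      have "poly ?p x = (\<Sum>s\<le>k. poly q (of_nat s) * (if r = s then 1 else 0))"
        unfolding poly_sum r(2) by (intro sum.cong) (use r L in auto)
      then show "poly q x = poly ?p x" using r by (simp add: if_distrib cong: if_cong)
    next
      have c: "card (of_nat ` {..k} :: complex set) = Suc k" by (subst card_image) auto
      show "degree q < card (of_nat ` {..k} :: complex set)" using q c by simp
      have "degree ?p \<le> k" by (rule degree_sum_le) (auto intro: order_trans[OF degree_smult_le] deg)
      then show "degree ?p < card (of_nat ` {..k} :: complex set)" using c by simp
    qed
    then have "poly q x = (\<Sum>s\<le>k. poly q (of_nat s) * poly (L s) x)"
      by (metis (mono_tags, lifting) poly_smult poly_sum sum.cong)
    also have "\<dots> = (\<Sum>s\<le>k. \<Sum>t\<le>k. coeff (L s) t * x ^ t * poly q (of_nat s))"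
    proof (rule sum.cong[OF refl])
      fix s assume "s \<in> {..k}"
      then have "degree (L s) \<le> k" by (simp add: deg)
      then have "poly (L s) x = (\<Sum>t\<le>k. coeff (L s) t * x ^ t)"
        unfolding poly_altdef by (intro sum.mono_neutral_left) (auto simp: coeff_eq_0)
      then show "poly q (of_nat s) * poly (L s) x = (\<Sum>t\<le>k. coeff (L s) t * x ^ t * poly q (of_nat s))"
        by (simp add: sum_distrib_left mult_ac)
    qed
    finally show ?thesis .
  qed
  then show ?thesis by (rule that)
qed

text \<open>Variables are released one at a time: those in \<open>I\<close> are free, the others
  frozen at \<open>y\<close>. Interpolation in the new variable \<open>i\<close> leaves finitely
  many functions in which \<open>i\<close> is frozen at a node, so the induction hypothesis is
  needed for all \<open>y\<close>.\<close>

lemma polynomial_fun_separately: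
  fixes g :: "complex^'d \<Rightarrow> complex"
  assumes "\<And>z i. \<exists>q. degree q \<le> k \<and> (\<forall>t. g (\<chi> j. if j = i then t else z $ j) = poly q t)"
  shows "polynomial_fun g"
proof -
  obtain c :: "nat \<Rightarrow> nat \<Rightarrow> complex" where c:
    "\<And>q x. degree q \<le> k \<Longrightarrow> poly q x = (\<Sum>s\<le>k. \<Sum>t\<le>k. c s t * x ^ t * poly q (of_nat s))"
    using lagrange_interpolation by blast
  have "polynomial_fun (\<lambda>z. g (\<chi> j. if j \<in> I then z $ j else y $ j))" if "finite I" for I y
    using that
  proof (induction I arbitrary: y rule: finite_induct)
    case empty
    then show ?case by (simp add: polynomial_fun_const)
  next
    case (insert i I)
    let ?y = "\<lambda>s::nat. \<chi> j. if j = i then of_nat s else y $ j"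
    have "g (\<chi> j. if j \<in> insert i I then z $ j else y $ j)
      = (\<Sum>s\<le>k. \<Sum>t\<le>k. c s t * (z $ i) ^ t * g (\<chi> j. if j \<in> I then z $ j else ?y s $ j))" for z
    proof -
      obtain q where q: "degree q \<le> k"
        "\<forall>t. g (\<chi> j. if j = i then t else (\<chi> j. if j \<in> I then z $ j else y $ j) $ j) = poly q t"
        using assms by blast
      have eq: "(\<chi> j. if j \<in> insert i I then z $ j else y $ j)
        = (\<chi> j. if j = i then z $ i else (\<chi> j. if j \<in> I then z $ j else y $ j) $ j)"
        using insert by (auto simp: vec_eq_iff)
      have "g (\<chi> j. if j \<in> insert i I then z $ j else y $ j) = poly q (z $ i)"
        unfolding eq by (rule q(2)[rule_format])
      moreover have eq': "(\<chi> j. if j \<in> I then z $ j else ?y s $ j)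
        = (\<chi> j. if j = i then of_nat s else (\<chi> j. if j \<in> I then z $ j else y $ j) $ j)" for s
        using insert by (auto simp: vec_eq_iff)
      have "g (\<chi> j. if j \<in> I then z $ j else ?y s $ j) = poly q (of_nat s)" for s
        unfolding eq' by (rule q(2)[rule_format])
      ultimately show ?thesis using c[OF q(1), of "z $ i"] by simp
    qed
    then show ?case
      using insert.IH by (auto intro!: polynomial_fun_sum polynomial_fun_monomial_mult)
  qed
  from this[of UNIV] show ?thesis by simp
qed

text \<open>The Taylor coefficient of order \<open>k\<close> on the complex line through 0 and
  \<open>z\<close>, that is, the term of degree \<open>k\<close> in the expansion at 0. For
  \<open>f\<close> holomorphic near 0 it makes sense at every \<open>z\<close>, inside the domain or
  not, because only small \<open>t\<close> enter.\<close>

definition homogeneous_part :: "(complex^'d \<Rightarrow> complex) \<Rightarrow> nat \<Rightarrow> complex^'d \<Rightarrow> complex" where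
  "homogeneous_part f k z = (deriv ^^ k) (\<lambda>t. f (t *s z)) 0 / fact k"

locale hol_at_zero =
  fixes G :: "(complex^'d) set" and f :: "complex^'d \<Rightarrow> complex" and r C :: real
  assumes f: "f \<in> hol G" and r: "r > 0" "cball 0 r \<subseteq> G"
    and C: "\<And>x. x \<in> cball 0 r \<Longrightarrow> cmod (f x) \<le> C"
begin

lemma C_nonneg: "C \<ge> 0"
proof -
  have "cmod (f 0) \<le> C" using r by (intro C) auto
  then show ?thesis using norm_ge_zero[of "f 0"] by linarith
qed

text \<open>The radius depends on \<open>m\<close> alone and not on \<open>y\<close>, which makes
  the later estimates uniform on balls and covers \<open>y = 0\<close>.\<close>

lemma line:
  assumes y: "norm y \<le> m" and m: "m > 0"
  shows "(\<lambda>t. f (t *s y)) holomorphic_on ball 0 (r / m)"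
    and "continuous_on (cball 0 (r / m)) (\<lambda>t. f (t *s y))"
    and "\<And>t. norm t = r / m \<Longrightarrow> cmod (f (t *s y)) \<le> C"
proof -
  have sub: "t *s y \<in> cball 0 r" if "t \<in> cball 0 (r / m)" for t
  proof -
    have "cmod t * norm y \<le> r / m * m" using that y m r by (intro mult_mono) auto
    then show ?thesis using m by (simp add: norm_vector_scalar_mult)
  qed
  have "(\<lambda>t. f (0 + t *s y)) holomorphic_on cball 0 (r / m)"
    by (rule holomorphic_on_subset[OF holomorphic_on_line[OF f]]) (use sub r in auto)
  then have hol: "(\<lambda>t. f (t *s y)) holomorphic_on cball 0 (r / m)" by simp
  then show "(\<lambda>t. f (t *s y)) holomorphic_on ball 0 (r / m)"
    by (rule holomorphic_on_subset) auto
  show "continuous_on (cball 0 (r / m)) (\<lambda>t. f (t *s y))"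
    using hol by (rule holomorphic_on_imp_continuous_on)
  show "cmod (f (t *s y)) \<le> C" if "norm t = r / m" for t
    using that sub[of t] C by simp
qed

lemma homogeneous_part_bound:
  assumes y: "norm y \<le> m" and m: "m > 0"
  shows "cmod (homogeneous_part f k y) \<le> C * (m / r) ^ k"
proof -
  have "cmod ((deriv ^^ k) (\<lambda>t. f (t *s y)) 0) \<le> fact k * C / (r / m) ^ k"
    by (rule Cauchy_inequality[OF line(1,2)[OF y m]]) (use line(3)[OF y m] r m in auto)
  then show ?thesis
    unfolding homogeneous_part_def using m r
    by (simp add: norm_divide field_simps)
qed

text \<open>The scaled remainders on the left are holomorphic in \<open>y\<close> once the lower homogeneous parts are, which
  makes \<open>homogeneous_part f k\<close> separately entire by induction on \<open>k\<close>.\<close>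

lemma homogeneous_part_approx:
  assumes y: "norm y \<le> m" and m: "m > 0" and n: "real n \<ge> 2 * m / r" "n > 0"
  shows "cmod ((f ((1 / of_nat n) *s y) - (\<Sum>l<k. homogeneous_part f l y * (1 / of_nat n) ^ l)) * of_nat n ^ k
      - homogeneous_part f k y) \<le> 2 * C * (m / r) ^ Suc k / n"
proof -
  let ?x = "1 / complex_of_nat n"
  have x: "norm ?x = 1 / n" using n by (simp add: norm_divide)
  have q: "norm ?x / (r / m) = m / r / n" using x by simp
  \<comment> \<open>The largeness of \<open>n\<close> puts the ratio of the geometric series at 1/2
    or below, so the denominator of the remainder costs only the factor 2.\<close>
  have q2: "m / r / n \<le> 1 / 2" using n r m by (simp add: field_simps)
  have "1 / n < r / m"
  proof -
    have "m < r * n" using n r m by (simp add: field_simps)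
    then show ?thesis using m n by (simp add: field_simps)
  qed
  then have "cmod (f (?x *s y) - (\<Sum>l<Suc k. (deriv ^^ l) (\<lambda>t. f (t *s y)) 0 / fact l * ?x ^ l))
      \<le> C * (norm ?x / (r / m)) ^ Suc k / (1 - norm ?x / (r / m))"
    by (intro taylor_remainder[OF line(1,2)[OF y m] _ line(3)[OF y m]]) (use x r m in auto)
  also have "\<dots> \<le> C * (m / r / n) ^ Suc k / (1 / 2)"
  proof -
    have 1: "m / r / n \<ge> 0" using m r by simp
    have 2: "0 < 1 - m / r / n" using q2 by linarith
    show ?thesis unfolding q
    proof (rule divide_left_mono)
      show "0 \<le> C * (m / r / n) ^ Suc k" by (intro mult_nonneg_nonneg zero_le_power C_nonneg 1)
    qed (use 2 q2 in auto)
  qed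
  finally have 1: "cmod (f (?x *s y) - (\<Sum>l<Suc k. homogeneous_part f l y * ?x ^ l)) \<le> 2 * C * (m / r / n) ^ Suc k"
    by (simp add: homogeneous_part_def mult_ac)
  have nk: "complex_of_nat n ^ k * ?x ^ k = 1" using n by (simp add: power_one_over)
  have "(f (?x *s y) - (\<Sum>l<k. homogeneous_part f l y * ?x ^ l)) * of_nat n ^ k - homogeneous_part f k y
      = (f (?x *s y) - (\<Sum>l<Suc k. homogeneous_part f l y * ?x ^ l)) * of_nat n ^ k"
    using nk by (simp add: algebra_simps)
  also have "cmod \<dots> \<le> 2 * C * (m / r / n) ^ Suc k * n ^ k"
    unfolding norm_mult norm_power using mult_right_mono[OF 1, of "real n ^ k"] by simp
  also have "\<dots> = 2 * C * (m / r) ^ Suc k / n"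
    using n by (simp add: power_divide field_simps)
  finally show ?thesis .
qed

lemma homogeneous_part_separately_holomorphic:
  assumes G: "open G"
  shows "(\<lambda>t. homogeneous_part f k (\<chi> j. if j = i then t else z $ j)) holomorphic_on UNIV"
proof (induction k rule: less_induct)
  case (less k)
  define Y where "Y t = (\<chi> j. if j = i then t else z $ j)" for t :: complex
  have Y: "Y t = Y 0 + t *s axis i 1" for t by (auto simp: Y_def vec_eq_iff axis_def)
  have IH: "(\<lambda>t. homogeneous_part f l (Y t)) holomorphic_on S" if "l < k" for l S
    using less[OF that] unfolding Y_def by (rule holomorphic_on_subset) auto
  have "(\<lambda>t. homogeneous_part f k (Y t)) holomorphic_on ball 0 \<rho>" if \<rho>: "\<rho> > 0" for \<rho>
  proof -
    define m where "m = norm (Y 0) + \<rho>"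
    have m: "m > 0" using \<rho> by (simp add: m_def add_nonneg_pos)
    have Ym: "norm (Y t) \<le> m" if "t \<in> ball 0 \<rho>" for t
    proof -
      have "norm (Y t) \<le> norm (Y 0) + norm (t *s (axis i 1 :: complex^'d))"
        using norm_triangle_ineq Y[of t] by metis
      also have "\<dots> \<le> m" using that by (simp add: m_def norm_vector_scalar_mult)
      finally show ?thesis .
    qed
    obtain n0 where n0: "2 * m / r \<le> real n0" using real_arch_simple by blast
    \<comment> \<open>The shift makes the lower bound \<open>2 * m / r\<close> hold from the first
      index on, so every \<open>u n\<close> is evaluated inside \<open>G\<close> on the whole disc,
      and it excludes a division by 0.\<close>
    define N where "N n = n + Suc n0" for n
    have N: "2 * m / r \<le> real (N n)" "N n > 0" for n using n0 by (auto simp: N_def)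
    define u where "u n t = (f ((1 / of_nat (N n)) *s Y t)
      - (\<Sum>l<k. homogeneous_part f l (Y t) * (1 / of_nat (N n)) ^ l)) * of_nat (N n) ^ k" for n t
    have inG: "(1 / of_nat (N n)) *s Y t \<in> G" if "t \<in> ball 0 \<rho>" for n t
    proof -
      have "2 * m \<le> r * N n" using N(1)[of n] r by (simp add: field_simps)
      then have "norm (Y t) \<le> r * N n" using Ym[OF that] m by linarith
      then have "norm ((1 / complex_of_nat (N n)) *s Y t) \<le> r"
        using N(2)[of n] by (simp add: norm_vector_scalar_mult norm_divide field_simps)
      then show ?thesis using r by auto
    qed
    have holu: "u n holomorphic_on ball 0 \<rho>" for n
    proof -
      have eq: "(1 / of_nat (N n)) *s Y t = (1 / of_nat (N n)) *s Y 0 + t *s ((1 / of_nat (N n)) *s axis i 1)" for t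
        by (subst Y) (simp add: vec_eq_iff algebra_simps)
      have "(\<lambda>t. f ((1 / of_nat (N n)) *s Y t)) holomorphic_on ball 0 \<rho>"
      proof -
        have "ball 0 \<rho> \<subseteq> {t. (1 / of_nat (N n)) *s Y 0 + t *s ((1 / of_nat (N n)) *s axis i 1) \<in> G}"
          unfolding eq[symmetric] using inG[of _ n] by blast
        from holomorphic_on_subset[OF holomorphic_on_line[OF f] this]
        show ?thesis unfolding eq[symmetric] .
      qed
      then show ?thesis unfolding u_def by (auto intro!: holomorphic_intros IH)
    qed
    have "uniform_limit (ball 0 \<rho>) u (\<lambda>t. homogeneous_part f k (Y t)) sequentially"
      unfolding uniform_limit_iff
    proof (intro allI impI)
      fix e :: real assume e: "e > 0"
      let ?B = "2 * C * (m / r) ^ Suc k"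
      have B: "?B \<ge> 0" using C_nonneg m r by simp
      obtain M where M: "?B / e < real M" using reals_Archimedean2 by blast
      have "dist (u n t) (homogeneous_part f k (Y t)) < e" if n: "n \<ge> M" and t: "t \<in> ball 0 \<rho>" for n t
      proof -
        have "dist (u n t) (homogeneous_part f k (Y t)) \<le> ?B / N n"
          unfolding dist_norm u_def by (rule homogeneous_part_approx[OF Ym[OF t] m N])
        also have "\<dots> < e"
        proof -
          have "?B < real M * e" using M unfolding pos_divide_less_eq[OF e] .
          also have "\<dots> \<le> real (N n) * e" using n e by (intro mult_right_mono) (auto simp: N_def)
          finally have "?B < e * real (N n)" by (simp only: mult.commute)
          then show ?thesis using N(2)[of n] by (subst pos_divide_less_eq) auto
        qed
        finally show ?thesis .
      qed
      then show "\<forall>\<^sub>F n in sequentially. \<forall>t\<in>ball 0 \<rho>. dist (u n t) (homogeneous_part f k (Y t)) < e"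
        unfolding eventually_sequentially by blast
    qed
    then have "\<exists>d>0. cball x d \<subseteq> ball 0 \<rho> \<and>
        uniform_limit (cball x d) u (\<lambda>t. homogeneous_part f k (Y t)) sequentially"
      if "x \<in> ball 0 \<rho>" for x
      using that open_contains_cball[of "ball 0 \<rho>"] uniform_limit_on_subset by (metis open_ball)
    then show ?thesis by (rule holomorphic_uniform_sequence[OF open_ball holu])
  qed
  then have "(\<lambda>t. homogeneous_part f k (Y t)) holomorphic_on (\<Union>\<rho>\<in>{0<..}. ball 0 \<rho>)"
    by (intro holomorphic_on_UN_open) auto
  moreover have "(\<Union>\<rho>\<in>{0<..}. ball (0::complex) \<rho>) = UNIV"
  proof (intro equalityI subsetI)
    fix x :: complex
    have "x \<in> ball 0 (norm x + 1)" by simp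
    then show "x \<in> (\<Union>\<rho>\<in>{0<..}. ball 0 \<rho>)" by (intro UN_I[of "norm x + 1"]) (auto simp: add_nonneg_pos)
  qed auto
  ultimately show ?case by (simp add: Y_def)
qed

text \<open>Liouville's theorem in each variable: the homogeneous part is entire there and grows at
  most like the power \<open>k\<close>. The resulting degree bound is \<open>k\<close> for every
  choice of the other variables, as the interpolation argument requires.\<close>

lemma polynomial_fun_homogeneous_part:
  assumes G: "open G"
  shows "polynomial_fun (homogeneous_part f k)"
proof (rule polynomial_fun_separately[where k = k])
  fix z :: "complex^'d" and i
  define h where "h t = homogeneous_part f k (\<chi> j. if j = i then t else z $ j)" for t
  define A where "A = norm (\<chi> j. if j = i then 0 else z $ j) + 1"
  have A: "A \<ge> 1" by (simp add: A_def)
  have growth: "cmod (h t) \<le> C * (2 / r) ^ k * norm t ^ k" if t: "A \<le> norm t" for t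
  proof -
    have "(\<chi> j. if j = i then t else z $ j) = (\<chi> j. if j = i then 0 else z $ j) + t *s axis i 1"
      by (auto simp: vec_eq_iff axis_def)
    then have "norm (\<chi> j. if j = i then t else z $ j)
      \<le> norm (\<chi> j. if j = i then 0 else z $ j) + norm (t *s (axis i 1 :: complex^'d))"
      using norm_triangle_ineq by metis
    also have "\<dots> \<le> 2 * norm t" using t by (simp add: A_def norm_vector_scalar_mult)
    finally have "cmod (h t) \<le> C * (2 * norm t / r) ^ k"
      unfolding h_def using t A by (intro homogeneous_part_bound) auto
    then show ?thesis by (simp add: power_divide power_mult_distrib mult_ac)
  qed
  have "h t = (\<Sum>l\<le>k. (deriv ^^ l) h 0 / fact l * t ^ l)" for t
    using homogeneous_part_separately_holomorphic[OF G, of k i z] growth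
    by (intro Liouville_polynomial[where A = A]) (auto simp: h_def)
  then have 1: "h t = poly (\<Sum>l\<le>k. monom ((deriv ^^ l) h 0 / fact l) l) t" for t
    by (simp add: poly_sum poly_monom)
  have 2: "degree (\<Sum>l\<le>k. monom ((deriv ^^ l) h 0 / fact l) l) \<le> k"
    by (rule degree_sum_le) (auto intro: order_trans[OF degree_monom_le])
  show "\<exists>q. degree q \<le> k \<and> (\<forall>t. homogeneous_part f k (\<chi> j. if j = i then t else z $ j) = poly q t)"
  proof (intro exI[of _ "\<Sum>l\<le>k. monom ((deriv ^^ l) h 0 / fact l) l"] conjI allI 2)
    show "homogeneous_part f k (\<chi> j. if j = i then t else z $ j)
      = poly (\<Sum>l\<le>k. monom ((deriv ^^ l) h 0 / fact l) l) t" for t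
      unfolding h_def[of t, symmetric] by (rule 1)
  qed
qed

end

text \<open>Partial sums of the dilations \<open>z \<mapsto> f (s z)\<close> with \<open>s < 1\<close> replace Cesaro means: their
  remainder is geometric with a constant that is uniform on \<open>G\<close> relative to the weight.\<close>

lemma polynomial_approximation:
  fixes f :: "complex^'d \<Rightarrow> complex"
  assumes G: "open G" "balanced G" and f: "f \<in> hol G"
    and w: "\<And>\<zeta>. \<zeta> \<in> G \<Longrightarrow> cmod (f \<zeta>) \<le> w \<zeta>" "\<And>\<zeta> c. \<zeta> \<in> G \<Longrightarrow> cmod c = 1 \<Longrightarrow> w (c *s \<zeta>) = w \<zeta>"
    and z: "z \<in> G" and e: "e > 0"
  obtains p where "polynomial_fun p" "\<And>\<zeta>. \<zeta> \<in> G \<Longrightarrow> cmod (p \<zeta>) \<le> 2 * w \<zeta>" "cmod (p z - f z) < e"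
proof -
  have bal: "c *s \<zeta> \<in> G" if "\<zeta> \<in> G" "cmod c \<le> 1" for c \<zeta>
    using G(2) that unfolding balanced_def by blast
  have "0 \<in> G" using bal[OF z, of 0] by simp
  then obtain r where r: "r > 0" "cball 0 r \<subseteq> G" using G(1) open_contains_cball by blast
  have "compact (f ` cball 0 r)"
    using r continuous_on_hol[OF f] by (intro compact_continuous_image) (auto intro: continuous_on_subset)
  then obtain C where C: "\<And>x. x \<in> cball 0 r \<Longrightarrow> cmod (f x) \<le> C"
    using compact_imp_bounded bounded_iff by (metis imageI)
  interpret hol_at_zero G f r C using f r C by unfold_locales
  have hol: "(\<lambda>t. f (t *s \<zeta>)) holomorphic_on cball 0 1" if "\<zeta> \<in> G" for \<zeta>
  proof -
    have "(\<lambda>t. f (0 + t *s \<zeta>)) holomorphic_on cball 0 1"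
      by (rule holomorphic_on_subset[OF holomorphic_on_line[OF f]]) (use bal that in auto)
    then show ?thesis by simp
  qed
  have holb: "(\<lambda>t. f (t *s \<zeta>)) holomorphic_on ball 0 1" and cont: "continuous_on (cball 0 1) (\<lambda>t. f (t *s \<zeta>))"
    if "\<zeta> \<in> G" for \<zeta>
    using hol[OF that] holomorphic_on_imp_continuous_on by (auto intro: holomorphic_on_subset)
  have bnd: "cmod (f (t *s \<zeta>)) \<le> w \<zeta>" if "\<zeta> \<in> G" "cmod t = 1" for \<zeta> t
    using w(1)[OF bal[OF that(1)], of t] w(2)[OF that] that by simp
  \<comment> \<open>For \<open>cmod t < 1\<close> the value of \<open>w\<close> at
    \<open>t *s \<zeta>\<close> is not controlled by \<open>w \<zeta>\<close>. The bound holds on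
    the unit circle by radiality and is carried inwards by the maximum principle.\<close>
  have maxmod: "cmod (f (t *s \<zeta>)) \<le> w \<zeta>" if "\<zeta> \<in> G" "cmod t < 1" for \<zeta> t
    by (rule maximum_modulus_frontier[where S = "cball 0 1" and f = "\<lambda>t. f (t *s \<zeta>)" and \<xi> = t])
      (use holb[OF that(1)] cont[OF that(1)] bnd[OF that(1)] that(2) in auto)
  have wz: "w z \<ge> 0" using w(1)[OF z] norm_ge_zero order_trans by blast
  have "isCont (\<lambda>s. f (of_real s *s z)) 1"
  proof -
    have "isCont f (of_real 1 *s z)"
      using continuous_on_hol[OF f] G(1) z by (simp add: continuous_on_eq_continuous_at)
    moreover have "isCont (\<lambda>s::real. complex_of_real s *s z) 1"
      by (rule isCont_o2[where f = complex_of_real and g = "\<lambda>c. c *s z"])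
        (auto intro: linear_continuous_at bounded_linear_scalar_line)
    ultimately show ?thesis
      using isCont_o2[where f = "\<lambda>s. complex_of_real s *s z" and g = f and a = 1] by simp
  qed
  from this[unfolded continuous_at_eps_delta, rule_format, of "e / 2"] e
  obtain d where d: "d > 0" "\<And>s. dist s 1 < d \<Longrightarrow> dist (f (of_real s *s z)) (f (of_real 1 *s z)) < e / 2"
    by auto
  define s where "s = max (1 / 2) (1 - d / 2)"
  have s: "0 < s" "s < 1" "dist s 1 < d" using d(1) by (auto simp: s_def dist_real_def)
  have fs: "cmod (f (of_real s *s z) - f z) < e / 2" using d(2)[OF s(3)] by (simp add: dist_norm)
  \<comment> \<open>The condition \<open>s ^ j < \<eta>\<close> makes the remainder at most
    \<open>w \<zeta>\<close> on all of \<open>G\<close>, whence the factor 2 in the conclusion, and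
    less than \<open>e / 2\<close> at \<open>z\<close>. The summand 1 avoids a division by 0 when
    \<open>w z = 0\<close>.\<close>
  define \<eta> where "\<eta> = (1 - s) * min 1 (e / (2 * (w z + 1)))"
  have \<eta>: "\<eta> > 0" using s e wz by (simp add: \<eta>_def)
  obtain j where j: "s ^ j < \<eta>"
    using real_arch_pow_inv[OF \<eta> s(2)] by blast
  have "s ^ j / (1 - s) < min 1 (e / (2 * (w z + 1)))"
    unfolding pos_divide_less_eq[of "1 - s", OF diff_gt_0_iff_gt[THEN iffD2, OF s(2)]]
    using j by (simp only: \<eta>_def mult.commute)
  then have j1: "s ^ j / (1 - s) \<le> 1" and j2: "s ^ j / (1 - s) \<le> e / (2 * (w z + 1))" by auto
  define p where "p \<zeta> = (\<Sum>l<j. of_real s ^ l * homogeneous_part f l \<zeta>)" for \<zeta>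
  have rem: "cmod (f (of_real s *s \<zeta>) - p \<zeta>) \<le> w \<zeta> * (s ^ j / (1 - s))" if "\<zeta> \<in> G" for \<zeta>
  proof -
    have "cmod (f (of_real s *s \<zeta>) - (\<Sum>l<j. (deriv ^^ l) (\<lambda>t. f (t *s \<zeta>)) 0 / fact l * of_real s ^ l))
      \<le> w \<zeta> * (norm (complex_of_real s) / 1) ^ j / (1 - norm (complex_of_real s) / 1)"
      by (rule taylor_remainder[OF holb[OF that] cont[OF that]]) (use bnd[OF that] s in auto)
    then show ?thesis using s by (simp add: p_def homogeneous_part_def mult_ac)
  qed
  show ?thesis
  proof (rule that[of p])
    show "polynomial_fun p"
    proof -
      have "polynomial_fun (\<lambda>z. of_real s ^ l * homogeneous_part f l z)" for l
        using polynomial_fun_monomial_mult[OF polynomial_fun_homogeneous_part[OF G(1)], of "of_real s ^ l" _ 0 l]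
        by simp
      then show ?thesis unfolding p_def by (intro polynomial_fun_sum) auto
    qed
    show "cmod (p \<zeta>) \<le> 2 * w \<zeta>" if "\<zeta> \<in> G" for \<zeta>
    proof -
      have "w \<zeta> \<ge> 0" using w(1)[OF that] norm_ge_zero order_trans by blast
      then have "w \<zeta> * (s ^ j / (1 - s)) \<le> w \<zeta>" using j1 mult_left_le by blast
      then show ?thesis
        using rem[OF that] maxmod[OF that, of "of_real s"] s
          norm_triangle_ineq4[of "f (of_real s *s \<zeta>)" "f (of_real s *s \<zeta>) - p \<zeta>"] by simp
    qed
    have "w z * (s ^ j / (1 - s)) \<le> w z * (e / (2 * (w z + 1)))" using j2 wz by (rule mult_left_mono)
    also have "\<dots> < e / 2" using wz e by (simp add: field_simps)
    finally have "cmod (f (of_real s *s z) - p z) < e / 2" using rem[OF z] by linarith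
    then show "cmod (p z - f z) < e"
      using fs norm_triangle_ineq4[of "f (of_real s *s z) - f z" "f (of_real s *s z) - p z"] by simp
  qed
qed


section \<open>Discs given by domination\<close>

text \<open>The seminorm properties hold for every disc; \<open>sep\<close> excludes a complex line
  inside \<open>D\<close> and so yields a norm. The infimum need not be attained, so the
  inequalities are proved up to an arbitrary positive \<open>e\<close>.\<close>

lemma Metric_space_minkowski:
  assumes D: "absolutely_convex D" and sep: "\<And>x. (\<And>r. r > 0 \<Longrightarrow> x \<in> dil r D) \<Longrightarrow> x = 0"
  shows "Metric_space (complex_vs.span D) (norm_dist (complex_vs.span D) (minkowski D))"
proof
  let ?M = "complex_vs.span D"
  have sym: "minkowski D (x - y) \<le> minkowski D (y - x)" if "x \<in> ?M" "y \<in> ?M" for x y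
  proof (rule field_le_epsilon)
    fix e :: real assume e: "e > 0"
    have yx: "y - x \<in> ?M" using that by (intro complex_vs.span_diff)
    then have "y - x \<in> dil (minkowski D (y - x) + e) D" using e by (intro minkowski_less_imp[OF D]) auto
    then have "(-1) *\<^sub>C (y - x) \<in> dil (minkowski D (y - x) + e) D"
      using minkowski_nonneg[OF D yx] e
      by (intro dil_scale[OF D, where s = "minkowski D (y - x) + e"]) simp_all
    then show "minkowski D (x - y) \<le> minkowski D (y - x) + e"
      using minkowski_nonneg[OF D yx] e by (intro minkowski_le) auto
  qed
  fix x y z
  show "0 \<le> norm_dist ?M (minkowski D) x y"
    unfolding norm_dist_def using minkowski_nonneg[OF D] complex_vs.span_diff by auto
  show "norm_dist ?M (minkowski D) x y = norm_dist ?M (minkowski D) y x"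
    unfolding norm_dist_def using sym[of x y] sym[of y x] by auto
  assume x: "x \<in> ?M" and y: "y \<in> ?M"
  show "(norm_dist ?M (minkowski D) x y = 0) = (x = y)"
  proof
    assume "norm_dist ?M (minkowski D) x y = 0"
    then have "minkowski D (x - y) = 0" using x y by (simp add: norm_dist_def)
    then have "x - y = 0" using x y by (intro sep minkowski_less_imp[OF D] complex_vs.span_diff) auto
    then show "x = y" by simp
  next
    assume "x = y"
    have "minkowski D 0 \<le> 0"
    proof (rule field_le_epsilon)
      fix e :: real assume "e > 0"
      moreover have "0 \<in> dil e D" using absolutely_convex_zero[OF D] by force
      ultimately show "minkowski D 0 \<le> 0 + e" using minkowski_le[of e 0 D] by simp
    qed
    then show "norm_dist ?M (minkowski D) x y = 0"
      using \<open>x = y\<close> x minkowski_nonneg[OF D complex_vs.span_zero] by (simp add: norm_dist_def)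
  qed
  assume z: "z \<in> ?M"
  have xy: "x - y \<in> ?M" and yz: "y - z \<in> ?M" using x y z by (auto intro: complex_vs.span_diff)
  have "minkowski D (x - z) \<le> minkowski D (x - y) + minkowski D (y - z)"
  proof (rule field_le_epsilon)
    fix e :: real assume e: "e > 0"
    have 1: "x - y \<in> dil (minkowski D (x - y) + e / 2) D"
      by (rule minkowski_less_imp[OF D xy]) (use e in simp)
    have 2: "y - z \<in> dil (minkowski D (y - z) + e / 2) D"
      by (rule minkowski_less_imp[OF D yz]) (use e in simp)
    have 3: "0 \<le> minkowski D (x - y)" "0 \<le> minkowski D (y - z)"
      using minkowski_nonneg[OF D] xy yz by auto
    have "(x - y) + (y - z) \<in> dil ((minkowski D (x - y) + e / 2) + (minkowski D (y - z) + e / 2)) D"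
      using 3 e by (intro dil_add[OF D 1 2]) auto
    then have "minkowski D ((x - y) + (y - z)) \<le> (minkowski D (x - y) + e / 2) + (minkowski D (y - z) + e / 2)"
      using 3 e by (intro minkowski_le) auto
    then show "minkowski D (x - z) \<le> minkowski D (x - y) + minkowski D (y - z) + e" by simp
  qed
  then show "norm_dist ?M (minkowski D) x z \<le> norm_dist ?M (minkowski D) x y + norm_dist ?M (minkowski D) y z"
    using x y z by (simp add: norm_dist_def)
qed

lemma absorbing_disc_span:
  assumes D: "absolutely_convex D"
  shows "absorbing_disc (complex_vs.span D) D"
proof
  show "complex_vs.subspace (complex_vs.span D)" by simp
  show "D \<subseteq> complex_vs.span D" by (rule complex_vs.span_superset)
  show "\<exists>r>0. x \<in> dil r D" if "x \<in> complex_vs.span D" for x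
    using that unfolding span_absolutely_convex[OF D] by auto
qed (rule D)

text \<open>At each point the metric balls and the translated dilates of \<open>D\<close> are
  cofinal. This brings norm topologies into the form in which inclusions are compared by
  absorption.\<close>

lemma mtopology_minkowski:
  assumes D: "absolutely_convex D"
    and M: "Metric_space (complex_vs.span D) (norm_dist (complex_vs.span D) (minkowski D))"
  shows "Metric_space.mtopology (complex_vs.span D) (norm_dist (complex_vs.span D) (minkowski D))
    = gauge_topology (complex_vs.span D) D"
proof -
  let ?M = "complex_vs.span D"
  interpret M: Metric_space ?M "norm_dist ?M (minkowski D)" by (rule M)
  interpret absorbing_disc ?M D by (rule absorbing_disc_span[OF D])
  have "(\<exists>r>0. M.mball x r \<subseteq> W) \<longleftrightarrow> (\<exists>r>0. \<forall>v\<in>dil r D. x + v \<in> W)" if x: "x \<in> ?M" for x W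
  proof
    assume "\<exists>r>0. M.mball x r \<subseteq> W"
    then obtain r where r: "r > 0" "M.mball x r \<subseteq> W" by blast
    have "x + v \<in> W" if v: "v \<in> dil (r / 2) D" for v
    proof -
      have vM: "v \<in> ?M" using v dil_subset by blast
      have "(-1) *\<^sub>C v \<in> dil (r / 2) D" using r by (intro dil_scale[OF D v]) auto
      then have "minkowski D (x - (x + v)) \<le> r / 2" using r by (intro minkowski_le) auto
      then have "x + v \<in> M.mball x r" using x vM r complex_vs.span_add[OF x vM]
        by (auto simp: M.in_mball norm_dist_def)
      then show ?thesis using r by blast
    qed
    then show "\<exists>r>0. \<forall>v\<in>dil r D. x + v \<in> W" using r by (intro exI[of _ "r / 2"]) auto
  next
    assume "\<exists>r>0. \<forall>v\<in>dil r D. x + v \<in> W"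
    then obtain r where r: "r > 0" "\<forall>v\<in>dil r D. x + v \<in> W" by blast
    have "y \<in> W" if "y \<in> M.mball x r" for y
    proof -
      have y: "y \<in> ?M" "minkowski D (x - y) < r" using that by (auto simp: M.in_mball norm_dist_def)
      then have "x - y \<in> dil r D" using x by (intro minkowski_less_imp[OF D] complex_vs.span_diff)
      then have "(-1) *\<^sub>C (x - y) \<in> dil r D" using r by (intro dil_scale[OF D, of "x - y" r]) auto
      then have "x + (-1) *\<^sub>C (x - y) \<in> W" using r by blast
      then show ?thesis by simp
    qed
    then show "\<exists>r>0. M.mball x r \<subseteq> W" using r by blast
  qed
  then have "openin M.mtopology W \<longleftrightarrow> openin (gauge_topology ?M D) W" for W
    unfolding M.openin_mtopology openin_gauge_topology by blast
  then show ?thesis by (simp add: topology_eq)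
qed

lemma gauge_topology_inclusion:
  assumes "absorbing_disc E V" "absorbing_disc E' V'" and sub: "E \<subseteq> E'" and abs: "absorbs V' V"
  shows "continuous_map (gauge_topology E V) (gauge_topology E' V') (\<lambda>x. x)"
proof -
  interpret A: absorbing_disc E V by fact
  interpret B: absorbing_disc E' V' by fact
  obtain k where k: "k > 0" "V \<subseteq> dil k V'" using abs unfolding absorbs_def by blast
  show ?thesis
    unfolding continuous_map_def
  proof (intro conjI allI impI)
    show "(\<lambda>x. x) \<in> topspace (gauge_topology E V) \<rightarrow> topspace (gauge_topology E' V')" using sub by auto
    fix W assume W: "openin (gauge_topology E' V') W"
    show "openin (gauge_topology E V) {x \<in> topspace (gauge_topology E V). x \<in> W}"
      unfolding A.openin_gauge_topology A.topspace_gauge_topology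
    proof (intro conjI ballI)
      fix x assume x: "x \<in> {x \<in> E. x \<in> W}"
      then obtain r where r: "r > 0" "\<forall>v\<in>dil r V'. x + v \<in> W"
        using W unfolding B.openin_gauge_topology by blast
      have "dil (r / k) V \<subseteq> dil (r / k) (dil k V')" using k by (intro image_mono)
      also have "\<dots> = dil r V'" unfolding dil_dil using k by simp
      finally have "\<forall>v\<in>dil (r / k) V. x + v \<in> {x \<in> E. x \<in> W}"
        using r x A.dil_subset complex_vs.subspace_add[OF A.subspace] by blast
      then show "\<exists>r>0. \<forall>v\<in>dil r V. x + v \<in> {x \<in> E. x \<in> W}"
        using r k by (intro exI[of _ "r / k"]) auto
    qed auto
  qed
qed

section \<open>Discs of holomorphic functions below a pointwise bound\<close>

lemma dominated_mono: "(\<And>z. z \<in> G \<Longrightarrow> v z \<le> w z) \<Longrightarrow> dominated G v \<subseteq> dominated G w"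
  unfolding dominated_def by force

lemma dil_dominated:
  assumes r: "r > 0"
  shows "dil r (dominated G v) = dominated G (\<lambda>z. r * v z)"
proof (intro set_eqI)
  fix f
  have h: "complex_of_real (1 / r) *\<^sub>C f \<in> hol G \<longleftrightarrow> f \<in> hol G"
  proof
    assume "complex_of_real (1 / r) *\<^sub>C f \<in> hol G"
    then have "complex_of_real r *\<^sub>C complex_of_real (1 / r) *\<^sub>C f \<in> hol G"
      by (rule complex_vs.subspace_scale[OF subspace_hol])
    then show "f \<in> hol G" using r by (simp add: scaleC_scaleC)
  qed (rule complex_vs.subspace_scale[OF subspace_hol])
  show "f \<in> dil r (dominated G v) \<longleftrightarrow> f \<in> dominated G (\<lambda>z. r * v z)"
    unfolding mem_dil_iff[OF r] dominated_def mem_Collect_eq h complex_scaleC_apply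
    using r by (simp add: norm_mult norm_divide divide_le_eq mult.commute)
qed

lemma absolutely_convex_dominated:
  assumes v: "\<And>z. z \<in> G \<Longrightarrow> v z \<ge> 0"
  shows "absolutely_convex (dominated G v)"
  unfolding absolutely_convex_def
proof (intro conjI ballI allI impI)
  have "0 \<in> dominated G v"
    using v complex_vs.subspace_0[OF subspace_hol] by (auto simp: dominated_def)
  then show "dominated G v \<noteq> {}" by blast
  fix f g b c assume f: "f \<in> dominated G v" and g: "g \<in> dominated G v" and bc: "cmod b + cmod c \<le> 1"
  have "b *\<^sub>C f + c *\<^sub>C g \<in> hol G"
    using f g by (intro complex_vs.subspace_add complex_vs.subspace_scale subspace_hol) (auto simp: dominated_def)
  moreover have "cmod ((b *\<^sub>C f + c *\<^sub>C g) z) \<le> v z" if z: "z \<in> G" for z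
  proof -
    have "cmod ((b *\<^sub>C f + c *\<^sub>C g) z) \<le> cmod b * cmod (f z) + cmod c * cmod (g z)"
      using norm_triangle_ineq[of "b * f z" "c * g z"] by (simp add: complex_scaleC_apply norm_mult)
    also have "\<dots> \<le> cmod b * v z + cmod c * v z"
      using f g z by (intro add_mono mult_left_mono) (auto simp: dominated_def)
    also have "\<dots> \<le> v z" using mult_right_mono[OF bc v[OF z]] by (simp add: algebra_simps)
    finally show ?thesis .
  qed
  ultimately show "b *\<^sub>C f + c *\<^sub>C g \<in> dominated G v" by (simp add: dominated_def)
qed

lemma dominated_separated:
  assumes "\<And>r. r > 0 \<Longrightarrow> f \<in> dil r (dominated G v)"
  shows "f = 0"
proof
  fix z
  have f: "f \<in> dominated G (\<lambda>z. r * v z)" if "r > 0" for r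
    using assms[OF that] unfolding dil_dominated[OF that] .
  show "f z = 0 z"
  proof (cases "z \<in> G")
    case True
    have "cmod (f z) \<le> 0"
    proof (rule field_le_epsilon)
      fix e :: real assume e: "e > 0"
      have "cmod (f z) \<le> e / (\<bar>v z\<bar> + 1) * v z"
        using f[of "e / (\<bar>v z\<bar> + 1)"] e True unfolding dominated_def by (simp add: add_nonneg_pos)
      also have "\<dots> \<le> e" using e by (simp add: divide_le_eq add_nonneg_pos)
      finally show "cmod (f z) \<le> 0 + e" by simp
    qed
    then show ?thesis by simp
  next
    case False
    then show ?thesis using f[of 1] hol_outside unfolding dominated_def by auto
  qed
qed

text \<open>The bound \<open>v\<close> may be discontinuous, as can happen for the infinite infimum
  of reciprocal weights to which the lemma is applied; the continuous majorant \<open>v0\<close>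
  secures local uniformity. A Cauchy sequence converges pointwise, the Cauchy estimates pass to the
  limit, and the limit is holomorphic.\<close>

lemma mcomplete_dominated:
  assumes G: "open G" and v0: "continuous_on G v0" and v: "\<And>z. z \<in> G \<Longrightarrow> 0 \<le> v z" "\<And>z. z \<in> G \<Longrightarrow> v z \<le> v0 z"
  defines "M \<equiv> complex_vs.span (dominated G v)" and "d \<equiv> minkowski (dominated G v)"
  shows "Metric_space M (norm_dist M d)" and "Metric_space.mcomplete M (norm_dist M d)"
proof -
  have D: "absolutely_convex (dominated G v)" using v by (intro absolutely_convex_dominated)
  show MS: "Metric_space M (norm_dist M d)"
    unfolding M_def d_def using D dominated_separated by (rule Metric_space_minkowski)
  interpret Metric_space M "norm_dist M d" by (rule MS)
  show mcomplete
    unfolding mcomplete_def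
  proof (intro allI impI)
    fix f assume "MCauchy f"
    then have f: "range f \<subseteq> M" and cauchy: "\<And>e. e > 0 \<Longrightarrow> \<exists>N. \<forall>n n'. N \<le> n \<longrightarrow> N \<le> n' \<longrightarrow> norm_dist M d (f n) (f n') < e"
      unfolding MCauchy_def by blast+
    have fM: "f n \<in> M" for n using f by blast
    have "M \<subseteq> hol G" unfolding M_def
      by (rule complex_vs.span_minimal[OF _ subspace_hol]) (auto simp: dominated_def)
    then have hol: "f n \<in> hol G" for n using fM by blast
    have close: "\<exists>N. \<forall>n\<ge>N. \<forall>n'\<ge>N. \<forall>z\<in>G. cmod (f n z - f n' z) \<le> e * v z" if e: "e > 0" for e
    proof -
      obtain N where N: "\<And>n n'. n \<ge> N \<Longrightarrow> n' \<ge> N \<Longrightarrow> norm_dist M d (f n) (f n') < e" using cauchy[OF e] by blast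
      have "cmod (f n z - f n' z) \<le> e * v z" if "n \<ge> N" "n' \<ge> N" "z \<in> G" for n n' z
      proof -
        have "d (f n - f n') < e" using N[OF that(1,2)] fM by (simp add: norm_dist_def)
        moreover have "f n - f n' \<in> M" using fM unfolding M_def by (intro complex_vs.span_diff)
        ultimately have "f n - f n' \<in> dil e (dominated G v)"
          unfolding d_def M_def by (intro minkowski_less_imp[OF D])
        then have "f n - f n' \<in> dominated G (\<lambda>z. e * v z)" by (simp only: dil_dominated[OF e])
        then show ?thesis using that(3) by (simp add: dominated_def)
      qed
      then show ?thesis by blast
    qed
    have conv: "convergent (\<lambda>n. f n z)" if z: "z \<in> G" for z
      unfolding Cauchy_convergent_iff[symmetric]
    proof (rule metric_CauchyI)
      fix e :: real assume e: "e > 0"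
      then have "e / (v z + 1) > 0" using v(1)[OF z] by simp
      then obtain N where N: "\<forall>n\<ge>N. \<forall>n'\<ge>N. \<forall>z'\<in>G. cmod (f n z' - f n' z') \<le> e / (v z + 1) * v z'"
        using close by blast
      have "e / (v z + 1) * v z < e" using e v(1)[OF z] by (simp add: divide_less_eq)
      then have "\<forall>m\<ge>N. \<forall>n\<ge>N. dist (f m z) (f n z) < e"
        using N z unfolding dist_norm by (meson order_le_less_trans)
      then show "\<exists>N. \<forall>m\<ge>N. \<forall>n\<ge>N. dist (f m z) (f n z) < e" by blast
    qed
    define g where "g z = (if z \<in> G then lim (\<lambda>n. f n z) else 0)" for z
    have fg: "(\<lambda>n. f n z) \<longlonglongrightarrow> g z" if "z \<in> G" for z
      using conv[OF that] that by (simp add: g_def convergent_LIMSEQ_iff)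
    have lim: "\<exists>N. \<forall>n\<ge>N. \<forall>z\<in>G. cmod (f n z - g z) \<le> e * v z" if e: "e > 0" for e
    proof -
      obtain N where N: "\<forall>n\<ge>N. \<forall>n'\<ge>N. \<forall>z\<in>G. cmod (f n z - f n' z) \<le> e * v z" using close[OF e] by blast
      have "cmod (f n z - g z) \<le> e * v z" if "n \<ge> N" "z \<in> G" for n z
      proof (rule LIMSEQ_le_const2)
        show "(\<lambda>m. cmod (f n z - f m z)) \<longlonglongrightarrow> cmod (f n z - g z)" by (intro tendsto_intros fg that)
        show "\<exists>N. \<forall>m\<ge>N. cmod (f n z - f m z) \<le> e * v z" using N that by blast
      qed
      then show ?thesis by blast
    qed
    have g: "g \<in> hol G"
    proof (rule hol_weighted_limit[OF G v0 hol])
      show "\<exists>N. \<forall>n\<ge>N. \<forall>z\<in>G. cmod (f n z - g z) \<le> e * v0 z" if e: "e > 0" for e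
      proof -
        obtain N where N: "\<forall>n\<ge>N. \<forall>z\<in>G. cmod (f n z - g z) \<le> e * v z" using lim[OF e] by blast
        have "e * v z \<le> e * v0 z" if "z \<in> G" for z using v(2)[OF that] e by (intro mult_left_mono) auto
        then show ?thesis using N by (meson order_trans)
      qed
    qed (simp add: g_def)
    have diff: "\<exists>N. \<forall>n\<ge>N. f n - g \<in> dil e (dominated G v)" if e: "e > 0" for e
    proof -
      obtain N where N: "\<forall>n\<ge>N. \<forall>z\<in>G. cmod (f n z - g z) \<le> e * v z" using lim[OF e] by blast
      have "f n - g \<in> hol G" for n by (rule complex_vs.subspace_diff[OF subspace_hol hol g])
      then have "\<forall>n\<ge>N. f n - g \<in> dominated G (\<lambda>z. e * v z)" using N by (simp add: dominated_def)
      then show ?thesis unfolding dil_dominated[OF e] by blast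
    qed
    have gM: "g \<in> M"
    proof -
      obtain n where "f n - g \<in> dil 1 (dominated G v)" using diff[of 1] by auto
      then have "f n - g \<in> M" unfolding M_def by (simp add: complex_vs.span_base)
      then have "f n - (f n - g) \<in> M"
        unfolding M_def by (rule complex_vs.span_diff[OF fM[of n, unfolded M_def]])
      then show ?thesis by simp
    qed
    have "limitin mtopology f g sequentially"
      unfolding limitin_metric
    proof (intro conjI gM allI impI)
      fix e :: real assume e: "e > 0"
      obtain N where N: "\<forall>n\<ge>N. f n - g \<in> dil (e / 2) (dominated G v)" using diff[of "e / 2"] e by auto
      have "norm_dist M d (f n) g < e" if "n \<ge> N" for n
      proof -
        have "d (f n - g) \<le> e / 2" unfolding d_def using N that e by (intro minkowski_le) auto
        then show ?thesis using e gM fM by (simp add: norm_dist_def)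
      qed
      then show "\<forall>\<^sub>F n in sequentially. f n \<in> M \<and> norm_dist M d (f n) g < e"
        using fM unfolding eventually_sequentially by blast
    qed
    then show "\<exists>x. limitin mtopology f x sequentially" by blast
  qed
qed


section \<open>Weighted spaces and their limits\<close>

lemma mem_Ha_iff:
  assumes w: "weight G w"
  shows "f \<in> Ha G w \<longleftrightarrow> (\<exists>r>0. f \<in> dil r (dominated G (\<lambda>z. 1 / w z)))"
proof
  assume f: "f \<in> Ha G w"
  then obtain C where C: "\<And>z. z \<in> G \<Longrightarrow> w z * cmod (f z) \<le> C" unfolding Ha_def bdd_above_def by auto
  have "f \<in> dominated G (\<lambda>z. (\<bar>C\<bar> + 1) * (1 / w z))"
    unfolding dominated_def
  proof (intro CollectI conjI ballI)
    fix z assume z: "z \<in> G"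
    then have "w z > 0" using w by (simp add: weight_def)
    moreover have "w z * cmod (f z) \<le> \<bar>C\<bar> + 1" using C[OF z] by linarith
    ultimately show "cmod (f z) \<le> (\<bar>C\<bar> + 1) * (1 / w z)" by (simp add: field_simps)
  qed (use f in \<open>simp add: Ha_def\<close>)
  then have "f \<in> dil (\<bar>C\<bar> + 1) (dominated G (\<lambda>z. 1 / w z))" by (subst dil_dominated) auto
  then show "\<exists>r>0. f \<in> dil r (dominated G (\<lambda>z. 1 / w z))" by (intro exI[of _ "\<bar>C\<bar> + 1"]) auto
next
  assume "\<exists>r>0. f \<in> dil r (dominated G (\<lambda>z. 1 / w z))"
  then obtain r where "r > 0" "f \<in> dil r (dominated G (\<lambda>z. 1 / w z))" by blast
  then have r: "r > 0" "f \<in> dominated G (\<lambda>z. r * (1 / w z))" by (simp_all only: dil_dominated)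
  have "w z * cmod (f z) \<le> r" if z: "z \<in> G" for z
  proof -
    have "w z > 0" using w z by (simp add: weight_def)
    moreover have "cmod (f z) \<le> r * (1 / w z)" using r z unfolding dominated_def by blast
    ultimately show ?thesis by (simp add: field_simps)
  qed
  then show "f \<in> Ha G w" unfolding Ha_def using r unfolding dominated_def by (auto intro!: bdd_aboveI)
qed

lemma Ha_eq_span:
  assumes w: "weight G w"
  shows "Ha G w = complex_vs.span (dominated G (\<lambda>z. 1 / w z))"
proof -
  have "absolutely_convex (dominated G (\<lambda>z. 1 / w z))"
    using w by (intro absolutely_convex_dominated) (auto simp: weight_def less_imp_le)
  from span_absolutely_convex[OF this] show ?thesis
    by (intro set_eqI) (simp only: mem_Ha_iff[OF w] UN_iff greaterThan_iff, blast)
qed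

text \<open>The disc is the closed unit ball of the weighted supremum norm. The identity lets the
  weighted Banach spaces be treated as special cases of discs given by pointwise bounds.\<close>

lemma Ha_norm_eq_minkowski:
  assumes w: "weight G w" and ne: "G \<noteq> {}" and f: "f \<in> Ha G w"
  shows "Ha_norm G w f = minkowski (dominated G (\<lambda>z. 1 / w z)) f"
proof (rule antisym)
  let ?B = "dominated G (\<lambda>z. 1 / w z)"
  have wpos: "w z > 0" if "z \<in> G" for z using w that by (simp add: weight_def)
  have upper: "w z * cmod (f z) \<le> Ha_norm G w f" if "z \<in> G" for z
    unfolding Ha_norm_def using f that by (intro cSUP_upper) (auto simp: Ha_def)
  obtain z0 where z0: "z0 \<in> G" using ne by blast
  have nonneg: "Ha_norm G w f \<ge> 0"
    by (rule order_trans[OF _ upper[OF z0]]) (use wpos[OF z0] in simp)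
  show "Ha_norm G w f \<le> minkowski ?B f"
    unfolding minkowski_def
  proof (rule cInf_greatest)
    show "{r. r > 0 \<and> f \<in> dil r ?B} \<noteq> {}" using f unfolding mem_Ha_iff[OF w] by blast
    fix r assume "r \<in> {r. r > 0 \<and> f \<in> dil r ?B}"
    then have "r > 0" "f \<in> dil r ?B" by simp_all
    then have r: "r > 0" "f \<in> dominated G (\<lambda>z. r * (1 / w z))" by (simp_all only: dil_dominated)
    show "Ha_norm G w f \<le> r"
      unfolding Ha_norm_def
    proof (rule cSUP_least[OF ne])
      fix z assume z: "z \<in> G"
      then have "cmod (f z) \<le> r * (1 / w z)" using r unfolding dominated_def by blast
      then show "w z * cmod (f z) \<le> r" using wpos[OF z] by (simp add: field_simps)
    qed
  qed
  show "minkowski ?B f \<le> Ha_norm G w f"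
  proof (rule field_le_epsilon)
    fix e :: real assume e: "e > 0"
    have "f \<in> dominated G (\<lambda>z. (Ha_norm G w f + e) * (1 / w z))"
      unfolding dominated_def
    proof (intro CollectI conjI ballI)
      fix z assume z: "z \<in> G"
      have "w z * cmod (f z) \<le> Ha_norm G w f + e" using upper[OF z] e by linarith
      then show "cmod (f z) \<le> (Ha_norm G w f + e) * (1 / w z)" using wpos[OF z] by (simp add: field_simps)
    qed (use f in \<open>simp add: Ha_def\<close>)
    then have "f \<in> dil (Ha_norm G w f + e) ?B" using nonneg e by (subst dil_dominated) auto
    then show "minkowski ?B f \<le> Ha_norm G w f + e" using nonneg e by (intro minkowski_le) auto
  qed
qed

lemma norm_dist_Ha:
  assumes w: "weight G w" and ne: "G \<noteq> {}"
  shows "norm_dist (Ha G w) (Ha_norm G w)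
    = norm_dist (Ha G w) (minkowski (dominated G (\<lambda>z. 1 / w z)))"
proof (intro ext)
  fix f g
  have "f - g \<in> Ha G w" if "f \<in> Ha G w" "g \<in> Ha G w"
    using that unfolding Ha_eq_span[OF w] by (rule complex_vs.span_diff)
  then show "norm_dist (Ha G w) (Ha_norm G w) f g
    = norm_dist (Ha G w) (minkowski (dominated G (\<lambda>z. 1 / w z))) f g"
    unfolding norm_dist_def using Ha_norm_eq_minkowski[OF w ne] by auto
qed

lemma absorbing_disc_Ha:
  assumes w: "weight G w"
  shows "absorbing_disc (Ha G w) (dominated G (\<lambda>z. 1 / w z))"
  unfolding Ha_eq_span[OF w]
  using w by (intro absorbing_disc_span absolutely_convex_dominated) (auto simp: weight_def less_imp_le)

lemma Ha_topology_eq_gauge: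
  assumes w: "weight G w" and ne: "G \<noteq> {}"
  shows "Ha_topology G w = gauge_topology (Ha G w) (dominated G (\<lambda>z. 1 / w z))"
proof -
  have D: "absolutely_convex (dominated G (\<lambda>z. 1 / w z))"
    using w by (intro absolutely_convex_dominated) (auto simp: weight_def less_imp_le)
  show ?thesis
    unfolding Ha_topology_def norm_dist_Ha[OF w ne] unfolding Ha_eq_span[OF w]
    by (rule mtopology_minkowski[OF D Metric_space_minkowski[OF D dominated_separated]])
qed

lemma completely_metrizable_Ha:
  assumes G: "open G" and w: "weight G w" and ne: "G \<noteq> {}"
  shows "completely_metrizable_space (Ha_topology G w)"
proof -
  have "continuous_on G (\<lambda>z. 1 / w z)" using w by (force simp: weight_def intro!: continuous_intros)
  then have "Metric_space (Ha G w) (norm_dist (Ha G w) (Ha_norm G w))"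
    "Metric_space.mcomplete (Ha G w) (norm_dist (Ha G w) (Ha_norm G w))"
    unfolding norm_dist_Ha[OF w ne] unfolding Ha_eq_span[OF w]
    using w by (auto intro!: mcomplete_dominated[OF G] simp: weight_def less_imp_le)
  then show ?thesis unfolding Ha_topology_def completely_metrizable_space_def by blast
qed

section \<open>Steps of the weighted spectrum and their unit balls\<close>

locale weighted_spectrum =
  fixes G :: "(complex^'d) set" and a :: "nat \<Rightarrow> nat \<Rightarrow> complex^'d \<Rightarrow> real"
  assumes open_G: "open G" and nonempty: "G \<noteq> {}" and ws: "weight_system G a"
begin

text \<open>The closed unit ball of \<open>Ha G (a N n)\<close>. It grows with \<open>n\<close> and
  shrinks as \<open>N\<close> grows.\<close>

definition B :: "nat \<Rightarrow> nat \<Rightarrow> (complex^'d \<Rightarrow> complex) set" where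
  "B N n = dominated G (\<lambda>z. 1 / a N n z)"

abbreviation X :: "nat \<Rightarrow> (complex^'d \<Rightarrow> complex) set" where
  "X \<equiv> ANH_space G a"

definition XX :: "(complex^'d \<Rightarrow> complex) set" where
  "XX = (\<Inter>N. X N)"

lemma weight: "weight G (a N n)"
  using ws by (simp add: weight_system_def)

lemma pos: "z \<in> G \<Longrightarrow> a N n z > 0"
  using weight by (simp add: weight_def)

lemma a_antimono: "n \<le> m \<Longrightarrow> z \<in> G \<Longrightarrow> a N m z \<le> a N n z"
proof (induction m rule: dec_induct)
  case (step m)
  then show ?case using ws unfolding weight_system_def by (meson order_trans)
qed simp

lemma a_mono: "N \<le> M \<Longrightarrow> z \<in> G \<Longrightarrow> a N n z \<le> a M n z"
proof (induction M rule: dec_induct)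
  case (step M)
  then show ?case using ws unfolding weight_system_def by (meson order_trans)
qed simp

lemma B_mono:
  assumes "N \<le> M" "m \<le> n"
  shows "B M m \<subseteq> B N n"
  unfolding B_def
proof (rule dominated_mono)
  fix z assume z: "z \<in> G"
  have "a N n z \<le> a M m z" using a_antimono[OF assms(2) z, of N] a_mono[OF assms(1) z, of m] by linarith
  then show "1 / a M m z \<le> 1 / a N n z" using pos[OF z] by (simp add: frac_le)
qed

lemma absolutely_convex_B: "absolutely_convex (B N n)"
  unfolding B_def using pos by (intro absolutely_convex_dominated) (simp add: less_imp_le)

lemma mem_X_iff: "f \<in> X N \<longleftrightarrow> (\<exists>n. \<exists>r>0. f \<in> dil r (B N n))"
  unfolding ANH_space_def B_def using mem_Ha_iff[OF weight] by (simp only: UN_iff UNIV_I bex_simps simp_thms)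

lemma dil_B_mono: "N \<le> M \<Longrightarrow> m \<le> n \<Longrightarrow> 0 \<le> r \<Longrightarrow> r \<le> s \<Longrightarrow> dil r (B M m) \<subseteq> dil s (B N n)"
  using dil_mono[OF absolutely_convex_B, of r s N n] B_mono[of N M m n] image_mono by blast

lemma X_antimono: "N \<le> M \<Longrightarrow> X M \<subseteq> X N"
proof
  fix f assume N: "N \<le> M" and "f \<in> X M"
  then obtain n r where "r > 0" "f \<in> dil r (B M n)" unfolding mem_X_iff by blast
  then have "r > 0" "f \<in> dil r (B N n)" using dil_B_mono[OF N, of n n r r] by auto
  then show "f \<in> X N" unfolding mem_X_iff by blast
qed

lemma subspace_Ha: "complex_vs.subspace (Ha G (a N n))"
  using absorbing_disc.subspace[OF absorbing_disc_Ha[OF weight]] .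

lemma Ha_mono: "n \<le> m \<Longrightarrow> Ha G (a N n) \<subseteq> Ha G (a N m)"
  unfolding Ha_eq_span[OF weight] B_def[symmetric] by (intro complex_vs.span_mono B_mono) auto

lemma subspace_X: "complex_vs.subspace (X N)"
proof (rule complex_vs.subspaceI)
  show "0 \<in> X N" unfolding ANH_space_def using complex_vs.subspace_0[OF subspace_Ha] by blast
  fix f g assume "f \<in> X N" "g \<in> X N"
  then obtain n m where "f \<in> Ha G (a N n)" "g \<in> Ha G (a N m)" unfolding ANH_space_def by blast
  then have "f \<in> Ha G (a N (max n m))" "g \<in> Ha G (a N (max n m))"
    using Ha_mono[of n "max n m" N] Ha_mono[of m "max n m" N] by auto
  then show "f + g \<in> X N" unfolding ANH_space_def using complex_vs.subspace_add[OF subspace_Ha] by blast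
next
  fix c f assume "f \<in> X N"
  then show "c *\<^sub>C f \<in> X N" unfolding ANH_space_def using complex_vs.subspace_scale[OF subspace_Ha] by blast
qed

lemma X_subset_hol: "X N \<subseteq> hol G"
  unfolding ANH_space_def Ha_def by blast

lemma subspace_XX: "complex_vs.subspace XX"
  unfolding XX_def by (intro complex_vs.subspace_Inter) (auto simp: subspace_X)

lemma Ha_topology_eq: "Ha_topology G (a N n) = gauge_topology (Ha G (a N n)) (B N n)"
  unfolding B_def by (rule Ha_topology_eq_gauge[OF weight nonempty])

lemma absorbing_disc_Ha_B: "absorbing_disc (Ha G (a N n)) (B N n)"
  unfolding B_def by (rule absorbing_disc_Ha[OF weight])

lemma topspace_Ha_topology [simp]: "topspace (Ha_topology G (a N n)) = Ha G (a N n)"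
  unfolding Ha_topology_eq by (rule absorbing_disc.topspace_gauge_topology[OF absorbing_disc_Ha_B])

text \<open>The topologies that compete in the definition of the inductive limit; the topology of
  \<open>ANH G a N\<close> is their supremum.\<close>

definition lc_topologies :: "nat \<Rightarrow> (complex^'d \<Rightarrow> complex) topology set" where
  "lc_topologies N = {T. lcs T \<and> topspace T = X N \<and> (\<forall>n. continuous_map (Ha_topology G (a N n)) T (\<lambda>x. x))}"

lemma ANH_eq: "ANH G a N = topology_generated_by {X N \<inter> U | U. \<exists>T\<in>lc_topologies N. openin T U}"
proof -
  have "{U. \<exists>T. lcs T \<and> topspace T = (\<Union>n. topspace (Ha_topology G (a N n))) \<and>
             (\<forall>n. continuous_map (Ha_topology G (a N n)) T (\<lambda>x. x)) \<and> openin T U}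
    = {X N \<inter> U | U. \<exists>T\<in>lc_topologies N. openin T U}" (is "?L = ?R")
  proof (intro equalityI subsetI)
    fix U assume "U \<in> ?L"
    then obtain T where T: "T \<in> lc_topologies N" "openin T U"
      unfolding lc_topologies_def ANH_space_def by auto
    then have "U = X N \<inter> U" using openin_subset[OF T(2)] unfolding lc_topologies_def by auto
    then show "U \<in> ?R" using T by blast
  next
    fix U assume "U \<in> ?R"
    then obtain U' T where T: "T \<in> lc_topologies N" "openin T U'" "U = X N \<inter> U'" by blast
    then have "U = U'" using openin_subset[OF T(2)] unfolding lc_topologies_def by auto
    then show "U \<in> ?L" using T unfolding lc_topologies_def ANH_space_def by auto
  qed
  then show ?thesis unfolding ANH_def ind_lim_def by simp
qed

text \<open>That \<open>V\<close> absorbs the unit ball of a generating Banach space is what makes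
  its inclusion into the gauge topology of \<open>V\<close> continuous. Absorbing all of these balls
  also makes \<open>V\<close> absorbing in the step.\<close>

lemma gauge_in_lc_topologies:
  assumes V: "absolutely_convex V" "V \<subseteq> X N" and abs: "\<And>n. absorbs V (B N n)"
  shows "absorbing_disc (X N) V" and "gauge_topology (X N) V \<in> lc_topologies N"
proof -
  show ad: "absorbing_disc (X N) V"
  proof
    fix f assume "f \<in> X N"
    then obtain n r where r: "r > 0" "f \<in> dil r (B N n)" unfolding mem_X_iff by blast
    obtain s where s: "s > 0" "B N n \<subseteq> dil s V" using abs unfolding absorbs_def by blast
    have "dil r (B N n) \<subseteq> dil r (dil s V)" using s by (intro image_mono)
    then have "f \<in> dil (r * s) V" using r unfolding dil_dil by blast
    then show "\<exists>r>0. f \<in> dil r V" using r s by (intro exI[of _ "r * s"]) auto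
  qed (use V subspace_X in auto)
  have "Ha G (a N n) \<subseteq> X N" for n unfolding ANH_space_def by blast
  then show "gauge_topology (X N) V \<in> lc_topologies N"
    unfolding lc_topologies_def Ha_topology_eq
    using absorbing_disc.lcs_gauge_topology[OF ad] absorbing_disc.topspace_gauge_topology[OF ad]
      gauge_topology_inclusion[OF absorbing_disc_Ha_B ad _ abs] by blast
qed

lemma lc_topologies_nonempty: "lc_topologies N \<noteq> {}"
proof -
  have "B N n \<subseteq> X N" for n
  proof
    fix f assume "f \<in> B N n"
    then have "f \<in> dil 1 (B N n)" by simp
    then show "f \<in> X N" unfolding mem_X_iff using zero_less_one by blast
  qed
  \<comment> \<open>The whole step, taken as a disc, gives the indiscrete topology; so the supremum
    is over a non-empty family.\<close>
  then have "absorbs (X N) (B N n)" for n using absorbsI[of 1 "B N n" "X N"] by (auto simp del: dil_one)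
  then show ?thesis
    using gauge_in_lc_topologies(2)[of "X N" N] absolutely_convex_subspace[OF subspace_X] by blast
qed

lemma lcs_ANH: "lcs (ANH G a N)" and topspace_ANH [simp]: "topspace (ANH G a N) = X N"
  unfolding ANH_eq
  using lcs_generated[OF subspace_X lc_topologies_nonempty, of N] unfolding lc_topologies_def by auto

lemma openin_ANH: "T \<in> lc_topologies N \<Longrightarrow> openin T U \<Longrightarrow> openin (ANH G a N) U"
proof -
  assume T: "T \<in> lc_topologies N" "openin T U"
  then have "U = X N \<inter> U" using openin_subset[OF T(2)] unfolding lc_topologies_def by auto
  then have "U \<in> {X N \<inter> U | U. \<exists>T\<in>lc_topologies N. openin T U}" using T by blast
  then show ?thesis unfolding ANH_eq by (rule topology_generated_by_Basis)
qed

lemma Ha_inclusion: "continuous_map (Ha_topology G (a N n)) (ANH G a N) (\<lambda>x. x)"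
  unfolding ANH_eq
proof (rule continuous_on_generated_topo)
  have sub: "Ha G (a N n) \<subseteq> X N" unfolding ANH_space_def by blast
  have "\<Union>{X N \<inter> U |U. \<exists>T\<in>lc_topologies N. openin T U} = X N"
    using topspace_ANH[of N] unfolding ANH_eq topology_generated_by_topspace .
  then show "(\<lambda>x. x) ` topspace (Ha_topology G (a N n)) \<subseteq> \<Union>{X N \<inter> U |U. \<exists>T\<in>lc_topologies N. openin T U}"
    using sub by simp
  fix U assume "U \<in> {X N \<inter> U |U. \<exists>T\<in>lc_topologies N. openin T U}"
  then obtain U' T where T: "T \<in> lc_topologies N" "openin T U'" "U = X N \<inter> U'" by blast
  have eq: "(\<lambda>x. x) -` U \<inter> topspace (Ha_topology G (a N n)) = {x \<in> topspace (Ha_topology G (a N n)). x \<in> U'}"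
    using T(3) sub by auto
  show "openin (Ha_topology G (a N n)) ((\<lambda>x. x) -` U \<inter> topspace (Ha_topology G (a N n)))"
    unfolding eq using T openin_continuous_map_preimage unfolding lc_topologies_def by blast
qed

lemma openin_ANH_absorbs:
  assumes W: "openin (ANH G a N) W" "0 \<in> W"
  shows "\<exists>r>0. dil r (B N n) \<subseteq> W"
proof -
  have "openin (Ha_topology G (a N n)) {x \<in> Ha G (a N n). x \<in> W}"
    using openin_continuous_map_preimage[OF Ha_inclusion W(1), of n] by simp
  then obtain r where "r > 0" "\<forall>v\<in>dil r (B N n). 0 + v \<in> {x \<in> Ha G (a N n). x \<in> W}"
    unfolding Ha_topology_eq absorbing_disc.openin_gauge_topology[OF absorbing_disc_Ha_B]
    using W(2) complex_vs.subspace_0[OF subspace_Ha, of N n] by (metis (no_types, lifting) mem_Collect_eq)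
  then show ?thesis by (intro exI[of _ r]) auto
qed

text \<open>Together with \<open>openin_ANH_absorbs\<close> this describes the inductive limit: an
  absolutely convex subset of the step is a zero neighbourhood exactly when it absorbs the unit ball
  of each generating space. The gauge topology of \<open>V\<close> is the witness in the
  supremum.\<close>

lemma zero_nhd_ANH:
  assumes "absolutely_convex V" "V \<subseteq> X N" "\<And>n. absorbs V (B N n)"
  shows "zero_nhd (ANH G a N) V"
proof -
  note g = gauge_in_lc_topologies[OF assms]
  obtain W where "openin (gauge_topology (X N) V) W" "0 \<in> W" "W \<subseteq> V"
    using absorbing_disc.zero_nhd_gauge_topology[OF g(1)] unfolding zero_nhd_def by blast
  then show ?thesis unfolding zero_nhd_def using openin_ANH[OF g(2)] assms(2) by auto
qed

section \<open>Topology of the projective limit\<close>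

lemma AH_eq: "AH G a = topology_generated_by {XX \<inter> U | U. \<exists>T\<in>range (ANH G a). openin T U}"
proof -
  have "{(\<Inter>N. topspace (ANH G a N)) \<inter> U |N U. openin (ANH G a N) U}
    = {XX \<inter> U | U. \<exists>T\<in>range (ANH G a). openin T U}"
    unfolding topspace_ANH XX_def by blast
  then show ?thesis unfolding AH_def proj_lim_def by simp
qed

lemma lcs_AH: "lcs (AH G a)" and topspace_AH [simp]: "topspace (AH G a) = XX"
proof -
  have "lcs T" "XX \<subseteq> topspace T" if "T \<in> range (ANH G a)" for T
    using that lcs_ANH by (auto simp: XX_def)
  then show "lcs (AH G a)" "topspace (AH G a) = XX"
    unfolding AH_eq using lcs_generated[OF subspace_XX, of "range (ANH G a)"] by auto
qed

lemma openin_AH: "openin (ANH G a N) U \<Longrightarrow> openin (AH G a) (XX \<inter> U)"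
  unfolding AH_eq by (rule topology_generated_by_Basis) blast

lemma zero_nhd_AH:
  assumes "zero_nhd (ANH G a N) V" "XX \<inter> V \<subseteq> U" "U \<subseteq> XX"
  shows "zero_nhd (AH G a) U"
proof -
  obtain W where W: "openin (ANH G a N) W" "0 \<in> W" "W \<subseteq> V" using assms(1) unfolding zero_nhd_def by blast
  then show ?thesis unfolding zero_nhd_def
    using openin_AH[OF W(1)] assms complex_vs.subspace_0[OF subspace_XX] by (intro conjI exI[of _ "XX \<inter> W"]) auto
qed

text \<open>A neighbourhood in the projective limit comes from finitely many steps. The claim is
  made for all \<open>M\<close> beyond some \<open>M0\<close>, which is possible because balls
  shrink as \<open>M\<close> grows: intersections then have a common index, and later arguments may
  enlarge \<open>M\<close>.\<close>

lemma zero_nhd_AH_imp: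
  assumes "zero_nhd (AH G a) U"
  shows "\<exists>M0. \<forall>M\<ge>M0. \<forall>m. \<exists>r>0. dil r (B M m) \<inter> XX \<subseteq> U"
proof -
  let ?S = "{XX \<inter> U | U. \<exists>T\<in>range (ANH G a). openin T U}"
  obtain W where W: "openin (AH G a) W" "0 \<in> W" "W \<subseteq> U" using assms unfolding zero_nhd_def by blast
  then have "generate_topology_on ?S W" unfolding AH_eq by (simp only: openin_topology_generated_by_iff)
  then have "0 \<in> W \<Longrightarrow> \<exists>M0. \<forall>M\<ge>M0. \<forall>m. \<exists>r>0. dil r (B M m) \<inter> XX \<subseteq> W"
  proof induction
    case Empty
    then show ?case by simp
  next
    case (Int a b)
    then obtain M1 M2 where M1: "\<forall>M\<ge>M1. \<forall>m. \<exists>r>0. dil r (B M m) \<inter> XX \<subseteq> a"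
      and M2: "\<forall>M\<ge>M2. \<forall>m. \<exists>r>0. dil r (B M m) \<inter> XX \<subseteq> b" by blast
    have "\<exists>r>0. dil r (B M m) \<inter> XX \<subseteq> a \<inter> b" if "M \<ge> max M1 M2" for M m
    proof -
      have "M \<ge> M1" "M \<ge> M2" using that by auto
      then obtain r s where r: "r > 0" "dil r (B M m) \<inter> XX \<subseteq> a" and s: "s > 0" "dil s (B M m) \<inter> XX \<subseteq> b"
        using M1 M2 by meson
      have "dil (min r s) (B M m) \<subseteq> dil r (B M m)" "dil (min r s) (B M m) \<subseteq> dil s (B M m)"
        using r s by (intro dil_mono[OF absolutely_convex_B]; simp)+
      then have "dil (min r s) (B M m) \<inter> XX \<subseteq> a \<inter> b" using r(2) s(2) by blast
      then show ?thesis using r(1) s(1) by (intro exI[of _ "min r s"]) auto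
    qed
    then show ?case by blast
  next
    case (UN K)
    then obtain k where "k \<in> K" "0 \<in> k" by blast
    then have "\<exists>M0. \<forall>M\<ge>M0. \<forall>m. \<exists>r>0. dil r (B M m) \<inter> XX \<subseteq> k" using UN.IH by blast
    then show ?case using \<open>k \<in> K\<close> by (meson Union_upper order_trans)
  next
    case (Basis s)
    then obtain V N where V: "s = XX \<inter> V" "openin (ANH G a N) V" by blast
    have "\<exists>r>0. dil r (B M m) \<inter> XX \<subseteq> s" if M: "M \<ge> N" for M m
    proof -
      obtain r where r: "r > 0" "dil r (B N m) \<subseteq> V" using openin_ANH_absorbs[OF V(2)] Basis V by blast
      have "dil r (B M m) \<subseteq> dil r (B N m)" using M r by (intro dil_B_mono) auto
      then show ?thesis using r V by blast
    qed
    then show ?case by blast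
  qed
  then show ?thesis using W by (meson order_trans)
qed

lemma lc_bounded_AH:
  assumes D: "D \<subseteq> XX" and bd: "\<And>N. \<exists>n. \<exists>r>0. D \<subseteq> dil r (B N n)"
  shows "lc_bounded (AH G a) D"
  unfolding lc_bounded_def
proof (intro conjI allI impI)
  show "D \<subseteq> topspace (AH G a)" using D by simp
  fix U assume "zero_nhd (AH G a) U"
  then obtain M where M: "\<And>m. \<exists>r>0. dil r (B M m) \<inter> XX \<subseteq> U" using zero_nhd_AH_imp by blast
  obtain n r where r: "r > 0" "D \<subseteq> dil r (B M n)" using bd by blast
  obtain s where s: "s > 0" "dil s (B M n) \<inter> XX \<subseteq> U" using M by blast
  show "absorbs U D"
  proof (rule absorbsI)
    show "r / s > 0" using r s by simp
    fix f assume f: "f \<in> D"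
    have "f \<in> dil (r / s * s) (B M n)" using f r s by auto
    then have "f \<in> dil (r / s) (dil s (B M n))" by (simp only: dil_dil)
    then obtain g where g: "g \<in> dil s (B M n)" "f = complex_of_real (r / s) *\<^sub>C g" by (rule imageE)
    have "complex_of_real (s / r) *\<^sub>C f \<in> XX" using D f complex_vs.subspace_scale[OF subspace_XX] by blast
    also have "complex_of_real (s / r) *\<^sub>C f = g" unfolding g(2) scaleC_scaleC using r s by simp
    finally have "g \<in> U" using g(1) s(2) by blast
    then show "f \<in> dil (r / s) U" using g(2) by blast
  qed
qed

end


section \<open>Barrelledness and the weight condition\<close>

text \<open>The associated weight at \<open>z\<close> is the norm of the evaluation at
  \<open>z\<close> measured on the disc below \<open>w\<close>; this reading underlies the use of
  point evaluations.\<close>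

lemma tilde_eq: "tilde G w z = (SUP g\<in>dominated G w. cmod (g z))"
  unfolding tilde_def dominated_def by (rule arg_cong[where f = Sup]) auto

lemma le_tilde: "g \<in> dominated G w \<Longrightarrow> z \<in> G \<Longrightarrow> cmod (g z) \<le> tilde G w z"
  unfolding tilde_eq by (rule cSUP_upper) (auto simp: dominated_def intro!: bdd_aboveI[of _ "w z"])

lemma tilde_le: "dominated G w \<noteq> {} \<Longrightarrow> (\<And>g. g \<in> dominated G w \<Longrightarrow> cmod (g z) \<le> C) \<Longrightarrow> tilde G w z \<le> C"
  unfolding tilde_eq by (rule cSUP_least)

text \<open>Merges finitely many exceptional constants into one. \<open>P\<close> is abstract
  because it is used once for a single inequality and once for a whole family of them.\<close>

lemma uniform_constant:
  fixes P :: "nat \<Rightarrow> real \<Rightarrow> bool"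
  assumes ex: "\<And>i. i < n \<Longrightarrow> \<exists>C>0. P i C" and mono: "\<And>i C D. P i C \<Longrightarrow> C \<le> D \<Longrightarrow> P i D"
  obtains C where "C > 0" "\<And>i. i < n \<Longrightarrow> P i C"
  using ex
proof (induction n arbitrary: thesis)
  case 0
  then show ?case using zero_less_one by blast
next
  case (Suc n)
  obtain C where C: "C > 0" "\<And>i. i < n \<Longrightarrow> P i C" using Suc.IH Suc.prems(2) by (metis less_SucI)
  obtain D where D: "D > 0" "P n D" using Suc.prems(2) by blast
  show ?case
  proof (rule Suc.prems(1))
    show "max C D > 0" using C by simp
    show "P i (max C D)" if "i < Suc n" for i
      using C(2)[of i] D(2) mono[of i _ "max C D"] that by (cases "i = n") auto
  qed
qed

context weighted_spectrum
begin

lemma Ha0_subset_Ha: "Ha0 G (a N n) \<subseteq> Ha G (a N n)"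
proof
  fix f assume f: "f \<in> Ha0 G (a N n)"
  then have hol: "f \<in> hol G" by (simp add: Ha0_def)
  have "\<forall>e>0. \<exists>K. compact K \<and> K \<subseteq> G \<and> (\<forall>z\<in>G - K. \<bar>a N n z * cmod (f z)\<bar> < e)"
    using f unfolding Ha0_def vanishes_at_infinity_def by simp
  from this[rule_format, OF zero_less_one]
  obtain K where K: "compact K" "K \<subseteq> G" "\<And>z. z \<in> G - K \<Longrightarrow> \<bar>a N n z * cmod (f z)\<bar> < 1" by meson
  have "continuous_on K (\<lambda>z. a N n z * cmod (f z))"
    using weight[of N n] continuous_on_hol[OF hol] K(2)
    by (intro continuous_intros) (auto simp: weight_def intro: continuous_on_subset)
  then have "bounded ((\<lambda>z. a N n z * cmod (f z)) ` K)"
    using K(1) compact_continuous_image compact_imp_bounded by blast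
  then obtain C where C: "\<And>z. z \<in> K \<Longrightarrow> \<bar>a N n z * cmod (f z)\<bar> \<le> C" unfolding bounded_real by auto
  have "a N n z * cmod (f z) \<le> max C 1" if "z \<in> G" for z
    using C[of z] K(3)[of z] that by (cases "z \<in> K") force+
  then show "f \<in> Ha G (a N n)" unfolding Ha_def using hol by (auto intro!: bdd_aboveI)
qed

text \<open>The evaluation at \<open>z\<close> is bounded on every unit ball of the step 0, hence
  continuous there and on the projective limit. Continuity is expressed by the gauge topology of the
  polar \<open>?V\<close> of the evaluation, in which the set of large values is open.\<close>

lemma closedin_evaluation:
  assumes z: "z \<in> G"
  shows "closedin (AH G a) {f \<in> XX. cmod (f z) \<le> c}"
proof -
  let ?V = "{f \<in> X 0. cmod (f z) \<le> 1}"
  have V: "absolutely_convex ?V"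
    unfolding absolutely_convex_def
  proof (intro conjI ballI allI impI)
    have "0 \<in> ?V" using complex_vs.subspace_0[OF subspace_X] by simp
    then show "?V \<noteq> {}" by blast
    fix f g b c assume f: "f \<in> ?V" and g: "g \<in> ?V" and bc: "cmod b + cmod c \<le> 1"
    have "cmod ((b *\<^sub>C f + c *\<^sub>C g) z) \<le> cmod b * cmod (f z) + cmod c * cmod (g z)"
      using norm_triangle_ineq[of "b * f z" "c * g z"] by (simp add: complex_scaleC_apply norm_mult)
    also have "\<dots> \<le> cmod b * 1 + cmod c * 1"
      using f g by (intro add_mono mult_left_mono) auto
    finally show "b *\<^sub>C f + c *\<^sub>C g \<in> ?V"
      using f g bc complex_vs.subspace_add[OF subspace_X] complex_vs.subspace_scale[OF subspace_X] by simp
  qed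
  have abs: "absorbs ?V (B 0 n)" for n
  proof (rule absorbsI)
    show k: "1 / a 0 n z > 0" using pos[OF z] by simp
    fix f assume f: "f \<in> B 0 n"
    then have "f \<in> X 0" unfolding mem_X_iff using zero_less_one by (metis dil_one)
    moreover have "cmod (f z) \<le> 1 / a 0 n z" using f z by (simp add: B_def dominated_def)
    ultimately show "f \<in> dil (1 / a 0 n z) ?V"
      unfolding mem_dil_iff[OF k] using complex_vs.subspace_scale[OF subspace_X] pos[OF z]
      by (simp add: complex_scaleC_apply norm_mult pos_le_divide_eq abs_of_pos mult.commute)
  qed
  note g = gauge_in_lc_topologies[OF V _ abs]
  have "openin (gauge_topology (X 0) ?V) {f \<in> X 0. c < cmod (f z)}"
    unfolding absorbing_disc.openin_gauge_topology[OF g(1)[OF Collect_restrict]]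
  proof (intro conjI ballI)
    fix f assume f: "f \<in> {f \<in> X 0. c < cmod (f z)}"
    show "\<exists>r>0. \<forall>v\<in>dil r ?V. f + v \<in> {f \<in> X 0. c < cmod (f z)}"
    proof (intro exI[of _ "(cmod (f z) - c) / 2"] conjI ballI)
      show r: "(cmod (f z) - c) / 2 > 0" using f by simp
      fix v assume "v \<in> dil ((cmod (f z) - c) / 2) ?V"
      then obtain v' where v': "v' \<in> ?V" "v = complex_of_real ((cmod (f z) - c) / 2) *\<^sub>C v'" by blast
      have "cmod (v z) = (cmod (f z) - c) / 2 * cmod (v' z)"
        unfolding v'(2) complex_scaleC_apply norm_mult norm_of_real using r by simp
      also have "\<dots> \<le> (cmod (f z) - c) / 2" using v'(1) r by (intro mult_left_le) auto
      finally have "cmod (v z) < cmod (f z) - c" using f by simp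
      then have "c < cmod (f z + v z)" using norm_triangle_ineq2[of "f z" "- v z"] by simp
      moreover have "f + v \<in> X 0"
        using f v' complex_vs.subspace_add[OF subspace_X] complex_vs.subspace_scale[OF subspace_X] by simp
      ultimately show "f + v \<in> {f \<in> X 0. c < cmod (f z)}" by simp
    qed
  qed blast
  from openin_AH[OF openin_ANH[OF g(2)[OF Collect_restrict] this]]
  have "openin (AH G a) (XX \<inter> {f \<in> X 0. c < cmod (f z)})" .
  moreover have "XX - {f \<in> XX. cmod (f z) \<le> c} = XX \<inter> {f \<in> X 0. c < cmod (f z)}"
    unfolding XX_def by auto
  ultimately show ?thesis unfolding closedin_def by auto
qed

text \<open>If the weight condition fails for \<open>N\<close>, choosing \<open>n = M\<close> gives evaluations \<open>\<delta>\<close> at points \<open>z M k\<close>,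
  normalised by \<open>c M k\<close>, that are pointwise bounded: membership in \<open>X N\<close> handles all large \<open>M\<close>, and for each
  of the remaining \<open>M\<close> membership in \<open>X (K M)\<close> handles all large \<open>k\<close>. Their polar is thus a
  barrel, but it contains no set \<open>dil r (B M (m M)) \<inter> XX\<close> with \<open>M \<ge> N\<close>.\<close>

lemma barrelled_imp_wQ:
  assumes bal: "balanced_setting G a" and barrelled: "barrelled (AH G a)"
  shows "wQ_in_tilde G a"
proof (rule ccontr)
  define t where "t N n z = tilde G (\<lambda>\<zeta>. 1 / a N n \<zeta>) z" for N n z
  assume "\<not> wQ_in_tilde G a"
  then obtain N where "\<And>M n. M \<ge> N \<Longrightarrow> \<exists>K\<ge>M. \<exists>m. \<forall>k. \<forall>S>0. \<exists>z\<in>G. S * max (t N n z) (t K k z) < t M m z"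
    unfolding wQ_in_tilde_def t_def[symmetric] by (meson not_le)
  then have "\<forall>M. \<exists>K m. M \<ge> N \<longrightarrow> (\<forall>k. \<forall>S>0. \<exists>z\<in>G. S * max (t N M z) (t K k z) < t M m z)" by blast
  then obtain K m where Km: "\<And>M k S. M \<ge> N \<Longrightarrow> S > 0 \<Longrightarrow> \<exists>z\<in>G. S * max (t N M z) (t (K M) k z) < t M (m M) z"
    by metis
  have "\<forall>M k. \<exists>z. M \<ge> N \<longrightarrow> z \<in> G \<and> real (Suc k) * max (t N M z) (t (K M) k z) < t M (m M) z"
    using Km[of _ "real (Suc _)"] by (metis of_nat_0_less_iff zero_less_Suc)
  then obtain z where z: "\<And>M k. M \<ge> N \<Longrightarrow> z M k \<in> G"
    "\<And>M k. M \<ge> N \<Longrightarrow> real (Suc k) * max (t N M (z M k)) (t (K M) k (z M k)) < t M (m M) (z M k)"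
    by metis
  define c where "c M k = max (t N M (z M k)) (t (K M) k (z M k))" for M k
  have poly: "(\<lambda>\<zeta>. if \<zeta> \<in> G then p \<zeta> else 0) \<in> XX" if "polynomial_fun p" for p
    using bal that Ha0_subset_Ha unfolding balanced_setting_def XX_def ANH_space_def by blast
  have eval: "cmod (f z) \<le> r * t N n z" if f: "f \<in> dil r (B N n)" and r: "r > 0" and z: "z \<in> G" for f r N n z
  proof -
    obtain g where g: "g \<in> B N n" "f = complex_of_real r *\<^sub>C g" using f by blast
    then show ?thesis using le_tilde[of g G _ z] r z
      by (simp add: complex_scaleC_apply norm_mult t_def B_def)
  qed
  \<comment> \<open>The constant polynomial 1 lies in every weighted space, so the associated
    weights do not vanish and the normalisation by \<open>c\<close> is legitimate.\<close>
  have tpos: "t N n z > 0" if "z \<in> G" for N n z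
  proof -
    have "(\<lambda>\<zeta>. if \<zeta> \<in> G then 1 else 0) \<in> X N"
      using poly[OF polynomial_fun_const[of 1]] by (auto simp: XX_def)
    then have "(\<lambda>\<zeta>. if \<zeta> \<in> G then 1 else 0) \<in> Ha G (a N n)"
      using poly bal Ha0_subset_Ha polynomial_fun_const[of 1] unfolding balanced_setting_def by blast
    then obtain r where r: "r > 0" "(\<lambda>\<zeta>. if \<zeta> \<in> G then 1 else 0) \<in> dil r (B N n)"
      unfolding mem_Ha_iff[OF weight] B_def by blast
    then have "1 \<le> r * t N n z" using eval[OF r(2,1) that] that by simp
    then show ?thesis using r by (metis mult_pos_pos not_le mult_nonneg_nonpos less_imp_le zero_less_one less_le_trans)
  qed
  have cpos: "c M k > 0" if "M \<ge> N" for M k using tpos[OF z(1)[OF that]] by (simp add: c_def less_max_iff_disj)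
  define U where "U = (\<Inter>(M, k)\<in>{N..} \<times> UNIV. {f \<in> XX. cmod (f (z M k)) \<le> c M k})"
  have U_iff: "f \<in> U \<longleftrightarrow> f \<in> XX \<and> (\<forall>M\<ge>N. \<forall>k. cmod (f (z M k)) \<le> c M k)" for f
    unfolding U_def by auto
  have pointwise: "\<exists>C>0. \<forall>M\<ge>N. \<forall>k. cmod (f (z M k)) \<le> C * c M k" if f: "f \<in> XX" for f
  proof -
    have fX: "f \<in> X M" for M using f by (simp add: XX_def)
    obtain n0 C1 where C1: "C1 > 0" "f \<in> dil C1 (B N n0)" using fX[of N] unfolding mem_X_iff by blast
    have 1: "cmod (f (z M k)) \<le> C1 * c M k" if M: "M \<ge> N" "M \<ge> n0" for M k
    proof -
      have "f \<in> dil C1 (B N M)" using dil_B_mono[of N N n0 M C1 C1] C1 M by auto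
      then have "cmod (f (z M k)) \<le> C1 * t N M (z M k)" by (rule eval[OF _ C1(1) z(1)[OF M(1)]])
      also have "\<dots> \<le> C1 * c M k" using C1 by (intro mult_left_mono) (auto simp: c_def)
      finally show ?thesis .
    qed
    have 2: "\<exists>C>0. \<forall>k. cmod (f (z M k)) \<le> C * c M k" if M: "M \<ge> N" for M
    proof -
      obtain k0 C2 where C2: "C2 > 0" "f \<in> dil C2 (B (K M) k0)" using fX[of "K M"] unfolding mem_X_iff by blast
      have large: "cmod (f (z M k)) \<le> C2 * c M k" if k: "k \<ge> k0" for k
      proof -
        have "f \<in> dil C2 (B (K M) k)" using dil_B_mono[of "K M" "K M" k0 k C2 C2] C2 k by auto
        then have "cmod (f (z M k)) \<le> C2 * t (K M) k (z M k)" by (rule eval[OF _ C2(1) z(1)[OF M]])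
        also have "\<dots> \<le> C2 * c M k" using C2 by (intro mult_left_mono) (auto simp: c_def)
        finally show ?thesis .
      qed
      obtain C3 where C3: "C3 > 0" "\<And>k. k < k0 \<Longrightarrow> cmod (f (z M k)) \<le> C3 * c M k"
      proof (rule uniform_constant[of k0 "\<lambda>k C. cmod (f (z M k)) \<le> C * c M k"])
        fix k
        have "cmod (f (z M k)) \<le> (cmod (f (z M k)) / c M k + 1) * c M k"
          using cpos[OF M, of k] by (simp add: field_simps)
        moreover have "cmod (f (z M k)) / c M k + 1 > 0" using cpos[OF M, of k] by (simp add: add_nonneg_pos)
        ultimately show "\<exists>C>0. cmod (f (z M k)) \<le> C * c M k" by blast
        fix C D :: real assume "cmod (f (z M k)) \<le> C * c M k" "C \<le> D"
        then show "cmod (f (z M k)) \<le> D * c M k"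
          using cpos[OF M, of k] by (meson less_imp_le mult_right_mono order_trans)
      qed (use that in blast)
      have "cmod (f (z M k)) \<le> max C2 C3 * c M k" for k
      proof -
        have "C2 * c M k \<le> max C2 C3 * c M k" "C3 * c M k \<le> max C2 C3 * c M k"
          using cpos[OF M, of k] by (auto intro!: mult_right_mono)
        then show ?thesis using large[of k] C3(2)[of k] by (cases "k < k0") auto
      qed
      then show ?thesis using C2 by (intro exI[of _ "max C2 C3"]) auto
    qed
    obtain C4 where C4: "C4 > 0" "\<And>M. M < n0 \<Longrightarrow> M \<ge> N \<longrightarrow> (\<forall>k. cmod (f (z M k)) \<le> C4 * c M k)"
    proof (rule uniform_constant[of n0 "\<lambda>M C. M \<ge> N \<longrightarrow> (\<forall>k. cmod (f (z M k)) \<le> C * c M k)"])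
      fix M
      show "\<exists>C>0. M \<ge> N \<longrightarrow> (\<forall>k. cmod (f (z M k)) \<le> C * c M k)"
        using 2[of M] zero_less_one by blast
      fix C D :: real assume "M \<ge> N \<longrightarrow> (\<forall>k. cmod (f (z M k)) \<le> C * c M k)" "C \<le> D"
      then show "M \<ge> N \<longrightarrow> (\<forall>k. cmod (f (z M k)) \<le> D * c M k)"
        using cpos by (meson less_imp_le mult_right_mono order_trans)
    qed (use that in blast)
    have "cmod (f (z M k)) \<le> max C1 C4 * c M k" if M: "M \<ge> N" for M k
    proof -
      have "C1 * c M k \<le> max C1 C4 * c M k" "C4 * c M k \<le> max C1 C4 * c M k"
        using cpos[OF M, of k] by (auto intro!: mult_right_mono)
      moreover have "cmod (f (z M k)) \<le> C1 * c M k \<or> cmod (f (z M k)) \<le> C4 * c M k"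
        using 1[OF M, of k] C4(2)[of M] M by (cases "M < n0") (simp_all add: not_less)
      ultimately show ?thesis by linarith
    qed
    then show ?thesis using C1 by (intro exI[of _ "max C1 C4"]) auto
  qed
  have "barrel (AH G a) U"
    unfolding barrel_def
  proof (intro conjI ballI)
    show "closedin (AH G a) U"
      unfolding U_def by (rule closedin_INT) (auto intro!: closedin_evaluation z)
    show "absolutely_convex U"
      unfolding absolutely_convex_def
    proof (intro conjI ballI allI impI)
      have "0 \<in> U" unfolding U_iff using complex_vs.subspace_0[OF subspace_XX] cpos by (simp add: less_imp_le)
      then show "U \<noteq> {}" by blast
      fix f g b d assume f: "f \<in> U" and g: "g \<in> U" and bd: "cmod b + cmod d \<le> 1"
      have "b *\<^sub>C f + d *\<^sub>C g \<in> XX"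
        using f g complex_vs.subspace_add[OF subspace_XX] complex_vs.subspace_scale[OF subspace_XX]
        unfolding U_iff by blast
      moreover have "cmod ((b *\<^sub>C f + d *\<^sub>C g) (z M k)) \<le> c M k" if M: "M \<ge> N" for M k
      proof -
        have "cmod ((b *\<^sub>C f + d *\<^sub>C g) (z M k)) \<le> cmod b * cmod (f (z M k)) + cmod d * cmod (g (z M k))"
          using norm_triangle_ineq[of "b * f (z M k)" "d * g (z M k)"] by (simp add: complex_scaleC_apply norm_mult)
        also have "\<dots> \<le> cmod b * c M k + cmod d * c M k"
          using f g M unfolding U_iff by (intro add_mono mult_left_mono) auto
        also have "\<dots> \<le> c M k" using mult_right_mono[OF bd, of "c M k"] cpos[OF M, of k] by (simp add: algebra_simps)
        finally show ?thesis .
      qed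
      ultimately show "b *\<^sub>C f + d *\<^sub>C g \<in> U" unfolding U_iff by blast
    qed
    fix f assume "f \<in> topspace (AH G a)"
    then have f: "f \<in> XX" by simp
    then obtain C where C: "C > 0" "\<forall>M\<ge>N. \<forall>k. cmod (f (z M k)) \<le> C * c M k" using pointwise by blast
    have "complex_of_real (1 / C) *\<^sub>C f \<in> U"
      unfolding U_iff
    proof (intro conjI allI impI)
      show "complex_of_real (1 / C) *\<^sub>C f \<in> XX" by (rule complex_vs.subspace_scale[OF subspace_XX f])
      fix M k assume "M \<ge> N"
      then have "cmod (f (z M k)) \<le> C * c M k" using C(2) by blast
      then show "cmod ((complex_of_real (1 / C) *\<^sub>C f) (z M k)) \<le> c M k"
        unfolding complex_scaleC_apply norm_mult using C(1) by (simp add: norm_divide divide_le_eq mult.commute)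
    qed
    then have "f \<in> dil C U" unfolding mem_dil_iff[OF C(1)] .
    then show "absorbs U {f}" using C by (intro absorbsI[of C]) auto
  qed
  then have "zero_nhd (AH G a) U" using barrelled unfolding barrelled_def by blast
  then obtain M0 where M0: "\<forall>M\<ge>M0. \<forall>m. \<exists>r>0. dil r (B M m) \<inter> XX \<subseteq> U" using zero_nhd_AH_imp by blast
  define M where "M = max N M0"
  have M: "M \<ge> N" "M \<ge> M0" by (auto simp: M_def)
  obtain r where r: "r > 0" "dil r (B M (m M)) \<inter> XX \<subseteq> U" using M0 M by blast
  have "t M (m M) (z M k) \<le> 2 / r * c M k" for k
    unfolding t_def
  proof (rule tilde_le)
    show "dominated G (\<lambda>\<zeta>. 1 / a M (m M) \<zeta>) \<noteq> {}"
      using absolutely_convex_B[of M "m M"] unfolding B_def absolutely_convex_def by blast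
    fix g assume "g \<in> dominated G (\<lambda>\<zeta>. 1 / a M (m M) \<zeta>)"
    then have g: "g \<in> hol G" "\<And>\<zeta>. \<zeta> \<in> G \<Longrightarrow> cmod (g \<zeta>) \<le> 1 / a M (m M) \<zeta>" by (auto simp: dominated_def)
    have balG: "balanced G" and rad: "\<And>\<zeta> b. \<zeta> \<in> G \<Longrightarrow> cmod b = 1 \<Longrightarrow> 1 / a M (m M) (b *s \<zeta>) = 1 / a M (m M) \<zeta>"
      using bal by (auto simp: balanced_setting_def radial_def)
    \<comment> \<open>The function \<open>g\<close> may lie outside \<open>XX\<close>, where
      \<open>U\<close> gives no information. A polynomial with nearly the same value at
      \<open>z M k\<close> does lie in \<open>XX\<close>; it is bounded by twice the reciprocal
      weight, so \<open>r / 2\<close> times it belongs to \<open>dil r (B M (m M))\<close>.\<close>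
    show "cmod (g (z M k)) \<le> 2 / r * c M k"
    proof (rule field_le_epsilon)
      fix e :: real assume e: "e > 0"
      obtain p where p: "polynomial_fun p" "\<And>\<zeta>. \<zeta> \<in> G \<Longrightarrow> cmod (p \<zeta>) \<le> 2 * (1 / a M (m M) \<zeta>)"
        "cmod (p (z M k) - g (z M k)) < e"
        using polynomial_approximation[OF open_G balG g rad z(1)[OF M(1)] e] by blast
      let ?p = "\<lambda>\<zeta>. if \<zeta> \<in> G then p \<zeta> else 0"
      have pX: "?p \<in> XX" by (rule poly[OF p(1)])
      have "?p \<in> dominated G (\<lambda>\<zeta>. 2 * (1 / a M (m M) \<zeta>))"
        using pX p(2) X_subset_hol unfolding dominated_def XX_def by fastforce
      then have "?p \<in> dil 2 (B M (m M))" unfolding B_def by (subst dil_dominated) auto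
      then have "complex_of_real (r / 2) *\<^sub>C ?p \<in> dil r (B M (m M))"
        by (rule dil_scale[OF absolutely_convex_B]) (use r in simp_all)
      then have "complex_of_real (r / 2) *\<^sub>C ?p \<in> U"
        using r(2) complex_vs.subspace_scale[OF subspace_XX pX] by blast
      then have "cmod (complex_of_real (r / 2) * p (z M k)) \<le> c M k"
        using M(1) z(1)[OF M(1)] unfolding U_iff complex_scaleC_apply by force
      then have "cmod (p (z M k)) \<le> 2 / r * c M k"
        using r by (simp add: norm_mult field_simps)
      then show "cmod (g (z M k)) \<le> 2 / r * c M k + e"
        using p(3) norm_triangle_ineq2[of "g (z M k)" "p (z M k)"] by (simp add: norm_minus_commute)
    qed
  qed
  \<comment> \<open>The failure of the condition was sampled with the constants
    \<open>Suc k\<close>, unbounded along the points, and now meets the fixed constant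
    \<open>2 / r\<close>.\<close>
  then have "real (Suc k) * c M k < 2 / r * c M k" for k
    using z(2)[OF M(1), of k] unfolding c_def[symmetric] by (meson less_le_trans)
  then have "real (Suc k) < 2 / r" for k
    using cpos[OF M(1), of k] by (meson mult_less_cancel_right_pos)
  moreover obtain k where "2 / r < real k" using reals_Archimedean2 by blast
  ultimately show False by (meson less_trans not_less_iff_gr_or_eq of_nat_less_iff lessI)
qed

end


section \<open>Vanishing of the first derived projective limit\<close>

text \<open>If the image of \<open>proj_sigma\<close> is the only class, it is the class of
  \<open>y\<close>; and it contains \<open>y\<close>, because the zero sequence is mapped to
  \<open>y - y\<close>.\<close>

lemma Proj1_is_zero_imp_surj:
  fixes X :: "nat \<Rightarrow> 'a::complex_vs set"
  assumes P: "Proj1_is_zero X" and y: "y \<in> Pi UNIV X" and X: "\<And>N. 0 \<in> X N"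
  obtains x where "x \<in> Pi UNIV X" "y = proj_sigma x"
proof -
  let ?R = "{(x, y). x \<in> Pi UNIV X \<and> y \<in> Pi UNIV X \<and> x - y \<in> proj_sigma ` Pi UNIV X}"
  have "?R `` {y} \<in> Proj1 X" unfolding Proj1_def using y by (rule quotientI)
  then have "?R `` {y} = proj_sigma ` Pi UNIV X" using P unfolding Proj1_is_zero_def by simp
  moreover have "y - y \<in> proj_sigma ` Pi UNIV X"
  proof (rule image_eqI)
    show "y - y = proj_sigma (\<lambda>_. 0)" by (simp add: proj_sigma_def fun_eq_iff)
  qed (use X in auto)
  then have "y \<in> ?R `` {y}" using y by simp
  ultimately show ?thesis using that by auto
qed

text \<open>The coefficients match the doubling of errors in the successive approximations and sum
  to 2. The sum is pointwise, so no topology is involved.\<close>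

definition geometric_series :: "(nat \<Rightarrow> 'a \<Rightarrow> complex) \<Rightarrow> 'a \<Rightarrow> complex" where
  "geometric_series f = (\<lambda>z. \<Sum>t. (1/2) ^ t * f t z)"

lemma geometric_series_split:
  assumes "\<And>z. summable (\<lambda>t. (1/2) ^ t * f t z)"
  shows "geometric_series f = (\<Sum>t<n. (1/2) ^ t *\<^sub>C f t) + (1/2) ^ n *\<^sub>C geometric_series (\<lambda>t. f (t + n))"
proof
  fix z
  have "geometric_series f z = (\<Sum>t. (1/2) ^ (t + n) * f (t + n) z) + (\<Sum>t<n. (1/2) ^ t * f t z)"
    unfolding geometric_series_def by (rule suminf_split_initial_segment[OF assms])
  also have "(\<Sum>t. (1/2) ^ (t + n) * f (t + n) z) = (1/2) ^ n * geometric_series (\<lambda>t. f (t + n)) z"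
  proof -
    have "summable (\<lambda>t. (1/2) ^ (t + n) * f (t + n) z)"
      using assms[of z] by (subst summable_iff_shift)
    then have "summable (\<lambda>t. 2 ^ n * ((1/2) ^ (t + n) * f (t + n) z))" by (rule summable_mult)
    then have "summable (\<lambda>t. (1/2) ^ t * f (t + n) z)"
      by (simp add: power_add power_one_over field_simps)
    then have "(\<Sum>t. (1/2) ^ n * ((1/2) ^ t * f (t + n) z)) = (1/2) ^ n * geometric_series (\<lambda>t. f (t + n)) z"
      unfolding geometric_series_def by (rule suminf_mult)
    then show ?thesis by (simp add: power_add mult_ac)
  qed
  also have "(\<Sum>t<n. (1/2) ^ t * f t z) = (\<Sum>t<n. (1/2) ^ t *\<^sub>C f t) z"
    by (induction n) (simp_all add: complex_scaleC_apply)
  finally show "geometric_series f z = ((\<Sum>t<n. (1/2) ^ t *\<^sub>C f t) + (1/2) ^ n *\<^sub>C geometric_series (\<lambda>t. f (t + n))) z"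
    by (simp add: complex_scaleC_apply)
qed

text \<open>Doubling keeps the errors \<open>y t\<close> in sets of comparable size instead of ever
  smaller ones; undone, it reproduces the coefficients of \<open>geometric_series\<close>.\<close>

lemma doubling_recursion:
  fixes y w :: "nat \<Rightarrow> 'a::complex_vs"
  assumes "\<And>t. y (Suc t) = 2 *\<^sub>C (y t - w t)"
  shows "y 0 = (\<Sum>t<n. (1/2) ^ t *\<^sub>C w t) + (1/2) ^ n *\<^sub>C y n"
proof (induction n)
  case 0
  then show ?case by (simp add: scaleC_one)
next
  case (Suc n)
  have "(1/2) ^ n *\<^sub>C y n = (1/2) ^ n *\<^sub>C w n + (1/2) ^ Suc n *\<^sub>C y (Suc n)"
    unfolding assms by (simp add: scaleC_scaleC complex_vs.scale_right_diff_distrib)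
  then show ?case using Suc by (simp add: add.assoc)
qed

text \<open>A form of stability under convex series. The factor 2 is the sum of the coefficients;
  pointwise summability is included so that initial segments can be split off.\<close>

definition series_closed :: "('a \<Rightarrow> complex) set \<Rightarrow> bool" where
  "series_closed S \<longleftrightarrow> absolutely_convex S \<and>
    (\<forall>f. (\<forall>t. f t \<in> S) \<longrightarrow> geometric_series f \<in> dil 2 S \<and> (\<forall>z. summable (\<lambda>t. (1/2) ^ t * f t z)))"

lemma series_closed_dominated:
  fixes G :: "(complex^'d) set"
  assumes G: "open G" and v: "continuous_on G v" "\<And>z. z \<in> G \<Longrightarrow> v z \<ge> 0"
  shows "series_closed (dominated G v)"
  unfolding series_closed_def
proof (intro conjI allI impI)
  show "absolutely_convex (dominated G v)" using v(2) by (rule absolutely_convex_dominated)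
  fix f :: "nat \<Rightarrow> complex^'d \<Rightarrow> complex" assume f: "\<forall>t. f t \<in> dominated G v"
  have hol: "(\<lambda>z. (1/2) ^ t * f t z) \<in> hol G" for t
  proof -
    have "(1/2) ^ t *\<^sub>C f t \<in> hol G"
      using f by (intro complex_vs.subspace_scale subspace_hol) (simp add: dominated_def)
    then show ?thesis by (simp add: scaleC_fun_def scaleC_complex_def)
  qed
  have bnd: "cmod ((1/2) ^ t * f t z) \<le> (1/2) ^ t * v z" if "z \<in> G" for t z
    using f that by (auto simp: dominated_def norm_mult norm_power norm_divide intro!: mult_left_mono)
  have s: "summable (\<lambda>t. (1/2 :: real) ^ t)" by (rule summable_geometric) simp
  have e: "(\<Sum>t. (1/2 :: real) ^ t) = 2" by (subst suminf_geometric) simp_all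
  note r = hol_weighted_series[OF G v(1) hol bnd s _ v(2)]
  show "geometric_series f \<in> dil 2 (dominated G v)"
    unfolding geometric_series_def using r(1) by (subst dil_dominated) (simp_all add: e)
  show "summable (\<lambda>t. (1/2) ^ t * f t z)" for z using r(2) by simp
qed

lemma series_closed_dil:
  assumes S: "series_closed S" and f: "\<And>t. f t \<in> dil c S" and c: "c > 0"
  shows "geometric_series f \<in> dil (2 * c) S" "summable (\<lambda>t. (1/2) ^ t * f t z)"
proof -
  define g where "g t = complex_of_real (1 / c) *\<^sub>C f t" for t
  have "g t \<in> S" for t using f[of t] unfolding mem_dil_iff[OF c] g_def .
  moreover have "(\<forall>t. g t \<in> S) \<longrightarrow> geometric_series g \<in> dil 2 S \<and> (\<forall>z. summable (\<lambda>t. (1/2) ^ t * g t z))"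
    using S unfolding series_closed_def by (elim conjE allE)
  ultimately have g: "geometric_series g \<in> dil 2 S" "\<And>z. summable (\<lambda>t. (1/2) ^ t * g t z)"
    by simp_all
  have fg: "f t z = complex_of_real c * g t z" for t z using c by (simp add: g_def complex_scaleC_apply)
  have sm: "summable (\<lambda>t. complex_of_real c * ((1/2) ^ t * g t z))" for z by (rule summable_mult[OF g(2)])
  then show "summable (\<lambda>t. (1/2) ^ t * f t z)" unfolding fg by (simp add: mult_ac)
  have "geometric_series f = complex_of_real c *\<^sub>C geometric_series g"
    unfolding geometric_series_def scaleC_fun_def scaleC_complex_def fg
    using suminf_mult[OF g(2), of "complex_of_real c"] by (simp add: mult_ac)
  moreover have "dil (2 * c) S = dil c (dil 2 S)" unfolding dil_dil by (simp add: mult.commute)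
  ultimately show "geometric_series f \<in> dil (2 * c) S" using g(1) by blast
qed

text \<open>Membership of the sum is tested set by set, because dilation by 2 is invertible and
  hence commutes with intersections.\<close>

lemma series_closed_INT:
  assumes ne: "I \<noteq> {}" and S: "\<And>i. i \<in> I \<Longrightarrow> series_closed (S i)"
  shows "series_closed (\<Inter>i\<in>I. S i)"
  unfolding series_closed_def
proof (intro conjI allI impI)
  have ac: "absolutely_convex (S i)" if "i \<in> I" for i using S[OF that] by (simp add: series_closed_def)
  show "absolutely_convex (\<Inter>i\<in>I. S i)"
    unfolding absolutely_convex_def
  proof (intro conjI ballI allI impI INT_I)
    have "0 \<in> (\<Inter>i\<in>I. S i)" using ac absolutely_convex_zero by blast
    then show "(\<Inter>i\<in>I. S i) \<noteq> {}" by blast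
    fix x y b c i assume "x \<in> (\<Inter>i\<in>I. S i)" "y \<in> (\<Inter>i\<in>I. S i)" "cmod b + cmod c \<le> 1" "i \<in> I"
    then show "b *\<^sub>C x + c *\<^sub>C y \<in> S i" using ac[of i] unfolding absolutely_convex_def by blast
  qed
  fix f :: "nat \<Rightarrow> _ \<Rightarrow> complex" assume f: "\<forall>t. f t \<in> (\<Inter>i\<in>I. S i)"
  then have "geometric_series f \<in> dil 2 (S i)" if "i \<in> I" for i
    using S[OF that] that unfolding series_closed_def by blast
  then have "complex_of_real (1 / 2) *\<^sub>C geometric_series f \<in> S i" if "i \<in> I" for i
    using that mem_dil_iff[of 2 "geometric_series f" "S i"] by simp
  then show "geometric_series f \<in> dil 2 (\<Inter>i\<in>I. S i)" by (subst mem_dil_iff) simp_all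
  obtain i where "i \<in> I" using ne by blast
  then show "summable (\<lambda>t. (1/2) ^ t * f t z)" for z using f S unfolding series_closed_def by blast
qed

section \<open>Balls along a branch and their finite intersections\<close>

context weighted_spectrum
begin

text \<open>One index governs both weight and radius, so that each step is an increasing countable
  union of the sets \<open>E N n\<close> and a web needs one natural number per level.\<close>

definition E :: "nat \<Rightarrow> nat \<Rightarrow> (complex^'d \<Rightarrow> complex) set" where
  "E N n = dil (real (Suc n)) (B N n)"

definition W :: "(nat \<Rightarrow> nat) \<Rightarrow> nat \<Rightarrow> (complex^'d \<Rightarrow> complex) set" where
  "W l k = (\<Inter>i\<in>{..k}. E i (l i))"

lemma E_eq: "E N n = dominated G (\<lambda>z. real (Suc n) * (1 / a N n z))"
  unfolding E_def B_def by (rule dil_dominated) simp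

lemma series_closed_E: "series_closed (E N n)"
proof -
  have "continuous_on G (\<lambda>z. 1 / a N n z)"
    using weight[of N n] by (force simp: weight_def intro!: continuous_intros)
  then show ?thesis
    unfolding E_eq using pos
    by (intro series_closed_dominated[OF open_G] continuous_on_mult_left) (simp_all add: less_imp_le)
qed

lemma absolutely_convex_E: "absolutely_convex (E N n)"
  using series_closed_E by (simp add: series_closed_def)

lemma series_closed_W: "series_closed (W l k)"
  unfolding W_def by (intro series_closed_INT series_closed_E) auto

lemma absolutely_convex_W: "absolutely_convex (W l k)"
  using series_closed_W by (simp add: series_closed_def)

lemma W_antimono: "k \<le> m \<Longrightarrow> W l m \<subseteq> W l k"
  unfolding W_def by auto

lemma W_subset_E: "i \<le> k \<Longrightarrow> W l k \<subseteq> E i (l i)"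
  unfolding W_def by auto

lemma dil_W_subset: "k \<le> m \<Longrightarrow> dil c (W l m) \<subseteq> dil c (W l k)"
  by (intro image_mono W_antimono)

lemma E_mono: "n \<le> m \<Longrightarrow> E N n \<subseteq> E N m"
  unfolding E_def by (rule dil_B_mono) auto

lemma X_eq_UN: "X N = (\<Union>n. E N n)"
proof (intro equalityI subsetI)
  fix f assume "f \<in> X N"
  then obtain n r where r: "r > 0" "f \<in> dil r (B N n)" unfolding mem_X_iff by blast
  obtain m where "r < real m" using reals_Archimedean2 by blast
  then have "dil r (B N n) \<subseteq> E N (max n m)" unfolding E_def using r by (intro dil_B_mono) auto
  then show "f \<in> (\<Union>n. E N n)" using r by blast
next
  fix f assume "f \<in> (\<Union>n. E N n)"
  then obtain n where "f \<in> E N n" by blast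
  then show "f \<in> X N" unfolding mem_X_iff E_def by (meson of_nat_0_less_iff zero_less_Suc)
qed

lemma dil_E_subset_X: "dil c (E N n) \<subseteq> X N"
  unfolding X_eq_UN[of N] using complex_vs.subspace_scale[OF subspace_X, of _ N] unfolding X_eq_UN by blast

lemma dil_W_subset_X: "i \<le> k \<Longrightarrow> dil c (W l k) \<subseteq> X i"
  using W_subset_E[of i k l] dil_E_subset_X[of c i "l i"] image_mono by blast

text \<open>The terms from index \<open>N\<close> on lie in \<open>dil c (W l (k + N))\<close>, a
  subset of the step \<open>N\<close>, and the finitely many others lie in \<open>XX\<close>. So the
  sum belongs to every step, although its size is measured by \<open>W l k\<close> alone.\<close>

lemma geometric_series_in_XX:
  assumes f: "\<And>t. f t \<in> XX" "\<And>t. f t \<in> dil c (W l (k + t))" and c: "c > 0"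
  shows "geometric_series f \<in> XX" "geometric_series f \<in> dil (2 * c) (W l k)"
    "summable (\<lambda>t. (1/2) ^ t * f t z)"
proof -
  have f0: "f t \<in> dil c (W l k)" for t using f(2)[of t] dil_W_subset[of k "k + t" c l] by auto
  show "geometric_series f \<in> dil (2 * c) (W l k)" and s: "summable (\<lambda>t. (1/2) ^ t * f t z)" for z
    using series_closed_dil[OF series_closed_W f0 c] by auto
  have "geometric_series f \<in> X N" for N
  proof -
    have "f (t + N) \<in> dil c (W l (k + N))" for t
      using f(2)[of "t + N"] dil_W_subset[of "k + N" "k + (t + N)" c l] by auto
    then have "geometric_series (\<lambda>t. f (t + N)) \<in> dil (2 * c) (W l (k + N))"
      by (intro series_closed_dil(1)[OF series_closed_W _ c])
    then have 1: "geometric_series (\<lambda>t. f (t + N)) \<in> X N"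
      by (rule subsetD[OF dil_W_subset_X[OF le_add2]])
    have "f t \<in> X N" for t using f(1) by (auto simp: XX_def)
    then show ?thesis unfolding geometric_series_split[of f N, OF s]
      using 1 by (intro complex_vs.subspace_add complex_vs.subspace_sum complex_vs.subspace_scale subspace_X)
  qed
  then show "geometric_series f \<in> XX" by (simp add: XX_def)
qed

text \<open>Baire's theorem is applied to the product of the spaces \<open>X N\<close> with discrete topologies, where
  surjectivity of \<^const>\<open>proj_sigma\<close> presents everything as a countably branching web of images of the
  sets on which the first coordinates lie in prescribed balls. The vector \<open>v\<close> is placed at coordinate \<open>j\<close>:
  a preimage is constant before \<open>j\<close> and jumps by \<open>v\<close> there.\<close>

lemma Proj1_zero_approx_decomposition:
  assumes P: "Proj1_is_zero X"
  obtains l where "\<And>k. \<exists>j\<ge>k. \<forall>v\<in>X j. \<forall>p. \<exists>u\<in>dil 2 (W l k). v - u \<in> X p"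
proof -
  define T where "T = product_topology (\<lambda>N. discrete_topology (X N)) UNIV"
  define A where "A ls = proj_sigma ` {x \<in> Pi UNIV X. \<forall>i<length ls. x i \<in> E i (ls ! i)}" for ls
  have top: "topspace T = Pi UNIV X" by (simp add: T_def PiE_UNIV_domain)
  have sigma: "proj_sigma x \<in> Pi UNIV X" if "x \<in> Pi UNIV X" for x
  proof (rule Pi_I)
    fix N
    have "x (Suc N) \<in> X N" "x N \<in> X N" using that X_antimono[of N "Suc N"] by auto
    then show "proj_sigma x N \<in> X N" unfolding proj_sigma_def by (rule complex_vs.subspace_diff[OF subspace_X])
  qed
  obtain l where l: "\<And>k. T interior_of (T closure_of (A (map l [0..<k]))) \<noteq> {}"
  proof (rule Baire_web[of T A])
    show "completely_metrizable_space T"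
      unfolding T_def completely_metrizable_space_product_topology
      by (auto simp: completely_metrizable_space_discrete_topology)
    show "topspace T \<noteq> {}"
    proof -
      have "(\<lambda>_. 0) \<in> Pi UNIV X" by (simp add: complex_vs.subspace_0[OF subspace_X])
      then show ?thesis unfolding top by blast
    qed
    show "topspace T \<subseteq> A []"
    proof
      fix y assume "y \<in> topspace T"
      then obtain x where "x \<in> Pi UNIV X" "y = proj_sigma x"
        using Proj1_is_zero_imp_surj[OF P] complex_vs.subspace_0[OF subspace_X] unfolding top by blast
      then show "y \<in> A []" unfolding A_def by auto
    qed
    show "A ls \<subseteq> topspace T" for ls unfolding A_def top using sigma by blast
    show "A ls \<subseteq> (\<Union>n. A (ls @ [n]))" for ls
    proof
      fix y assume "y \<in> A ls"
      then obtain x where x: "x \<in> Pi UNIV X" "\<forall>i<length ls. x i \<in> E i (ls ! i)" "y = proj_sigma x"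
        unfolding A_def by blast
      have "x (length ls) \<in> X (length ls)" using x by blast
      then obtain n where n: "x (length ls) \<in> E (length ls) n" unfolding X_eq_UN by blast
      have "\<forall>i<length (ls @ [n]). x i \<in> E i ((ls @ [n]) ! i)"
        using x(2) n by (auto simp: nth_append less_Suc_eq)
      then show "y \<in> (\<Union>n. A (ls @ [n]))" unfolding A_def using x by blast
    qed
  qed (use that in blast)
  have "\<exists>j\<ge>k. \<forall>v\<in>X j. \<forall>p. \<exists>u\<in>dil 2 (W l k). v - u \<in> X p" for k
  proof -
    \<comment> \<open>\<open>Suc k\<close> entries prescribe the balls of the coordinates 0 to
      \<open>k\<close>, as in \<open>W l k\<close>.\<close>
    let ?A = "A (map l [0..<Suc k])"
    obtain y where y: "y \<in> T interior_of (T closure_of ?A)" using l[of "Suc k"] by (meson all_not_in_conv)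
    obtain O' where O': "openin T O'" "y \<in> O'" "O' \<subseteq> T closure_of ?A" using y unfolding interior_of_def by blast
    obtain U where U: "finite {i. U i \<noteq> X i}" "y \<in> Pi\<^sub>E UNIV U" "Pi\<^sub>E UNIV U \<subseteq> O'"
      using O'(1,2) unfolding T_def openin_product_topology_alt by fastforce
    obtain j0 where j0: "\<And>i. U i \<noteq> X i \<Longrightarrow> i < j0"
      using finite_nat_set_iff_bounded[THEN iffD1, OF U(1)] by blast
    \<comment> \<open>From \<open>j0\<close> on the basic neighbourhood imposes no restriction, so
      any \<open>v\<close> in \<open>X j\<close> may be added to \<open>y\<close> at coordinate
      \<open>j\<close>. The bound \<open>k \<le> j\<close> puts all prescribed coordinates where the
      difference of preimages is still constant.\<close>
    define j where "j = max k j0"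
    have yT: "y \<in> Pi UNIV X" using O' openin_subset[OF O'(1)] top by blast
    have "\<exists>u\<in>dil 2 (W l k). v - u \<in> X p" if v: "v \<in> X j" for v p
    proof -
      define y' where "y' = (\<lambda>i. if i = j then y i + v else y i)"
      have "j \<ge> j0" by (simp add: j_def)
      then have Uj: "U j = X j" using j0 by (meson not_le)
      have "y' i \<in> U i" for i
        using U(2) Uj v yT complex_vs.subspace_add[OF subspace_X] unfolding y'_def by (auto simp: Pi_iff PiE_iff)
      then have y'c: "y' \<in> T closure_of ?A" using U(3) O'(3) by (auto simp: PiE_UNIV_domain)
      have yc: "y \<in> T closure_of ?A" using O' by blast
      \<comment> \<open>Agreement up to \<open>q\<close> carries the jump past \<open>j\<close>: the
        difference of the preimages equals \<open>x 0 + v\<close> at \<open>Suc q\<close>, and it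
        lies in \<open>X p\<close> since \<open>p \<le> Suc q\<close>.\<close>
      define q where "q = max p j"
      \<comment> \<open>With discrete factors, fixing the coordinates up to \<open>q\<close> is an
        open condition. Hence a point of the closure is matched exactly, not just approximately, on
        these coordinates.\<close>
      have near: "\<exists>x. x \<in> Pi UNIV X \<and> (\<forall>i\<le>k. x i \<in> E i (l i)) \<and> (\<forall>i\<le>q. proj_sigma x i = x0 i)"
        if x0: "x0 \<in> T closure_of ?A" for x0
      proof -
        let ?N = "Pi\<^sub>E UNIV (\<lambda>i. if i \<le> q then {x0 i} else X i)"
        have x0T: "x0 \<in> Pi UNIV X" unfolding top[symmetric] using closure_of_subset_topspace x0 by (rule subsetD)
        have "openin T ?N" unfolding T_def
        proof (rule product_topology_basis)
          show "openin (discrete_topology (X i)) (if i \<le> q then {x0 i} else X i)" for i using x0T by auto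
          show "finite {i. (if i \<le> q then {x0 i} else X i) \<noteq> topspace (discrete_topology (X i))}"
            by (rule finite_subset[of _ "{..q}"]) auto
        qed
        moreover have "x0 \<in> ?N" using x0T by (auto simp: PiE_UNIV_domain)
        ultimately obtain s where s: "s \<in> ?A" "s \<in> ?N" using x0 unfolding in_closure_of by blast
        then obtain x where x: "x \<in> Pi UNIV X" "\<forall>i<Suc k. x i \<in> E i (map l [0..<Suc k] ! i)" "s = proj_sigma x"
          unfolding A_def by auto
        have "\<forall>i\<le>q. proj_sigma x i = x0 i" using s(2) unfolding x(3) by (auto simp: PiE_UNIV_domain Pi_iff split: if_splits)
        moreover have "\<forall>i\<le>k. x i \<in> E i (l i)" using x(2) by (auto simp: less_Suc_eq_le simp del: upt_Suc)
        ultimately show ?thesis using x(1) by blast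
      qed
      obtain w where w: "w \<in> Pi UNIV X" "\<forall>i\<le>k. w i \<in> E i (l i)" "\<forall>i\<le>q. proj_sigma w i = y i"
        using near[OF yc] by blast
      obtain w' where w': "w' \<in> Pi UNIV X" "\<forall>i\<le>k. w' i \<in> E i (l i)" "\<forall>i\<le>q. proj_sigma w' i = y' i"
        using near[OF y'c] by blast
      define x where "x i = w' i - w i" for i
      have xE: "x i \<in> dil 2 (E i (l i))" if "i \<le> k" for i
      proof -
        have 1: "w' i \<in> dil 1 (E i (l i))" using w' that by auto
        have "w i \<in> E i (l i)" using w that by blast
        then have "(-1) *\<^sub>C w i \<in> E i (l i)" by (rule absolutely_convex_scale[OF absolutely_convex_E]) simp
        then have 2: "(-1) *\<^sub>C w i \<in> dil 1 (E i (l i))" by simp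
        have "w' i + (-1) *\<^sub>C w i \<in> dil (1 + 1) (E i (l i))"
          by (rule dil_add[OF absolutely_convex_E 1 2]) auto
        then show ?thesis by (simp add: x_def)
      qed
      have step: "x (Suc i) - x i = (if i = j then v else 0)" if "i \<le> q" for i
      proof -
        have "x (Suc i) - x i = proj_sigma w' i - proj_sigma w i" by (simp add: x_def proj_sigma_def)
        then show ?thesis using w(3) w'(3) that by (simp add: y'_def)
      qed
      have low: "x i = x 0" if "i \<le> j" for i
        using that
      proof (induction i)
        case (Suc i)
        then have "x (Suc i) - x i = 0" using step[of i] by (simp add: q_def)
        then show ?case using Suc by simp
      qed simp
      have high: "x i = x 0 + v" if "j < i" "i \<le> Suc q" for i
        using that
      proof (induction i)
        case (Suc i)
        show ?case
        proof (cases "i = j")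
          case True
          then have "x (Suc i) - x i = v" using step[of i] Suc by simp
          moreover have "x i = x 0" using low[of i] True by simp
          ultimately show ?thesis by (simp add: algebra_simps)
        next
          case False
          then have "x (Suc i) - x i = 0" using step[of i] Suc by simp
          then show ?thesis using Suc False by simp
        qed
      qed simp
      have "x 0 \<in> dil 2 (E i (l i))" if "i \<le> k" for i
        using xE[OF that] low[of i] that by (simp add: j_def)
      then have "complex_of_real (1 / 2) *\<^sub>C x 0 \<in> E i (l i)" if "i \<le> k" for i
        using that mem_dil_iff[of 2 "x 0" "E i (l i)"] by simp
      then have "x 0 \<in> dil 2 (W l k)" unfolding W_def by (subst mem_dil_iff) auto
      then have "(-1) *\<^sub>C x 0 \<in> dil 2 (W l k)" by (rule dil_scale[OF absolutely_convex_W]) auto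
      moreover have "v - (-1) *\<^sub>C x 0 \<in> X p"
      proof -
        have "x (Suc q) \<in> X (Suc q)"
          unfolding x_def using w(1) w'(1) by (intro complex_vs.subspace_diff subspace_X) auto
        moreover have "p \<le> Suc q" by (simp add: q_def)
        ultimately have "x (Suc q) \<in> X p" using X_antimono by blast
        moreover have "x (Suc q) = v - (-1) *\<^sub>C x 0" using high[of "Suc q"] by (simp add: q_def)
        ultimately show ?thesis by simp
      qed
      ultimately show ?thesis by blast
    qed
    then show ?thesis by (intro exI[of _ j]) (auto simp: j_def)
  qed
  then show ?thesis by (rule that)
qed

text \<open>In the approximate version \<open>u\<close> depends on \<open>p\<close>. Iteration
  removes this: the error \<open>y t\<close> lies in \<open>X (j (k + t))\<close>, deep enough to be
  decomposed again with a term in \<open>dil 2 (W l (k + t))\<close>. Summation turns 2 into 4; for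
  each \<open>N\<close> both \<open>y N\<close> and the tail of the series from \<open>N\<close> on
  lie in \<open>X N\<close>.\<close>

lemma Proj1_zero_decomposition:
  assumes P: "Proj1_is_zero X"
  obtains l where "\<And>k. \<exists>j. \<forall>v\<in>X j. \<exists>u\<in>dil 4 (W l k). v - u \<in> XX"
proof -
  obtain l where "\<And>k. \<exists>j\<ge>k. \<forall>v\<in>X j. \<forall>p. \<exists>u\<in>dil 2 (W l k). v - u \<in> X p"
    using Proj1_zero_approx_decomposition[OF P] by blast
  then obtain j where j: "\<And>k. j k \<ge> k" "\<And>k v p. v \<in> X (j k) \<Longrightarrow> \<exists>u\<in>dil 2 (W l k). v - u \<in> X p"
    by metis
  have "\<exists>u\<in>dil 4 (W l k). v - u \<in> XX" if v: "v \<in> X (j k)" for k v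
  proof -
    have "\<exists>y. \<forall>t. (y t \<in> X (j (k + t)) \<and> (t = 0 \<longrightarrow> y t = v)) \<and>
      (\<exists>w\<in>dil 2 (W l (k + t)). y (Suc t) = 2 *\<^sub>C (y t - w))"
    proof (rule dependent_nat_choice)
      show "\<exists>x. x \<in> X (j (k + 0)) \<and> (0 = (0::nat) \<longrightarrow> x = v)" using v by auto
      fix x t assume "x \<in> X (j (k + t)) \<and> (t = 0 \<longrightarrow> x = v)"
      then obtain w where w: "w \<in> dil 2 (W l (k + t))" "x - w \<in> X (j (k + Suc t))" using j(2) by blast
      then show "\<exists>y. (y \<in> X (j (k + Suc t)) \<and> (Suc t = 0 \<longrightarrow> y = v)) \<and>
          (\<exists>w\<in>dil 2 (W l (k + t)). y = 2 *\<^sub>C (x - w))"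
        using complex_vs.subspace_scale[OF subspace_X] by blast
    qed
    then obtain y where y: "\<And>t. y t \<in> X (j (k + t))" "y 0 = v"
      "\<And>t. \<exists>w\<in>dil 2 (W l (k + t)). y (Suc t) = 2 *\<^sub>C (y t - w)" by blast
    then obtain w where w: "\<And>t. w t \<in> dil 2 (W l (k + t))" "\<And>t. y (Suc t) = 2 *\<^sub>C (y t - w t)" by metis
    have wk: "w t \<in> dil 2 (W l k)" for t using w(1)[of t] dil_W_subset[of k "k + t" 2 l] by auto
    have s: "summable (\<lambda>t. (1/2) ^ t * w t z)" for z
      by (rule series_closed_dil(2)[OF series_closed_W wk]) simp
    have u: "geometric_series w \<in> dil 4 (W l k)"
      using series_closed_dil(1)[OF series_closed_W wk] by simp
    have "v - geometric_series w \<in> X N" for N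
    proof -
      have eq: "v - geometric_series w = (1/2) ^ N *\<^sub>C y N - (1/2) ^ N *\<^sub>C geometric_series (\<lambda>t. w (t + N))"
        using doubling_recursion[of y w N, OF w(2)] geometric_series_split[of w N, OF s] y(2) by simp
      have "w (t + N) \<in> dil 2 (W l (k + N))" for t
        using w(1)[of "t + N"] dil_W_subset[of "k + N" "k + (t + N)" 2 l] by auto
      then have "geometric_series (\<lambda>t. w (t + N)) \<in> dil (2 * 2) (W l (k + N))"
        by (intro series_closed_dil(1)[OF series_closed_W]) auto
      then have 1: "geometric_series (\<lambda>t. w (t + N)) \<in> X N"
        by (rule subsetD[OF dil_W_subset_X[OF le_add2]])
      have "j (k + N) \<ge> N" using j(1)[of "k + N"] by simp
      then have "y N \<in> X N" using y(1)[of N] X_antimono by blast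
      then show ?thesis unfolding eq
        using 1 by (intro complex_vs.subspace_diff complex_vs.subspace_scale subspace_X)
    qed
    then have "v - geometric_series w \<in> XX" by (simp add: XX_def)
    then show ?thesis using u by blast
  qed
  then show ?thesis using that[of l] by blast
qed

text \<open>If \<open>U\<close> absorbed none of the sets \<open>XX \<inter> W l i\<close>, a sequence of witnesses would lie in a single
  Banach disc of the projective limit.\<close>

lemma absorbs_some_W:
  assumes U: "absolutely_convex U" and abs: "\<And>D. banach_disc (AH G a) D \<Longrightarrow> absorbs U D"
  obtains i where "absorbs U (XX \<inter> W l i)"
proof -
  have "\<exists>i. absorbs U (XX \<inter> W l i)"
  proof (rule ccontr)
    assume "\<not> ?thesis"
    then have "\<forall>i. \<exists>x. x \<in> XX \<inter> W l i \<and> x \<notin> dil (real (Suc i)) U"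
      using absorbsI[of "real (Suc _)" "XX \<inter> W l _" U] by (meson of_nat_0_less_iff zero_less_Suc)
    then obtain x where x: "\<And>i. x i \<in> XX" "\<And>i. x i \<in> W l i" "\<And>i. x i \<notin> dil (real (Suc i)) U"
      by (metis IntE)
    have "\<exists>n. \<forall>k. x k \<in> E N n" for N
    proof -
      have "\<forall>k. \<exists>m. x k \<in> E N m" using x(1) unfolding XX_def X_eq_UN by blast
      then obtain m where m: "\<And>k. x k \<in> E N (m k)" by metis
      \<comment> \<open>For \<open>k \<ge> N\<close> membership in \<open>W l k\<close> provides the
        index \<open>l N\<close>; the sum is just a common bound for the finitely many
        \<open>m k\<close> with \<open>k < N\<close>.\<close>
      let ?n = "max (l N) (\<Sum>k<N. m k)"
      have "x k \<in> E N ?n" for k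
      proof (cases "k < N")
        case True
        then have "m k \<le> (\<Sum>k<N. m k)" by (intro member_le_sum) auto
        then have "m k \<le> ?n" by simp
        then show ?thesis using m[of k] E_mono by blast
      next
        case False
        then have "x k \<in> E N (l N)" using x(2)[of k] W_subset_E[of N k l] by auto
        then show ?thesis using E_mono[of "l N" ?n N] by auto
      qed
      then show ?thesis by blast
    qed
    then obtain n where n: "\<And>N k. x k \<in> E N (n N)" by metis
    define v where "v N z = real (Suc (n N)) * (1 / a N (n N) z)" for N z
    have v0: "v N z \<ge> 0" if "z \<in> G" for N z using pos[OF that, of N "n N"] by (simp add: v_def less_imp_le)
    have bdd: "bdd_below (range (\<lambda>N. v N z))" if "z \<in> G" for z by (rule bdd_belowI[of _ 0]) (use v0[OF that] in auto)
    \<comment> \<open>The intersection of the balls is written as a single domination set, so that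
      completeness applies. The infimum may be discontinuous; \<open>v 0\<close> will be the
      continuous majorant.\<close>
    define D where "D = dominated G (\<lambda>z. INF N. v N z)"
    have DE: "D = (\<Inter>N. E N (n N))"
    proof (intro equalityI subsetI)
      fix f assume "f \<in> D"
      then have f: "f \<in> hol G" "\<And>z. z \<in> G \<Longrightarrow> cmod (f z) \<le> (INF N. v N z)" by (auto simp: D_def dominated_def)
      have "cmod (f z) \<le> v N z" if "z \<in> G" for z N
        using f(2)[OF that] cINF_lower[OF bdd[OF that], of N] by simp
      then show "f \<in> (\<Inter>N. E N (n N))" using f(1) unfolding E_eq dominated_def v_def by blast
    next
      fix f assume f: "f \<in> (\<Inter>N. E N (n N))"
      then have "cmod (f z) \<le> v N z" if "z \<in> G" for z N
        using that unfolding E_eq dominated_def v_def by blast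
      then have "cmod (f z) \<le> (INF N. v N z)" if "z \<in> G" for z using that by (intro cINF_greatest) auto
      moreover have "f \<in> hol G" using f unfolding E_eq dominated_def by blast
      ultimately show "f \<in> D" by (simp add: D_def dominated_def)
    qed
    have "banach_disc (AH G a) D"
      unfolding banach_disc_def
    proof (intro conjI)
      have inf0: "0 \<le> (INF N. v N z)" if "z \<in> G" for z using v0[OF that] by (intro cINF_greatest) auto
      have inf1: "(INF N. v N z) \<le> v 0 z" if "z \<in> G" for z using cINF_lower[OF bdd[OF that], of 0] by simp
      have cont: "continuous_on G (v 0)"
        unfolding v_def using weight[of 0 "n 0"] by (force simp: weight_def intro!: continuous_intros)
      show "absolutely_convex D" unfolding D_def using inf0 by (rule absolutely_convex_dominated)
      show "Metric_space (complex_vs.span D) (norm_dist (complex_vs.span D) (minkowski D))"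
        and "Metric_space.mcomplete (complex_vs.span D) (norm_dist (complex_vs.span D) (minkowski D))"
        unfolding D_def using mcomplete_dominated[OF open_G cont inf0 inf1] by simp_all
      show "lc_bounded (AH G a) D"
      proof (rule lc_bounded_AH)
        show "D \<subseteq> XX" unfolding DE XX_def X_eq_UN by blast
        show "\<exists>n. \<exists>r>0. D \<subseteq> dil r (B N n)" for N
          unfolding DE E_def by (intro exI[of _ "n N"] exI[of _ "real (Suc (n N))"]) auto
      qed
    qed
    then obtain r where r: "r > 0" "D \<subseteq> dil r U" using abs unfolding absorbs_def by blast
    obtain k where k: "r < real k" using reals_Archimedean2 by blast
    have "x k \<in> D" using n unfolding DE by blast
    then have "x k \<in> dil (real (Suc k)) U"
      using r k dil_mono[OF U, of r "real (Suc k)"] by auto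
    then show False using x(3) by blast
  qed
  then show ?thesis using that by blast
qed

text \<open>An open-mapping argument for the web of \<open>XX\<close> modulo \<open>W l k\<close>. It converges inside
  \<open>W l' i0\<close>, a set that \<open>U\<close> absorbs, so that \<open>U\<close> need not be closed.\<close>

lemma absorbing_by_decomposition:
  assumes U: "absolutely_convex U" and abs: "\<And>D. banach_disc (AH G a) D \<Longrightarrow> absorbs U D"
    and dec: "\<And>v. v \<in> X j \<Longrightarrow> \<exists>u\<in>dil 4 (W l k). v - u \<in> XX"
  shows "absorbs {f \<in> X j. \<exists>u\<in>U. f - u \<in> W l k} (B j n)"
proof -
  let ?B = "B j n" and ?H = "Ha G (a j n)"
  interpret H: absorbing_disc ?H ?B by (rule absorbing_disc_Ha_B)
  define T where "T = Ha_topology G (a j n)"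
  have T: "T = gauge_topology ?H ?B" unfolding T_def by (rule Ha_topology_eq)
  have HX: "?H \<subseteq> X j" unfolding ANH_space_def by blast
  \<comment> \<open>The web refines only the summand in \<open>XX\<close>; the other summand keeps
    the fixed bound supplied by \<open>dec\<close>.\<close>
  define A where "A ls = {f \<in> ?H. \<exists>w\<in>XX. (\<forall>i<length ls. w \<in> E i (ls ! i)) \<and> f - w \<in> dil 4 (W l k)}" for ls
  obtain l' where l': "\<And>i. T interior_of (T closure_of (A (map l' [0..<i]))) \<noteq> {}"
  proof (rule Baire_web[of T A])
    show "completely_metrizable_space T"
      unfolding T_def by (rule completely_metrizable_Ha[OF open_G weight nonempty])
    show "topspace T \<noteq> {}" unfolding T using complex_vs.subspace_0[OF H.subspace] by auto
    show "topspace T \<subseteq> A []"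
    proof
      fix f assume "f \<in> topspace T"
      then have f: "f \<in> ?H" by (simp add: T)
      then obtain u where u: "u \<in> dil 4 (W l k)" "f - u \<in> XX" using dec HX by blast
      have "\<exists>w\<in>XX. (\<forall>i<length []. w \<in> E i ([] ! i)) \<and> f - w \<in> dil 4 (W l k)"
        using u(1) by (intro bexI[OF _ u(2)]) simp
      then show "f \<in> A []" unfolding A_def using f by blast
    qed
    show "A ls \<subseteq> topspace T" for ls unfolding A_def T by auto
    show "A ls \<subseteq> (\<Union>n. A (ls @ [n]))" for ls
    proof
      fix f assume "f \<in> A ls"
      then obtain w where w: "f \<in> ?H" "w \<in> XX" "\<forall>i<length ls. w \<in> E i (ls ! i)" "f - w \<in> dil 4 (W l k)"
        unfolding A_def by blast
      then have "w \<in> X (length ls)" by (simp add: XX_def)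
      then obtain n where n: "w \<in> E (length ls) n" unfolding X_eq_UN by blast
      have "\<forall>i<length (ls @ [n]). w \<in> E i ((ls @ [n]) ! i)"
        using w(3) n by (auto simp: nth_append less_Suc_eq)
      then show "f \<in> (\<Union>n. A (ls @ [n]))" unfolding A_def using w by blast
    qed
  qed (use that in blast)
  \<comment> \<open>Differences of points near \<open>y + x\<close> and \<open>y\<close> double the
    bounds of the two summands. The radius \<open>r\<close> depends on \<open>i\<close> but not on
    the accuracy \<open>e\<close>, which permits iteration. The cap \<open>r \<le> 1\<close> keeps
    all errors in \<open>?B\<close>, so that their rescalings tend to 0 pointwise.\<close>
  have approx: "\<exists>r. 0 < r \<and> r \<le> 1 \<and> (\<forall>x\<in>dil r ?B. \<forall>e>0. \<exists>w\<in>XX \<inter> dil 2 (W l' i). \<exists>b\<in>dil 8 (W l k).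
      x - w - b \<in> dil e ?B)" for i
  proof -
    let ?A = "A (map l' [0..<Suc i])"
    have A: "\<exists>w\<in>XX. w \<in> W l' i \<and> p - w \<in> dil 4 (W l k)" if "p \<in> ?A" for p
    proof -
      obtain w where w: "w \<in> XX" "\<forall>s<Suc i. w \<in> E s (map l' [0..<Suc i] ! s)" "p - w \<in> dil 4 (W l k)"
        using \<open>p \<in> ?A\<close> unfolding A_def by auto
      have "w \<in> W l' i" unfolding W_def using w(2) by (auto simp: less_Suc_eq_le simp del: upt_Suc)
      then show ?thesis using w by blast
    qed
    obtain y where y: "y \<in> T interior_of (T closure_of ?A)" using l'[of "Suc i"] by (meson all_not_in_conv)
    have "openin (gauge_topology ?H ?B) (T interior_of (T closure_of ?A))"
      unfolding T[symmetric] by (rule openin_interior_of)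
    then obtain r where r: "r > 0" "\<forall>v\<in>dil r ?B. y + v \<in> T interior_of (T closure_of ?A)"
      using y unfolding H.openin_gauge_topology by blast
    have yc: "y \<in> T closure_of ?A" using interior_of_subset y by (rule subsetD)
    have near: "\<exists>p\<in>?A. p - x \<in> dil e ?B" if x: "x \<in> T closure_of ?A" and e: "e > 0" for x e
    proof -
      have xH: "x \<in> ?H" using x closure_of_subset_topspace[of T ?A] by (auto simp: T)
      have "openin T (H.gball x e)" unfolding T by (rule H.openin_gball[OF xH])
      moreover have "x \<in> H.gball x e" by (rule H.centre_in_gball[OF e])
      ultimately obtain p where p: "p \<in> ?A" "p \<in> H.gball x e" using x unfolding in_closure_of by blast
      then obtain s where "0 < s" "s < e" "p - x \<in> dil s ?B" unfolding H.gball_def by blast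
      then have "p - x \<in> dil e ?B" using dil_mono[OF absolutely_convex_B, of s e j n] by auto
      then show ?thesis using p by blast
    qed
    have "\<exists>w\<in>XX \<inter> dil 2 (W l' i). \<exists>b\<in>dil 8 (W l k). x - w - b \<in> dil e ?B"
      if x: "x \<in> dil r ?B" and e: "e > 0" for x e
    proof -
      have "y + x \<in> T closure_of ?A" using interior_of_subset r(2)[rule_format, OF x] by (rule subsetD)
      then obtain q where q: "q \<in> ?A" "q - (y + x) \<in> dil (e / 2) ?B" using near[of "y + x" "e / 2"] e by auto
      obtain p where p: "p \<in> ?A" "p - y \<in> dil (e / 2) ?B" using near[OF yc, of "e / 2"] e by auto
      obtain wq where wq: "wq \<in> XX" "wq \<in> W l' i" "q - wq \<in> dil 4 (W l k)" using A[OF q(1)] by blast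
      obtain wp where wp: "wp \<in> XX" "wp \<in> W l' i" "p - wp \<in> dil 4 (W l k)" using A[OF p(1)] by blast
      have neg: "- f \<in> S" if "absolutely_convex S" "f \<in> S" for f :: "complex^'d \<Rightarrow> complex" and S
        using absolutely_convex_scale[OF that, of "-1"] by simp
      have "wq + - wp \<in> dil (1 + 1) (W l' i)"
        using wq(2) neg[OF absolutely_convex_W wp(2)] by (intro dil_add absolutely_convex_W) simp_all
      then have 1: "wq - wp \<in> XX \<inter> dil 2 (W l' i)"
        using complex_vs.subspace_diff[OF subspace_XX wq(1) wp(1)] by simp
      have "(q - wq) + - (p - wp) \<in> dil (4 + 4) (W l k)"
        using wq(3) neg[OF absolutely_convex_dil[OF absolutely_convex_W] wp(3)]
        by (intro dil_add absolutely_convex_W) simp_all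
      then have 2: "(q - wq) - (p - wp) \<in> dil 8 (W l k)" unfolding add_uminus_conv_diff by simp
      have "(p - y) + - (q - (y + x)) \<in> dil (e / 2 + e / 2) ?B"
        using p(2) neg[OF absolutely_convex_dil[OF absolutely_convex_B] q(2)] e
        by (intro dil_add absolutely_convex_B) simp_all
      then have 3: "x - (wq - wp) - ((q - wq) - (p - wp)) \<in> dil e ?B" by (simp add: algebra_simps)
      show ?thesis using 1 2 3 by blast
    qed
    moreover have "dil (min r 1) ?B \<subseteq> dil r ?B" using r by (intro dil_mono[OF absolutely_convex_B]) auto
    ultimately show ?thesis using r(1) by (intro exI[of _ "min r 1"]) auto
  qed
  then have "\<exists>r. \<forall>i. 0 < r i \<and> r i \<le> 1 \<and> (\<forall>x\<in>dil (r i) ?B. \<forall>e>0.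
      \<exists>w\<in>XX \<inter> dil 2 (W l' i). \<exists>b\<in>dil 8 (W l k). x - w - b \<in> dil e ?B)"
    by (intro choice allI)
  then obtain r where r: "\<And>i. 0 < r i" "\<And>i. r i \<le> 1"
    "\<And>i x e. x \<in> dil (r i) ?B \<Longrightarrow> e > 0 \<Longrightarrow>
      \<exists>w\<in>XX \<inter> dil 2 (W l' i). \<exists>b\<in>dil 8 (W l k). x - w - b \<in> dil e ?B" by blast
  \<comment> \<open>The branch \<open>l'\<close> comes from the second web and is unrelated to the
    one defining \<open>W l k\<close>; \<open>U\<close> absorbs a set of this form for every branch.
    Starting the iteration at \<open>i0\<close> keeps the whole summand in \<open>XX\<close> within
    a multiple of \<open>W l' i0\<close>.\<close>
  obtain i0 where "absorbs U (XX \<inter> W l' i0)" using absorbs_some_W[OF U abs] by blast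
  then obtain \<rho> where \<rho>: "\<rho> > 0" "XX \<inter> W l' i0 \<subseteq> dil \<rho> U" unfolding absorbs_def by blast
  have split: "\<exists>w\<in>XX \<inter> dil 4 (W l' i0). x - w \<in> dil 16 (W l k)" if x: "x \<in> dil (r i0) ?B" for x
  proof -
    have "\<exists>y. \<forall>t. (y t \<in> dil (r (i0 + t)) ?B \<and> (t = 0 \<longrightarrow> y t = x)) \<and>
      (\<exists>w\<in>XX \<inter> dil 2 (W l' (i0 + t)). \<exists>b\<in>dil 8 (W l k). y (Suc t) = 2 *\<^sub>C (y t - (w + b)))"
    proof (rule dependent_nat_choice)
      show "\<exists>y. y \<in> dil (r (i0 + 0)) ?B \<and> (0 = (0::nat) \<longrightarrow> y = x)" using x by auto
      fix y t assume "y \<in> dil (r (i0 + t)) ?B \<and> (t = 0 \<longrightarrow> y = x)"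
      \<comment> \<open>The accuracy is half the radius admissible at the next stage, because the
        error is doubled before it is passed on.\<close>
      then obtain w b where wb: "w \<in> XX \<inter> dil 2 (W l' (i0 + t))" "b \<in> dil 8 (W l k)"
        "y - w - b \<in> dil (r (i0 + Suc t) / 2) ?B"
        using r(3)[of y "i0 + t" "r (i0 + Suc t) / 2"] r(1)[of "i0 + Suc t"] by auto
      have "2 *\<^sub>C (y - (w + b)) \<in> dil (r (i0 + Suc t)) ?B"
        using wb(3) r(1)[of "i0 + Suc t"]
        by (intro dil_scale[OF absolutely_convex_B, where s = "r (i0 + Suc t) / 2"]) (simp_all add: diff_diff_add)
      then show "\<exists>y'. (y' \<in> dil (r (i0 + Suc t)) ?B \<and> (Suc t = 0 \<longrightarrow> y' = x)) \<and>
          (\<exists>w\<in>XX \<inter> dil 2 (W l' (i0 + t)). \<exists>b\<in>dil 8 (W l k). y' = 2 *\<^sub>C (y - (w + b)))"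
        using wb by blast
    qed
    then obtain y where y: "\<And>t. y t \<in> dil (r (i0 + t)) ?B" "y 0 = x"
      "\<And>t. \<exists>w\<in>XX \<inter> dil 2 (W l' (i0 + t)). \<exists>b\<in>dil 8 (W l k). y (Suc t) = 2 *\<^sub>C (y t - (w + b))" by blast
    then obtain w b where wb: "\<And>t. w t \<in> XX" "\<And>t. w t \<in> dil 2 (W l' (i0 + t))" "\<And>t. b t \<in> dil 8 (W l k)"
      "\<And>t. y (Suc t) = 2 *\<^sub>C (y t - (w t + b t))" by (metis IntE)
    note w = geometric_series_in_XX[OF wb(1,2) zero_less_numeral]
    have b: "geometric_series b \<in> dil 16 (W l k)" "\<And>z. summable (\<lambda>t. (1/2) ^ t * b t z)"
      using series_closed_dil[OF series_closed_W wb(3)] by simp_all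
    have "x z = geometric_series w z + geometric_series b z" for z
    proof (rule LIMSEQ_unique)
      have eq: "x z = (\<Sum>t<N. (1/2) ^ t * w t z) + (\<Sum>t<N. (1/2) ^ t * b t z) + (1/2) ^ N * y N z" for N
      proof -
        have "(\<Sum>t<N. (1/2) ^ t *\<^sub>C (w t + b t)) z = (\<Sum>t<N. (1/2) ^ t * w t z) + (\<Sum>t<N. (1/2) ^ t * b t z)"
          by (induction N) (simp_all add: complex_scaleC_apply algebra_simps)
        then show ?thesis
          using fun_cong[OF doubling_recursion[of y "\<lambda>t. w t + b t" N, OF wb(4)], of z] y(2)
          by (simp add: complex_scaleC_apply)
      qed
      have "(\<lambda>N. (1/2) ^ N * y N z) \<longlonglongrightarrow> 0"
      proof (rule Lim_null_comparison)
        have "cmod (y N z) \<le> \<bar>1 / a j n z\<bar>" for N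
        proof -
          have "y N \<in> dil 1 ?B" using y(1)[of N] dil_mono[OF absolutely_convex_B, of "r (i0 + N)" 1 j n]
            r(1,2)[of "i0 + N"] by auto
          then have "y N \<in> ?B" by simp
          then have "y N \<in> hol G" "z \<in> G \<Longrightarrow> cmod (y N z) \<le> 1 / a j n z" by (auto simp: B_def dominated_def)
          then have "y N z = 0 \<or> cmod (y N z) \<le> 1 / a j n z" using hol_outside by blast
          then show ?thesis by (metis abs_ge_self abs_ge_zero norm_zero order_trans)
        qed
        then have "(1/2) ^ N * cmod (y N z) \<le> (1/2) ^ N * \<bar>1 / a j n z\<bar>" for N
          by (rule mult_left_mono) simp
        then show "\<forall>\<^sub>F N in sequentially. norm ((1/2) ^ N * y N z) \<le> (1/2) ^ N * \<bar>1 / a j n z\<bar>"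
          by (intro always_eventually allI) (simp add: norm_mult norm_power norm_divide)
        show "(\<lambda>N. (1/2) ^ N * \<bar>1 / a j n z\<bar>) \<longlonglongrightarrow> 0"
          by (intro tendsto_mult_left_zero LIMSEQ_realpow_zero) auto
      qed
      moreover have "(\<lambda>N. \<Sum>t<N. (1/2) ^ t * w t z) \<longlonglongrightarrow> geometric_series w z"
        unfolding geometric_series_def by (rule summable_LIMSEQ[OF w(3)])
      moreover have "(\<lambda>N. \<Sum>t<N. (1/2) ^ t * b t z) \<longlonglongrightarrow> geometric_series b z"
        unfolding geometric_series_def by (rule summable_LIMSEQ[OF b(2)])
      ultimately have "(\<lambda>N. (\<Sum>t<N. (1/2) ^ t * w t z) + (\<Sum>t<N. (1/2) ^ t * b t z) + (1/2) ^ N * y N z)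
        \<longlonglongrightarrow> geometric_series w z + geometric_series b z + 0" by (intro tendsto_add)
      then show "(\<lambda>N. x z) \<longlonglongrightarrow> geometric_series w z + geometric_series b z" unfolding eq[symmetric] by simp
      show "(\<lambda>N. x z) \<longlonglongrightarrow> x z" by (rule tendsto_const)
    qed
    then have "x = geometric_series w + geometric_series b" by (simp add: fun_eq_iff)
    then have "x - geometric_series w \<in> dil 16 (W l k)" using b(1) by simp
    moreover have "geometric_series w \<in> dil 4 (W l' i0)" using w(2) by simp
    ultimately show ?thesis using w(1) by blast
  qed
  let ?V = "{f \<in> X j. \<exists>u\<in>U. f - u \<in> W l k}"
  \<comment> \<open>\<open>4 * \<rho>\<close> serves the summand in \<open>XX\<close>, through its
    absorption by \<open>U\<close>, and 16 serves the summand in \<open>W l k\<close>.\<close>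
  define c where "c = max (4 * \<rho>) 16"
  have c: "c > 0" "4 * \<rho> \<le> c" "16 \<le> c" by (auto simp: c_def)
  show ?thesis
  proof (rule absorbsI)
    show "c / r i0 > 0" using c r(1) by simp
    fix x assume x: "x \<in> ?B"
    let ?x = "complex_of_real (r i0) *\<^sub>C x"
    have "?x \<in> dil (r i0) ?B" using x by blast
    then obtain w where w: "w \<in> XX" "w \<in> dil 4 (W l' i0)" "?x - w \<in> dil 16 (W l k)" using split by blast
    obtain w' where w': "w' \<in> W l' i0" "w = complex_of_real 4 *\<^sub>C w'" using w(2) by blast
    have "complex_of_real (1 / 4) *\<^sub>C w \<in> XX" using w(1) by (rule complex_vs.subspace_scale[OF subspace_XX])
    moreover have "complex_of_real (1 / 4) *\<^sub>C w = w'" unfolding w'(2) by (simp add: scaleC_scaleC)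
    ultimately have "w' \<in> dil \<rho> U" using w'(1) \<rho>(2) by auto
    then have "w \<in> dil 4 (dil \<rho> U)" unfolding w'(2) by (rule imageI)
    then have "w \<in> dil (4 * \<rho>) U" unfolding dil_dil .
    then have "w \<in> dil c U" using dil_mono[OF U, of "4 * \<rho>" c] \<rho> c by auto
    then have 1: "complex_of_real (1 / c) *\<^sub>C w \<in> U" unfolding mem_dil_iff[OF c(1)] .
    have "?x - w \<in> dil c (W l k)" using w(3) dil_mono[OF absolutely_convex_W, of 16 c l k] c by auto
    then have 2: "complex_of_real (1 / c) *\<^sub>C ?x - complex_of_real (1 / c) *\<^sub>C w \<in> W l k"
      unfolding mem_dil_iff[OF c(1)] complex_vs.scale_right_diff_distrib .
    have "x \<in> X j" using x H.V(2) HX by blast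
    then have "complex_of_real (1 / c) *\<^sub>C ?x \<in> X j" by (intro complex_vs.subspace_scale[OF subspace_X])
    then have "complex_of_real (1 / c) *\<^sub>C ?x \<in> ?V" using 1 2 by blast
    moreover have "complex_of_real (1 / c) *\<^sub>C ?x = complex_of_real (1 / (c / r i0)) *\<^sub>C x"
      by (simp add: scaleC_scaleC)
    ultimately show "x \<in> dil (c / r i0) ?V"
      using c r(1)[of i0] by (subst mem_dil_iff) simp_all
  qed
qed

lemma Proj1_zero_imp_ultrabornological:
  assumes P: "Proj1_is_zero X"
  shows "ultrabornological (AH G a)"
  unfolding ultrabornological_def
proof (intro conjI allI impI lcs_AH)
  fix U assume "U \<subseteq> topspace (AH G a) \<and> absolutely_convex U \<and> (\<forall>D. banach_disc (AH G a) D \<longrightarrow> absorbs U D)"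
  then have U: "U \<subseteq> XX" "absolutely_convex U" and abs: "\<And>D. banach_disc (AH G a) D \<Longrightarrow> absorbs U D" by auto
  obtain l where l: "\<And>k. \<exists>j. \<forall>v\<in>X j. \<exists>u\<in>dil 4 (W l k). v - u \<in> XX"
    using Proj1_zero_decomposition[OF P] by blast
  obtain k where "absorbs U (XX \<inter> W l k)" using absorbs_some_W[OF U(2) abs] by blast
  then obtain \<rho> where \<rho>: "\<rho> > 0" "XX \<inter> W l k \<subseteq> dil \<rho> U" unfolding absorbs_def by blast
  obtain j where j: "\<And>v. v \<in> X j \<Longrightarrow> \<exists>u\<in>dil 4 (W l k). v - u \<in> XX" using l[of k, THEN exE] by metis
  let ?V = "{f \<in> X j. \<exists>u\<in>U. f - u \<in> W l k}"
  have V: "absolutely_convex ?V"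
    unfolding absolutely_convex_def
  proof (intro conjI ballI allI impI)
    have "0 \<in> X j" "0 \<in> U" "0 - 0 \<in> W l k"
      using complex_vs.subspace_0[OF subspace_X] absolutely_convex_zero[OF U(2)]
        absolutely_convex_zero[OF absolutely_convex_W] by simp_all
    then have "0 \<in> ?V" unfolding mem_Collect_eq by (intro conjI bexI[of _ 0])
    then show "?V \<noteq> {}" by (metis empty_iff)
    fix f g b c assume f: "f \<in> ?V" and g: "g \<in> ?V" and bc: "cmod b + cmod c \<le> 1"
    obtain u u' where u: "u \<in> U" "f - u \<in> W l k" "u' \<in> U" "g - u' \<in> W l k" using f g by blast
    have 1: "b *\<^sub>C u + c *\<^sub>C u' \<in> U" using U(2) u bc unfolding absolutely_convex_def by blast
    have "b *\<^sub>C (f - u) + c *\<^sub>C (g - u') \<in> W l k"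
      using absolutely_convex_W u bc unfolding absolutely_convex_def by blast
    also have "b *\<^sub>C (f - u) + c *\<^sub>C (g - u') = b *\<^sub>C f + c *\<^sub>C g - (b *\<^sub>C u + c *\<^sub>C u')"
      by (simp add: complex_vs.scale_right_diff_distrib)
    finally have 2: "b *\<^sub>C f + c *\<^sub>C g - (b *\<^sub>C u + c *\<^sub>C u') \<in> W l k" .
    have "b *\<^sub>C f + c *\<^sub>C g \<in> X j"
      using f g complex_vs.subspace_add[OF subspace_X] complex_vs.subspace_scale[OF subspace_X] by blast
    then show "b *\<^sub>C f + c *\<^sub>C g \<in> ?V" using 1 2 by blast
  qed
  have "zero_nhd (ANH G a j) ?V"
    by (rule zero_nhd_ANH[OF V _ absorbing_by_decomposition[OF U(2) abs j]]) auto
  then have nhd: "zero_nhd (ANH G a j) (dil (1 / (1 + \<rho>)) ?V)"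
    by (rule zero_nhd_dil[OF lcs_ANH]) (use \<rho> in simp)
  \<comment> \<open>For \<open>g\<close> in \<open>XX\<close> and \<open>u\<close> in
    \<open>U\<close> the difference \<open>g - u\<close> is again in \<open>XX\<close>, hence in
    \<open>XX \<inter> W l k\<close>, which lies in \<open>dil \<rho> U\<close>. So \<open>g\<close>
    lies in \<open>1 + \<rho>\<close> times \<open>U\<close>.\<close>
  have "XX \<inter> dil (1 / (1 + \<rho>)) ?V \<subseteq> U"
  proof
    fix f assume f: "f \<in> XX \<inter> dil (1 / (1 + \<rho>)) ?V"
    then obtain g where g: "g \<in> ?V" "f = complex_of_real (1 / (1 + \<rho>)) *\<^sub>C g" by blast
    have "complex_of_real (1 + \<rho>) * complex_of_real (1 / (1 + \<rho>)) = 1"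
      using \<rho>(1) by (simp flip: of_real_mult del: of_real_add)
    then have "complex_of_real (1 + \<rho>) *\<^sub>C f = g" unfolding g(2) scaleC_scaleC by (simp add: scaleC_one)
    moreover have "complex_of_real (1 + \<rho>) *\<^sub>C f \<in> XX" using f complex_vs.subspace_scale[OF subspace_XX] by blast
    ultimately have gX: "g \<in> XX" by simp
    obtain u where u: "u \<in> U" "g - u \<in> W l k" using g(1) by blast
    have "g - u \<in> XX" using gX u(1) U(1) by (intro complex_vs.subspace_diff[OF subspace_XX]) auto
    then have 1: "g - u \<in> dil \<rho> U" using u(2) \<rho>(2) by blast
    have 2: "u \<in> dil 1 U" using u(1) by simp
    have "u + (g - u) \<in> dil (1 + \<rho>) U" by (rule dil_add[OF U(2) 2 1]) (use \<rho> in auto)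
    then have "complex_of_real (1 / (1 + \<rho>)) *\<^sub>C (u + (g - u)) \<in> U"
      using \<rho>(1) mem_dil_iff[of "1 + \<rho>" "u + (g - u)" U] by (metis add_pos_pos zero_less_one)
    then show "f \<in> U" unfolding g(2) by simp
  qed
  then show "zero_nhd (AH G a) U" using U(1) by (rule zero_nhd_AH[OF nhd])
qed

end

theorem theorem3p5:
  fixes G :: "(complex^'d) set" and a :: "nat \<Rightarrow> nat \<Rightarrow> complex^'d \<Rightarrow> real"
  assumes "open G" and "G \<noteq> {}"
    and "weight_system G a"
    and "balanced_setting G a"
  shows "(Proj1_is_zero (ANH_space G a) \<longrightarrow> ultrabornological (AH G a)) \<and>
         (ultrabornological (AH G a) \<longrightarrow> barrelled (AH G a)) \<and>
         (barrelled (AH G a) \<longrightarrow> wQ_in_tilde G a)"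
proof -
  interpret weighted_spectrum G a by unfold_locales (fact assms)+
  show ?thesis
    using Proj1_zero_imp_ultrabornological ultrabornological_imp_barrelled
      barrelled_imp_wQ[OF assms(4)] by blast
qed

end
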